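(* Let $H\in\mathcal{H}_2$ be given. Let $\hat H_k,\hat H_{k+1}\in\mathcal{M}$ be two consecutive iterates of IRKA for $H$ such that $\hat H_k$ has pairwise distinct poles. Then $$H-\hat H_{k+1}\perp\mathrm{T}_{\hat H_k}\mathcal{M},$$ i.e., $\hat H_{k+1}$ is an orthogonal projection of $H$ onto $\mathcal{M}$ along the normal space $(\mathrm{T}_{\hat H_k}\mathcal{M})^{\perp}$ of $\mathcal{M}$ at $\hat H_k$.
   Context: $\mathcal{H}_2=\mathcal{H}_2^{p\times m}(\mathbb{C}^+)$ is the Hardy space of analytic functions $F:\mathbb{C}^+\to\mathbb{C}^{p\times m}$ on the open right half-plane with $\sup_{\xi>0}\int_{-\infty}^{\infty}\|F(\xi+\mathrm{i}\omega)\|_{\mathrm{F}}^2\,d\omega<\infty$ and inner product $\langle F,G\rangle_{\mathcal{H}_2}=\frac{1}{2\pi}\int_{-\infty}^{\infty}\operatorname{tr}(F(\mathrm{i}\omega)^*G(\mathrm{i}\omega))\,d\omega$; $\perp$ is orthogonality in this inner product. $\mathcal{M}$ is the set of $\hat C(sI-\hat A)^{-1}\hat B$ with $\hat A\in\mathbb{C}^{r\times r}$ Hurwitz (all eigenvalues in the open left half-plane), $\hat B\in\mathbb{C}^{r\times m}$, $\hat C\in\mathbb{C}^{p\times r}$, and $(\hat A,\hat B,\hat C)$ minimal (least possible order). $\mathcal{M}$ is an embedded submanifold of $\mathcal{H}_2$ of complex dimension $r(m+p)$; its tangent space $\mathrm{T}_{\hat H}\mathcal{M}$ is viewed as a subspace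 of $\mathcal{H}_2$, namely the set of velocities $\gamma'(0)$ of smooth curves $\gamma$ in $\mathcal{M}$ with $\gamma(0)=\hat H$. IRKA (iterative rational Krylov algorithm): from an iterate $\hat H_k(s)=\sum_{i=1}^r\frac{c_ib_i^*}{s-\lambda_i}$ ($b_i\in\mathbb{C}^m$, $c_i\in\mathbb{C}^p$, distinct $\lambda_i$), the next iterate $\hat H_{k+1}$ is determined by the conditions $H(-\overline{\lambda_i})b_i=\hat H_{k+1}(-\overline{\lambda_i})b_i$, $c_i^*H(-\overline{\lambda_i})=c_i^*\hat H_{k+1}(-\overline{\lambda_i})$, $c_i^*H'(-\overline{\lambda_i})b_i=c_i^*\hat H_{k+1}'(-\overline{\lambda_i})b_i$ for $i=1,\dots,r$. *)

theory Defs
  imports "HOL-Analysis.Analysis"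
    "Jordan_Normal_Form.Gauss_Jordan_Elimination"
    "Jordan_Normal_Form.Char_Poly"
    "Jordan_Normal_Form.Schur_Decomposition"
begin

text \<open>
  Matrix sizes vary inside the statement (minimality compares realizations of different orders),
  so matrices are those of Jordan_Normal_Form, with carriers \<open>carrier_mat p m\<close>.
  A function on the open right half-plane is represented by a total function on the complex
  numbers; nothing below depends on its values outside the half-plane.
\<close>

section \<open>The Hardy space\<close>

definition frob_norm :: "complex mat \<Rightarrow> real" where
  "frob_norm A = sqrt (\<Sum>i<dim_row A. \<Sum>j<dim_col A. (cmod (A $$ (i, j)))\<^sup>2)"

definition mat_trace :: "complex mat \<Rightarrow> complex" where
  "mat_trace A = (\<Sum>i<dim_row A. A $$ (i, i))"

definition H2 :: "nat \<Rightarrow> nat \<Rightarrow> (complex \<Rightarrow> complex mat) set" where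
  "H2 p m = {F.
     (\<forall>s. Re s > 0 \<longrightarrow> F s \<in> carrier_mat p m) \<and>
     (\<forall>i<p. \<forall>j<m. (\<lambda>s. F s $$ (i, j)) holomorphic_on {s. Re s > 0}) \<and>
     (SUP \<xi>\<in>{0<..}. \<integral>\<^sup>+\<omega>. ennreal ((frob_norm (F (Complex \<xi> \<omega>)))\<^sup>2) \<partial>lborel) < \<infinity>}"

text \<open>
  The values \<open>F(i\<omega>)\<close> on the imaginary axis are boundary values: the limit of
  \<open>\<omega> \<mapsto> F(\<xi> + i\<omega>)\<close> in \<open>L\<^sup>2\<close> as \<open>\<xi>\<close> decreases to 0.  This determines the boundary
  function up to a null set, which the inner product does not see.
\<close>

definition is_boundary_function ::
    "nat \<Rightarrow> nat \<Rightarrow> (complex \<Rightarrow> complex mat) \<Rightarrow> (real \<Rightarrow> complex mat) \<Rightarrow> bool" where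
  "is_boundary_function p m F f \<longleftrightarrow>
     (\<forall>\<omega>. f \<omega> \<in> carrier_mat p m) \<and>
     (\<forall>i<p. \<forall>j<m. (\<lambda>\<omega>. f \<omega> $$ (i, j)) \<in> borel_measurable lborel) \<and>
     ((\<lambda>\<xi>. \<integral>\<^sup>+\<omega>. ennreal ((frob_norm (F (Complex \<xi> \<omega>) - f \<omega>))\<^sup>2) \<partial>lborel) \<longlongrightarrow> 0)
       (at_right 0)"

definition boundary_function ::
    "nat \<Rightarrow> nat \<Rightarrow> (complex \<Rightarrow> complex mat) \<Rightarrow> real \<Rightarrow> complex mat" where
  "boundary_function p m F = (SOME f. is_boundary_function p m F f)"

definition h2_inner ::
    "nat \<Rightarrow> nat \<Rightarrow> (complex \<Rightarrow> complex mat) \<Rightarrow> (complex \<Rightarrow> complex mat) \<Rightarrow> complex" where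
  "h2_inner p m F G = 1 / (2 * of_real pi) *
     (\<integral>\<omega>. mat_trace (mat_adjoint (boundary_function p m F \<omega>) * boundary_function p m G \<omega>) \<partial>lborel)"

definition h2_norm :: "nat \<Rightarrow> nat \<Rightarrow> (complex \<Rightarrow> complex mat) \<Rightarrow> real" where
  "h2_norm p m F = sqrt (Re (h2_inner p m F F))"

definition h2_perp ::
    "nat \<Rightarrow> nat \<Rightarrow> (complex \<Rightarrow> complex mat) \<Rightarrow> (complex \<Rightarrow> complex mat) set \<Rightarrow> bool" where
  "h2_perp p m F S \<longleftrightarrow> (\<forall>V\<in>S. h2_inner p m F V = 0)"

definition h2_orth_compl ::
    "nat \<Rightarrow> nat \<Rightarrow> (complex \<Rightarrow> complex mat) set \<Rightarrow> (complex \<Rightarrow> complex mat) set" where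
  "h2_orth_compl p m S = {F \<in> H2 p m. h2_perp p m F S}"

section \<open>The manifold of minimal stable realizations of order r\<close>

definition transfer ::
    "complex mat \<Rightarrow> complex mat \<Rightarrow> complex mat \<Rightarrow> complex \<Rightarrow> complex mat" where
  "transfer A B C s = C * the (mat_inverse (s \<cdot>\<^sub>m 1\<^sub>m (dim_row A) - A)) * B"

definition realization ::
    "nat \<Rightarrow> nat \<Rightarrow> nat \<Rightarrow> complex mat \<Rightarrow> complex mat \<Rightarrow> complex mat \<Rightarrow> bool" where
  "realization p m r A B C \<longleftrightarrow>
     A \<in> carrier_mat r r \<and> B \<in> carrier_mat r m \<and> C \<in> carrier_mat p r"

definition hurwitz :: "complex mat \<Rightarrow> bool" where
  "hurwitz A \<longleftrightarrow> (\<forall>k. eigenvalue A k \<longrightarrow> Re k < 0)"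

text \<open>
  Equality of two transfer functions as rational functions means equality at all points where
  both resolvents exist.  The competing realization need not be Hurwitz.
\<close>

definition minimal_realization ::
    "nat \<Rightarrow> nat \<Rightarrow> nat \<Rightarrow> complex mat \<Rightarrow> complex mat \<Rightarrow> complex mat \<Rightarrow> bool" where
  "minimal_realization p m r A B C \<longleftrightarrow>
     realization p m r A B C \<and>
     (\<forall>q A' B' C'. realization p m q A' B' C' \<and>
        (\<forall>s. \<not> eigenvalue A s \<and> \<not> eigenvalue A' s \<longrightarrow> transfer A B C s = transfer A' B' C' s)
        \<longrightarrow> r \<le> q)"

definition manifold_M :: "nat \<Rightarrow> nat \<Rightarrow> nat \<Rightarrow> (complex \<Rightarrow> complex mat) set" where
  "manifold_M p m r = {G. \<exists>A B C. minimal_realization p m r A B C \<and> hurwitz A \<and>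
     (\<forall>s. Re s > 0 \<longrightarrow> G s = transfer A B C s)}"

section \<open>Tangent space\<close>

definition h2_has_derivative_at ::
    "nat \<Rightarrow> nat \<Rightarrow> (real \<Rightarrow> complex \<Rightarrow> complex mat) \<Rightarrow> (complex \<Rightarrow> complex mat) \<Rightarrow> real \<Rightarrow> bool" where
  "h2_has_derivative_at p m \<gamma> V t \<longleftrightarrow> V \<in> H2 p m \<and>
     ((\<lambda>h. h2_norm p m (\<lambda>s. complex_of_real (1 / h) \<cdot>\<^sub>m (\<gamma> (t + h) s - \<gamma> t s) - V s)) \<longlongrightarrow> 0) (at 0)"

text \<open>
  Since the manifold is embedded, a curve in it is smooth iff it is smooth (infinitely often
  differentiable in the norm) as a curve in the ambient Hardy space.  The curve parameter is real;
  \<open>D n\<close> is the n-th derivative.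
\<close>

definition h2_smooth_curve ::
    "nat \<Rightarrow> nat \<Rightarrow> real \<Rightarrow> (real \<Rightarrow> complex \<Rightarrow> complex mat) \<Rightarrow> bool" where
  "h2_smooth_curve p m \<epsilon> \<gamma> \<longleftrightarrow>
     (\<exists>D. D 0 = \<gamma> \<and>
        (\<forall>n::nat. \<forall>t\<in>{-\<epsilon><..<\<epsilon>}. D n t \<in> H2 p m \<and> h2_has_derivative_at p m (D n) (D (Suc n) t) t))"

definition tangent_space ::
    "nat \<Rightarrow> nat \<Rightarrow> nat \<Rightarrow> (complex \<Rightarrow> complex mat) \<Rightarrow> (complex \<Rightarrow> complex mat) set" where
  "tangent_space p m r G = {V. \<exists>\<epsilon>>0. \<exists>\<gamma>. h2_smooth_curve p m \<epsilon> \<gamma> \<and>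
     (\<forall>t\<in>{-\<epsilon><..<\<epsilon>}. \<gamma> t \<in> manifold_M p m r) \<and> \<gamma> 0 = G \<and> h2_has_derivative_at p m \<gamma> V 0}"

definition mfd_normal_space ::
    "nat \<Rightarrow> nat \<Rightarrow> nat \<Rightarrow> (complex \<Rightarrow> complex mat) \<Rightarrow> (complex \<Rightarrow> complex mat) set" where
  "mfd_normal_space p m r G = h2_orth_compl p m (tangent_space p m r G)"

definition is_projection_along ::
    "(complex \<Rightarrow> complex mat) set \<Rightarrow> (complex \<Rightarrow> complex mat) set \<Rightarrow>
     (complex \<Rightarrow> complex mat) \<Rightarrow> (complex \<Rightarrow> complex mat) \<Rightarrow> bool" where
  "is_projection_along S N H P \<longleftrightarrow> P \<in> S \<and> (\<lambda>s. H s - P s) \<in> N"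

section \<open>The iterative rational Krylov algorithm\<close>

definition deriv_mat :: "nat \<Rightarrow> nat \<Rightarrow> (complex \<Rightarrow> complex mat) \<Rightarrow> complex \<Rightarrow> complex mat" where
  "deriv_mat p m F s = Matrix.mat p m (\<lambda>(j, l). deriv (\<lambda>z. F z $$ (j, l)) s)"

text \<open>
  The vectors \<open>b i\<close> and \<open>c i\<close> are column matrices, so that \<open>c i * mat_adjoint (b i)\<close> is the
  residue and \<open>mat_adjoint (c i) * H z\<close> a row.
\<close>

definition pole_residue_form ::
    "nat \<Rightarrow> nat \<Rightarrow> nat \<Rightarrow> (complex \<Rightarrow> complex mat) \<Rightarrow>
     (nat \<Rightarrow> complex) \<Rightarrow> (nat \<Rightarrow> complex mat) \<Rightarrow> (nat \<Rightarrow> complex mat) \<Rightarrow> bool" where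
  "pole_residue_form p m r G lam b c \<longleftrightarrow>
     (\<forall>i<r. b i \<in> carrier_mat m 1 \<and> c i \<in> carrier_mat p 1) \<and>
     (\<forall>s. Re s > 0 \<longrightarrow>
        G s = Matrix.mat p m (\<lambda>(j, l). \<Sum>i<r. (c i * mat_adjoint (b i)) $$ (j, l) / (s - lam i)))"

text \<open>
  \<open>Hnew\<close> is a next iterate for \<open>H\<close> after the iterate with pole-residue data \<open>lam, b, c\<close>;
  the conditions apply at the mirror images \<open>- cnj (lam i)\<close> of the poles.
\<close>

definition irka_next ::
    "nat \<Rightarrow> nat \<Rightarrow> nat \<Rightarrow> (complex \<Rightarrow> complex mat) \<Rightarrow>
     (nat \<Rightarrow> complex) \<Rightarrow> (nat \<Rightarrow> complex mat) \<Rightarrow> (nat \<Rightarrow> complex mat) \<Rightarrow>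
     (complex \<Rightarrow> complex mat) \<Rightarrow> bool" where
  "irka_next p m r H lam b c Hnew \<longleftrightarrow>
     (\<forall>i<r. let \<sigma> = - cnj (lam i) in
        H \<sigma> * b i = Hnew \<sigma> * b i \<and>
        mat_adjoint (c i) * H \<sigma> = mat_adjoint (c i) * Hnew \<sigma> \<and>
        mat_adjoint (c i) * deriv_mat p m H \<sigma> * b i =
          mat_adjoint (c i) * deriv_mat p m Hnew \<sigma> * b i)"

end

theory Submission
  imports Defs "HOL-Complex_Analysis.Complex_Analysis" "HOL-Probability.Sinc_Integral"
begin

text \<open>
  A curve in the manifold can be reconstructed from finitely many of its values: if \<open>G\<close> has a
  realization of order \<open>r\<close>, then \<open>G(s) = W K\<^sup>-\<^sup>1 Y\<close>, where \<open>W\<close>, \<open>Y\<close> and the shifted Loewner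
  matrix \<open>K\<close> depend linearly on values of \<open>G\<close> at \<open>2r\<close> points of the right half-plane.  Point
  evaluations are continuous in the Hardy norm, so this formula can be differentiated along the
  curve.  No smooth choice of realizations is needed, and every tangent vector at
  \<open>\<Sum> c\<^sub>i b\<^sub>i\<^sup>* / (s - \<lambda>\<^sub>i)\<close> comes out as a combination of terms \<open>c\<^sub>i x\<^sup>* / (s - \<lambda>\<^sub>i)\<close>,
  \<open>y b\<^sub>i\<^sup>* / (s - \<lambda>\<^sub>i)\<close> and \<open>(\<kappa> + \<kappa>' s) c\<^sub>i b\<^sub>j\<^sup>* / ((s - \<lambda>\<^sub>i)(s - \<lambda>\<^sub>j))\<close>.

  The interpolation conditions say that the error, contracted with these residues, vanishes at the
  mirror images of the poles (to second order for a double pole).  The integrand of the inner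
  product is then holomorphic in the right half-plane and decays, so the integral over a vertical
  line does not depend on the line and tends to 0 as the line moves to the right.

  Boundary functions exist because the inner product of \<open>F(\<xi> + i\<cdot>)\<close> and \<open>F(\<eta> + i\<cdot>)\<close> depends only
  on \<open>\<xi> + \<eta>\<close>: by the parallelogram identity the norm on vertical lines is midpoint convex, hence
  antitone, and the restrictions to vertical lines are Cauchy in \<open>L\<^sup>2\<close> as \<open>\<xi>\<close> decreases to 0.
\<close>

section \<open>Square integrable functions and vertical lines\<close>

text \<open>The inner product conjugates one factor, and a conjugated function is not holomorphic.
  On the imaginary axis, however, \<open>cnj (V s)\<close> equals \<open>cnj (V (- cnj s))\<close>,
  which is holomorphic in \<open>s\<close> with poles at the mirror images
  \<open>- cnj (lam k)\<close>. Leaving the axis therefore means reading the error on the line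
  \<open>Re s = x\<close> and the tangent vector on \<open>Re s = -x\<close>; this is possible
  because a tangent vector is rational and continues past the axis. The zeros of the error cancel
  exactly those mirrored poles.

  Contour shifts cannot rely on pointwise decay along horizontal segments; they rest on integral
  bounds for each vertical line.

  The determinant of \<open>K\<close> must not vanish at the base point. For the diagonal
  realization, \<open>K\<close> factors through two scaled Cauchy matrices whose weights are the
  tangential data applied to the residue vectors. Minimality makes all residues nonzero, so generic
  data make all weights nonzero. Nonzero residues also force the poles \<open>lam k\<close>, which
  are not assumed stable, into the left half-plane: each is an eigenvalue of a Hurwitz
  matrix.\<close>

text \<open>By Fubini the horizontal contributions at height \<open>T\<close> have a finite integral
  over all \<open>T\<close>, so they cannot stay bounded away from 0. This takes the place of decay
  on the horizontal sides of a rectangle.\<close>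

lemma line_integral_shift:
  fixes g :: "complex \<Rightarrow> complex"
  assumes holo: "g holomorphic_on {s. lo < Re s \<and> Re s < hi}" 
    and ab: "lo < a" "a \<le> b" "b < hi"
    and bnd: "\<And>\<xi>. a \<le> \<xi> \<Longrightarrow> \<xi> \<le> b \<Longrightarrow>
      (\<integral>\<^sup>+\<omega>. ennreal (cmod (g (Complex \<xi> \<omega>))) \<partial>lborel) \<le> ennreal M"
  shows "(\<integral>\<omega>. g (Complex a \<omega>) \<partial>lborel) = (\<integral>\<omega>. g (Complex b \<omega>) \<partial>lborel)"
proof -
  define S where "S = {s. lo < Re s \<and> Re s < hi}"
  have S: "open S" "convex S"
  proof -
    have eq: "S = {s. lo < Re s} \<inter> {s. Re s < hi}" by (auto simp: S_def)
    show "open S" unfolding eq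
      by (intro open_Int open_halfspace_Re_gt open_halfspace_Re_lt)
    show "convex S" unfolding eq
      by (intro convex_Int convex_halfspace_Re_gt convex_halfspace_Re_lt)
  qed
  obtain G where G: "\<And>x. x \<in> S \<Longrightarrow> (G has_field_derivative g x) (at x within S)"
    using holomorphic_convex_primitive'[OF S(2,1) holo[folded S_def]] by blast
  have contg: "continuous_on S g"
    using holo holomorphic_on_imp_continuous_on S_def by auto
  have inS: "Complex \<xi> \<omega> \<in> S" if "a \<le> \<xi>" "\<xi> \<le> b" for \<xi> \<omega>
    using that ab by (auto simp: S_def)
  have Gd: "(G has_field_derivative g x) (at x)" if "x \<in> S" for x
    using G[OF that] unfolding at_within_open[OF that S(1)] .
  have contl: "continuous_on UNIV (\<lambda>\<omega>. g (Complex \<xi> \<omega>))" if "a \<le> \<xi>" "\<xi> \<le> b" for \<xi>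
    by (rule continuous_on_compose2[OF contg]) (auto intro!: continuous_intros inS that)
  have integr: "integrable lborel (\<lambda>\<omega>. g (Complex \<xi> \<omega>))" if "a \<le> \<xi>" "\<xi> \<le> b" for \<xi>
  proof (rule integrableI_bounded)
    show "(\<lambda>\<omega>. g (Complex \<xi> \<omega>)) \<in> borel_measurable lborel"
      using borel_measurable_continuous_onI[OF contl[OF that]] by simp
    show "(\<integral>\<^sup>+ x. ennreal (norm (g (Complex \<xi> x))) \<partial>lborel) < \<infinity>"
      using bnd[OF that] by (rule order_le_less_trans) simp
  qed
  \<comment> \<open>\<open>D T\<close> is the integral of \<open>g\<close> over the horizontal
    segment at height \<open>T\<close>, by the primitive \<open>G\<close>; \<open>h T\<close> bounds
    its modulus.\<close>
  define D where "D T = G (Complex b T) - G (Complex a T)" for T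
  define h where "h T = (\<integral>\<^sup>+\<xi>. ennreal (cmod (g (Complex \<xi> T))) * indicator {a..b} \<xi> \<partial>lborel)" for T
  have meas2: "(\<lambda>x. ennreal (cmod (g (Complex (fst x) (snd x)))) * indicator {a..b} (fst x)) \<in> borel_measurable (lborel \<Otimes>\<^sub>M lborel)"
  proof -
    have "continuous_on ({a..b} \<times> UNIV) (\<lambda>x. g (Complex (fst x) (snd x)))"
      by (rule continuous_on_compose2[OF contg]) (auto intro!: continuous_intros inS)
    then have m: "(\<lambda>x. indicator ({a..b} \<times> UNIV) x *\<^sub>R g (Complex (fst x) (snd x))) \<in> borel_measurable borel"
      by (intro borel_measurable_continuous_on_indicator) (auto intro: borel_closed closed_Times)
    have "(\<lambda>x. ennreal (cmod (g (Complex (fst x) (snd x)))) * indicator {a..b} (fst x)) 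
       = (\<lambda>x. ennreal (cmod (indicator ({a..b} \<times> UNIV) x *\<^sub>R g (Complex (fst x) (snd x)))))"
      by (auto simp: fun_eq_iff indicator_def)
    also have "\<dots> \<in> borel_measurable borel"
      by (intro measurable_compose[OF m] measurable_compose[OF _ measurable_ennreal]) auto
    finally show ?thesis by (simp add: lborel_prod)
  qed
  have hm[measurable]: "h \<in> borel_measurable lborel"
    unfolding h_def
  proof (rule lborel.borel_measurable_nn_integral)
    have "(\<lambda>x. (snd x, fst x)) \<in> measurable (lborel \<Otimes>\<^sub>M lborel) (lborel \<Otimes>\<^sub>M (lborel :: real measure))"
      by measurable
    from measurable_compose[OF this meas2]
    show "(\<lambda>(T, \<xi>). ennreal (cmod (g (Complex \<xi> T))) * indicator {a..b} \<xi>) \<in> borel_measurable (lborel \<Otimes>\<^sub>M lborel)"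
      by (simp add: case_prod_beta')
  qed
  have hint: "(\<integral>\<^sup>+T. h T \<partial>lborel) \<le> ennreal M * ennreal (b - a)"
  proof -
    have "(\<integral>\<^sup>+T. h T \<partial>lborel) = (\<integral>\<^sup>+\<xi>. (\<integral>\<^sup>+T. ennreal (cmod (g (Complex \<xi> T))) * indicator {a..b} \<xi> \<partial>lborel) \<partial>lborel)"
      unfolding h_def
      by (subst lborel_pair.Fubini') (use meas2 in \<open>auto simp: case_prod_beta'\<close>)
    also have "\<dots> \<le> (\<integral>\<^sup>+\<xi>. ennreal M * indicator {a..b} \<xi> \<partial>lborel)"
    proof (rule nn_integral_mono)
      fix \<xi> :: real
      show "(\<integral>\<^sup>+T. ennreal (cmod (g (Complex \<xi> T))) * indicator {a..b} \<xi> \<partial>lborel) \<le> ennreal M * indicator {a..b} \<xi>"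
        by (cases "\<xi> \<in> {a..b}") (use bnd in auto)
    qed
    also have "\<dots> = ennreal M * ennreal (b - a)" using ab by (simp add: nn_integral_cmult)
    finally show ?thesis .
  qed
  have Dh: "ennreal (cmod (D T)) \<le> h T" for T
  proof -
    have "((\<lambda>\<xi>. G (Complex \<xi> T)) has_vector_derivative g (Complex \<xi> T)) (at \<xi> within {a..b})" if "\<xi> \<in> {a..b}" for \<xi>
    proof -
      have "((\<lambda>\<xi>. Complex \<xi> T) has_vector_derivative 1) (at \<xi> within {a..b})"
        unfolding Complex_eq by (auto intro!: derivative_eq_intros)
      from field_vector_diff_chain_within[OF this] Gd[OF inS, of \<xi> T] that
      show ?thesis by (auto simp: o_def intro: has_field_derivative_at_within)
    qed
    moreover have c: "continuous_on {a..b} (\<lambda>\<xi>. g (Complex \<xi> T))"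
      by (rule continuous_on_compose2[OF contg]) (auto intro!: continuous_intros inS)
    ultimately have 1: "(\<integral>\<xi>. indicator {a..b} \<xi> *\<^sub>R g (Complex \<xi> T) \<partial>lborel) = D T"
      unfolding D_def using ab by (intro integral_FTC_atLeastAtMost) auto
    have m: "(\<lambda>\<xi>. indicator {a..b} \<xi> *\<^sub>R g (Complex \<xi> T)) \<in> borel_measurable lborel"
      using borel_measurable_continuous_on_indicator[OF _ c] by simp
    show "ennreal (cmod (D T)) \<le> h T"
    proof (cases "integrable lborel (\<lambda>\<xi>. indicator {a..b} \<xi> *\<^sub>R g (Complex \<xi> T))")
      case True
      have "ennreal (cmod (D T)) \<le> (\<integral>\<^sup>+\<xi>. norm (indicator {a..b} \<xi> *\<^sub>R g (Complex \<xi> T)) \<partial>lborel)"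
        unfolding 1[symmetric] by (rule integral_norm_bound_ennreal[OF True])
      also have "\<dots> = h T" unfolding h_def by (intro nn_integral_cong) (auto simp: indicator_def)
      finally show ?thesis .
    next
      \<comment> \<open>The Bochner integral of a nonintegrable function is 0 by convention, so here
        \<open>D T = 0\<close>.\<close>
      case False
      then show ?thesis using 1 not_integrable_integral_eq[OF False] by simp
    qed
  qed
  define k where "k \<omega> = g (Complex b \<omega>) - g (Complex a \<omega>)" for \<omega>
  have kint: "integrable lborel k" unfolding k_def using integr ab by auto
  have kT: "\<i> * (\<integral>\<omega>. indicator {-T..T} \<omega> *\<^sub>R k \<omega> \<partial>lborel) = D T - D (-T)" if "T \<ge> 0" for T
  proof -
    have vd: "((\<lambda>\<omega>. G (Complex \<xi> \<omega>)) has_vector_derivative \<i> * g (Complex \<xi> \<omega>)) (at \<omega> within X)" if "a \<le> \<xi>" "\<xi> \<le> b" for \<xi> \<omega> X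
    proof -
      have "((\<lambda>\<omega>. Complex \<xi> \<omega>) has_vector_derivative \<i>) (at \<omega> within X)"
        unfolding Complex_eq by (auto intro!: derivative_eq_intros)
      from field_vector_diff_chain_within[OF this] Gd[OF inS, of \<xi> \<omega>] that
      show ?thesis by (auto simp: o_def intro: has_field_derivative_at_within)
    qed
    have "(\<integral>\<omega>. indicator {-T..T} \<omega> *\<^sub>R (\<i> * k \<omega>) \<partial>lborel) = D T - D (-T)"
    proof (rule integral_FTC_atLeastAtMost)
      show "-T \<le> T" using that by simp
      fix \<omega> assume "-T \<le> \<omega>" "\<omega> \<le> T"
      show "(D has_vector_derivative \<i> * k \<omega>) (at \<omega> within {-T..T})"
        unfolding D_def k_def right_diff_distrib
        by (intro has_vector_derivative_diff vd) (use ab in auto)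
    next
      show "continuous_on {-T..T} (\<lambda>x. \<i> * k x)" unfolding k_def
        by (intro continuous_intros continuous_on_subset[OF contl]) (use ab in auto)
    qed
    moreover have "(\<integral>\<omega>. indicator {-T..T} \<omega> *\<^sub>R (\<i> * k \<omega>) \<partial>lborel) = (\<integral>\<omega>. \<i> * (indicator {-T..T} \<omega> *\<^sub>R k \<omega>) \<partial>lborel)"
      by (simp only: mult_scaleR_right)
    moreover have "\<dots> = \<i> * (\<integral>\<omega>. indicator {-T..T} \<omega> *\<^sub>R k \<omega> \<partial>lborel)"
      by (rule Bochner_Integration.integral_mult_right_zero)
    ultimately show ?thesis by (simp only:)
  qed
  have lim: "((\<lambda>T. \<integral>\<omega>. indicator {-T..T} \<omega> *\<^sub>R k \<omega> \<partial>lborel) \<longlongrightarrow> (\<integral>\<omega>. k \<omega> \<partial>lborel)) at_top"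
  proof (rule integral_dominated_convergence_at_top[where w="\<lambda>\<omega>. norm (k \<omega>)"])
    show "k \<in> borel_measurable lborel" using kint by auto
    then show "(\<lambda>x. indicator {- t..t} x *\<^sub>R k x) \<in> borel_measurable lborel" for t by measurable
    show "\<forall>\<^sub>F t in at_top. AE x in lborel. norm (indicator {- t..t} x *\<^sub>R k x) \<le> norm (k x)"
      by (auto simp: indicator_def)
    show "AE x in lborel. ((\<lambda>t. indicator {- t..t} x *\<^sub>R k x) \<longlongrightarrow> k x) at_top"
    proof (rule AE_I2, rule tendsto_eventually)
      fix x :: real
      show "\<forall>\<^sub>F t in at_top. indicator {- t..t} x *\<^sub>R k x = k x"
        using eventually_ge_at_top[of "\<bar>x\<bar>"] by eventually_elim (auto simp: indicator_def)
    qed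
    show "integrable lborel (\<lambda>\<omega>. norm (k \<omega>))" using kint by auto
  qed
  \<comment> \<open>If this limit were nonzero, \<open>h T + h (-T)\<close> would be at least half
    its modulus for all large \<open>T\<close>, and \<open>h\<close> would have infinite
    integral.\<close>
  have "(\<integral>\<omega>. k \<omega> \<partial>lborel) = 0"
  proof (rule ccontr)
    define I where "I = (\<integral>\<omega>. k \<omega> \<partial>lborel)"
    assume "(\<integral>\<omega>. k \<omega> \<partial>lborel) \<noteq> 0"
    then have I: "cmod I > 0" by (simp add: I_def)
    have "\<forall>\<^sub>F T in at_top. cmod I / 2 < cmod (\<integral>\<omega>. indicator {-T..T} \<omega> *\<^sub>R k \<omega> \<partial>lborel)"
      using order_tendstoD(1)[OF tendsto_norm[OF lim], of "cmod I / 2"] I by (simp add: I_def)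
    then obtain N0 where N0: "\<And>T. T \<ge> N0 \<Longrightarrow> cmod I / 2 < cmod (\<integral>\<omega>. indicator {-T..T} \<omega> *\<^sub>R k \<omega> \<partial>lborel)"
      by (auto simp: eventually_at_top_linorder)
    define N where "N = max 0 N0"
    have low: "ennreal (cmod I / 2) \<le> h T + h (-T)" if "T \<ge> N" for T
    proof -
      have "cmod I / 2 \<le> cmod (\<i> * (\<integral>\<omega>. indicator {-T..T} \<omega> *\<^sub>R k \<omega> \<partial>lborel))"
        using N0[of T] that by (simp add: norm_mult N_def)
      also have "\<dots> \<le> cmod (D T) + cmod (D (-T))"
        using that by (subst kT) (auto simp: N_def norm_triangle_ineq4)
      finally have "ennreal (cmod I / 2) \<le> ennreal (cmod (D T)) + ennreal (cmod (D (-T)))"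
        by (metis ennreal_leI ennreal_plus norm_ge_zero)
      also have "\<dots> \<le> h T + h (-T)" by (intro add_mono Dh)
      finally show ?thesis .
    qed
    have Ninf: "emeasure lborel {N..} = \<infinity>"
    proof (rule ccontr)
      assume "emeasure lborel {N..} \<noteq> \<infinity>"
      then obtain r where r: "emeasure lborel {N..} = ennreal r" "r \<ge> 0" by (cases "emeasure lborel {N..}") auto
      have "emeasure lborel {N..N + (r + 1)} \<le> emeasure lborel {N..}" by (rule emeasure_mono) auto
      then show False using r by simp
    qed
    have "(\<infinity>::ennreal) = (\<integral>\<^sup>+T. ennreal (cmod I / 2) * indicator {N..} T \<partial>lborel)"
      using I Ninf by (simp add: nn_integral_cmult ennreal_mult_top)
    also have "\<dots> \<le> (\<integral>\<^sup>+T. h T + h (-T) \<partial>lborel)"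
      by (intro nn_integral_mono) (auto simp: indicator_def low)
    also have "\<dots> = (\<integral>\<^sup>+T. h T \<partial>lborel) + (\<integral>\<^sup>+T. h (-T) \<partial>lborel)"
      by (intro nn_integral_add) measurable
    also have "(\<integral>\<^sup>+T. h (-T) \<partial>lborel) = (\<integral>\<^sup>+T. h T \<partial>lborel)"
      using nn_integral_real_affine[of h "-1" 0] by simp
    also have "(\<integral>\<^sup>+T. h T \<partial>lborel) + (\<integral>\<^sup>+T. h T \<partial>lborel) < \<infinity>"
      using order_le_less_trans[OF hint] by (simp add: ennreal_mult_less_top)
    finally show False by simp
  qed
  then show ?thesis unfolding k_def using integr ab by simp
qed

section \<open>Square integrable functions on the real line\<close>

definition nrm2 :: "(real \<Rightarrow> complex) \<Rightarrow> ennreal" where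
  "nrm2 f = (\<integral>\<^sup>+\<omega>. ennreal ((cmod (f \<omega>))\<^sup>2) \<partial>lborel)"

definition sqint :: "(real \<Rightarrow> complex) \<Rightarrow> bool" where
  "sqint f \<longleftrightarrow> f \<in> borel_measurable lborel \<and> nrm2 f < \<infinity>"

text \<open>\<open>enn2real\<close> sends infinity to 0, so this is the norm only for functions that
  satisfy \<open>sqint\<close>.\<close>

definition l2 :: "(real \<Rightarrow> complex) \<Rightarrow> real" where
  "l2 f = sqrt (enn2real (nrm2 f))"

lemma sqint_meas: "sqint f \<Longrightarrow> f \<in> borel_measurable lborel"
  by (simp add: sqint_def)

lemma l2_nonneg: "0 \<le> l2 f"
  by (simp add: l2_def)

lemma nrm2_eq_l2: "sqint f \<Longrightarrow> nrm2 f = ennreal ((l2 f)\<^sup>2)"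
  by (simp add: l2_def sqint_def)

lemma sqint_integrable:
  assumes "sqint f"
  shows "integrable lborel (\<lambda>\<omega>. (cmod (f \<omega>))\<^sup>2)"
proof (rule integrableI_bounded)
  show "(\<lambda>\<omega>. (cmod (f \<omega>))\<^sup>2) \<in> borel_measurable lborel"
    using sqint_meas[OF assms] by measurable
  show "(\<integral>\<^sup>+ x. ennreal (norm ((cmod (f x))\<^sup>2)) \<partial>lborel) < \<infinity>"
    using assms by (simp add: sqint_def nrm2_def)
qed

lemma l2_squared:
  assumes "sqint f"
  shows "(l2 f)\<^sup>2 = (\<integral>\<omega>. (cmod (f \<omega>))\<^sup>2 \<partial>lborel)"
proof -
  have "nrm2 f = ennreal (\<integral>\<omega>. (cmod (f \<omega>))\<^sup>2 \<partial>lborel)"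
    unfolding nrm2_def by (rule nn_integral_eq_integral[OF sqint_integrable[OF assms]]) auto
  then show ?thesis by (simp add: l2_def)
qed

text \<open>The inequality \<open>(x + y)^2 <= 2 x^2 + 2 y^2\<close> serves instead of Minkowski and
  stays within the extended nonnegative numbers.\<close>

lemma nrm2_add_le:
  assumes "f \<in> borel_measurable lborel" "g \<in> borel_measurable lborel"
  shows "nrm2 (\<lambda>\<omega>. f \<omega> + g \<omega>) \<le> 2 * nrm2 f + 2 * nrm2 g"
proof -
  note [measurable] = assms
  have "nrm2 (\<lambda>\<omega>. f \<omega> + g \<omega>) \<le> (\<integral>\<^sup>+\<omega>. 2 * ennreal ((cmod (f \<omega>))\<^sup>2) + 2 * ennreal ((cmod (g \<omega>))\<^sup>2) \<partial>lborel)"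
    unfolding nrm2_def
  proof (rule nn_integral_mono)
    fix \<omega>
    have "(cmod (f \<omega> + g \<omega>))\<^sup>2 \<le> (cmod (f \<omega>) + cmod (g \<omega>))\<^sup>2"
      by (intro power_mono norm_triangle_ineq) auto
    also have "\<dots> \<le> 2 * (cmod (f \<omega>))\<^sup>2 + 2 * (cmod (g \<omega>))\<^sup>2"
      using sum_squares_bound[of "cmod (f \<omega>)" "cmod (g \<omega>)"] by (simp add: power2_sum)
    finally have "ennreal ((cmod (f \<omega> + g \<omega>))\<^sup>2) \<le> ennreal (2 * (cmod (f \<omega>))\<^sup>2 + 2 * (cmod (g \<omega>))\<^sup>2)"
      by (rule ennreal_leI)
    then show "ennreal ((cmod (f \<omega> + g \<omega>))\<^sup>2) \<le> 2 * ennreal ((cmod (f \<omega>))\<^sup>2) + 2 * ennreal ((cmod (g \<omega>))\<^sup>2)"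
      by (simp add: ennreal_plus ennreal_mult)
  qed
  also have "\<dots> = 2 * nrm2 f + 2 * nrm2 g"
    unfolding nrm2_def by (simp add: nn_integral_add nn_integral_cmult)
  finally show ?thesis .
qed

lemma nrm2_cmult:
  assumes "f \<in> borel_measurable lborel"
  shows "nrm2 (\<lambda>\<omega>. c * f \<omega>) = ennreal ((cmod c)\<^sup>2) * nrm2 f"
proof -
  note [measurable] = assms
  show ?thesis
    unfolding nrm2_def by (simp add: nn_integral_cmult norm_mult power_mult_distrib ennreal_mult)
qed

lemma nrm2_uminus: "nrm2 (\<lambda>\<omega>. - f \<omega>) = nrm2 f"
  by (simp add: nrm2_def)

lemma nrm2_minus_commute: "nrm2 (\<lambda>\<omega>. f \<omega> - g \<omega>) = nrm2 (\<lambda>\<omega>. g \<omega> - f \<omega>)"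
  by (simp add: nrm2_def norm_minus_commute)

lemma nrm2_diff_le:
  assumes "f \<in> borel_measurable lborel" "g \<in> borel_measurable lborel"
  shows "nrm2 (\<lambda>\<omega>. f \<omega> - g \<omega>) \<le> 2 * nrm2 f + 2 * nrm2 g"
  using nrm2_add_le[OF assms(1), of "\<lambda>\<omega>. - g \<omega>"] assms(2) by (simp add: nrm2_uminus)

lemma sqint_diff: "sqint f \<Longrightarrow> sqint g \<Longrightarrow> sqint (\<lambda>\<omega>. f \<omega> - g \<omega>)"
  unfolding sqint_def
  by (auto intro!: order_le_less_trans[OF nrm2_diff_le] simp: ennreal_mult_less_top)

lemma sqint_cnj: "sqint f \<Longrightarrow> sqint (\<lambda>\<omega>. cnj (f \<omega>))"
  unfolding sqint_def nrm2_def
  by (auto intro: borel_measurable_continuous_on[OF continuous_on_cnj[OF continuous_on_id]])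

lemma nrm2_cnj: "nrm2 (\<lambda>\<omega>. cnj (f \<omega>)) = nrm2 f"
  by (simp add: nrm2_def)

lemma nn_integral_mult_le:
  assumes "sqint f" "sqint g"
  shows "(\<integral>\<^sup>+\<omega>. ennreal (cmod (f \<omega> * g \<omega>)) \<partial>lborel) \<le> ennreal (l2 f * l2 g)"
proof -
  note [measurable] = sqint_meas[OF assms(1)] sqint_meas[OF assms(2)]
  define X where "X = (\<integral>\<^sup>+\<omega>. ennreal (cmod (f \<omega> * g \<omega>)) \<partial>lborel)"
  have "X\<^sup>2 = (\<integral>\<^sup>+\<omega>. ennreal (cmod (f \<omega>)) * ennreal (cmod (g \<omega>)) \<partial>lborel)\<^sup>2"
    by (simp add: X_def norm_mult ennreal_mult)
  also have "\<dots> \<le> (\<integral>\<^sup>+\<omega>. (ennreal (cmod (f \<omega>)))\<^sup>2 \<partial>lborel) * (\<integral>\<^sup>+\<omega>. (ennreal (cmod (g \<omega>)))\<^sup>2 \<partial>lborel)"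
    by (rule Cauchy_Schwarz_nn_integral) measurable
  also have "\<dots> = nrm2 f * nrm2 g" by (simp add: nrm2_def ennreal_power)
  also have "\<dots> = ennreal ((l2 f * l2 g)\<^sup>2)"
    by (simp add: nrm2_eq_l2 assms ennreal_mult power_mult_distrib)
  finally have le: "X\<^sup>2 \<le> ennreal ((l2 f * l2 g)\<^sup>2)" .
  have "X \<noteq> \<infinity>" 
  proof
    assume "X = \<infinity>" with le show False by (simp add: ennreal_top_mult power2_eq_square top_unique)
  qed
  then obtain x where x: "X = ennreal x" "x \<ge> 0" by (cases X) auto
  have "x \<le> l2 f * l2 g"
    by (rule power2_le_imp_le) (use le x l2_nonneg in \<open>auto simp: ennreal_power\<close>)
  then show ?thesis using x by (simp add: X_def[symmetric] ennreal_leI)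
qed

lemma sqint_mult_integrable:
  assumes "sqint f" "sqint g"
  shows "integrable lborel (\<lambda>\<omega>. f \<omega> * g \<omega>)"
proof (rule integrableI_bounded)
  show "(\<lambda>\<omega>. f \<omega> * g \<omega>) \<in> borel_measurable lborel"
    using assms[THEN sqint_meas] by measurable
  show "(\<integral>\<^sup>+ x. ennreal (norm (f x * g x)) \<partial>lborel) < \<infinity>"
    using nn_integral_mult_le[OF assms] by (rule order_le_less_trans) simp
qed

lemma integral_mult_le:
  assumes "sqint f" "sqint g"
  shows "cmod (\<integral>\<omega>. f \<omega> * g \<omega> \<partial>lborel) \<le> l2 f * l2 g"
proof -
  have "ennreal (cmod (\<integral>\<omega>. f \<omega> * g \<omega> \<partial>lborel)) \<le> ennreal (l2 f * l2 g)"
    using integral_norm_bound_ennreal[OF sqint_mult_integrable[OF assms]] nn_integral_mult_le[OF assms]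
    by (rule order_trans)
  then show ?thesis using l2_nonneg by simp
qed

text \<open>The difference of the products is
  \<open>(fn - f) (gn - g) + (fn - f) g + f (gn - g)\<close>, and Cauchy-Schwarz bounds each term.
  The filter is arbitrary because the lemma serves both one-sided limits and sequences.\<close>

lemma integral_mult_tendsto:
  assumes f: "sqint f" "\<forall>\<^sub>F n in F. sqint (fn n)" "((\<lambda>n. nrm2 (\<lambda>\<omega>. fn n \<omega> - f \<omega>)) \<longlongrightarrow> 0) F"
    and g: "sqint g" "\<forall>\<^sub>F n in F. sqint (gn n)" "((\<lambda>n. nrm2 (\<lambda>\<omega>. gn n \<omega> - g \<omega>)) \<longlongrightarrow> 0) F"
  shows "((\<lambda>n. \<integral>\<omega>. fn n \<omega> * gn n \<omega> \<partial>lborel) \<longlongrightarrow> (\<integral>\<omega>. f \<omega> * g \<omega> \<partial>lborel)) F"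
proof -
  define a where "a n = l2 (\<lambda>\<omega>. fn n \<omega> - f \<omega>)" for n
  define b where "b n = l2 (\<lambda>\<omega>. gn n \<omega> - g \<omega>)" for n
  have l2lim: "((\<lambda>n. l2 (h n)) \<longlongrightarrow> 0) F" if "((\<lambda>n. nrm2 (h n)) \<longlongrightarrow> 0) F" for h
  proof -
    have "((\<lambda>n. enn2real (nrm2 (h n))) \<longlongrightarrow> enn2real 0) F"
      using that by (intro tendsto_enn2real) auto
    then have "((\<lambda>n. sqrt (enn2real (nrm2 (h n)))) \<longlongrightarrow> sqrt 0) F"
      by (intro tendsto_real_sqrt) simp
    then show ?thesis by (simp add: l2_def)
  qed
  have lim: "(a \<longlongrightarrow> 0) F" "(b \<longlongrightarrow> 0) F"
    unfolding a_def b_def by (intro l2lim f g)+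
  have "((\<lambda>n. (\<integral>\<omega>. fn n \<omega> * gn n \<omega> \<partial>lborel) - (\<integral>\<omega>. f \<omega> * g \<omega> \<partial>lborel)) \<longlongrightarrow> 0) F"
  proof (rule tendsto_0_le[where K=1])
    show "((\<lambda>n. a n * b n + a n * l2 g + l2 f * b n) \<longlongrightarrow> 0) F"
      by (auto intro!: tendsto_eq_intros lim)
    show "\<forall>\<^sub>F n in F. norm ((\<integral>\<omega>. fn n \<omega> * gn n \<omega> \<partial>lborel) - (\<integral>\<omega>. f \<omega> * g \<omega> \<partial>lborel)) \<le> norm (a n * b n + a n * l2 g + l2 f * b n) * 1"
      using f(2) g(2)
    proof eventually_elim
      case (elim n)
      note fd = sqint_diff[OF elim(1) f(1)] and gd = sqint_diff[OF elim(2) g(1)]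
      note i1 = sqint_mult_integrable[OF fd gd] and i2 = sqint_mult_integrable[OF fd g(1)] and i3 = sqint_mult_integrable[OF f(1) gd]
      have "(\<integral>\<omega>. fn n \<omega> * gn n \<omega> \<partial>lborel) - (\<integral>\<omega>. f \<omega> * g \<omega> \<partial>lborel)
        = (\<integral>\<omega>. fn n \<omega> * gn n \<omega> - f \<omega> * g \<omega> \<partial>lborel)"
        by (intro Bochner_Integration.integral_diff[symmetric] sqint_mult_integrable elim f g)
      also have "\<dots> = (\<integral>\<omega>. (fn n \<omega> - f \<omega>) * (gn n \<omega> - g \<omega>) + (fn n \<omega> - f \<omega>) * g \<omega> + f \<omega> * (gn n \<omega> - g \<omega>) \<partial>lborel)"
        by (intro Bochner_Integration.integral_cong) (auto simp: algebra_simps)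
      also have "\<dots> = (\<integral>\<omega>. (fn n \<omega> - f \<omega>) * (gn n \<omega> - g \<omega>) \<partial>lborel) + (\<integral>\<omega>. (fn n \<omega> - f \<omega>) * g \<omega> \<partial>lborel) 
         + (\<integral>\<omega>. f \<omega> * (gn n \<omega> - g \<omega>) \<partial>lborel)"
        using Bochner_Integration.integral_add[OF Bochner_Integration.integrable_add[OF i1 i2] i3] 
          Bochner_Integration.integral_add[OF i1 i2] by simp
      also have "cmod \<dots> \<le> a n * b n + a n * l2 g + l2 f * b n"
        unfolding a_def b_def
        by (intro norm_triangle_le add_mono integral_mult_le fd gd f g)
      finally show ?case by simp
    qed
  qed
  then show ?thesis by (simp add: LIM_zero_iff)
qed

lemma sqint_limit:
  assumes "sqint f" "g \<in> borel_measurable lborel" "nrm2 (\<lambda>\<omega>. f \<omega> - g \<omega>) < \<infinity>"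
  shows "sqint g"
proof -
  have "sqint (\<lambda>\<omega>. f \<omega> - g \<omega>)" using assms by (auto simp: sqint_def)
  from sqint_diff[OF assms(1) this] show ?thesis by simp
qed

text \<open>The rate \<open>4^-n\<close> for squared distances yields almost everywhere convergence
  of the whole sequence, with no passage to a subsequence.\<close>

lemma L2_limit_exists:
  fixes f :: "nat \<Rightarrow> real \<Rightarrow> complex"
  assumes f: "\<And>n. f n \<in> borel_measurable lborel"
    and d: "\<And>n. nrm2 (\<lambda>\<omega>. f (Suc n) \<omega> - f n \<omega>) \<le> ennreal ((1/4) ^ n)"
  obtains g where "g \<in> borel_measurable lborel" "AE \<omega> in lborel. (\<lambda>n. f n \<omega>) \<longlonglongrightarrow> g \<omega>"
proof
  note [measurable] = f
  define g where "g \<omega> = lim (\<lambda>n. f n \<omega>)" for \<omega>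
  show "g \<in> borel_measurable lborel" unfolding g_def by measurable
  \<comment> \<open>The weight \<open>2^n\<close> splits the rate \<open>4^-n\<close>: the weighted
    squares still have a finite integral, and each step is almost everywhere at most a constant
    times \<open>2^(-n/2)\<close>.\<close>
  define u where "u n \<omega> = ennreal (2 ^ n * (cmod (f (Suc n) \<omega> - f n \<omega>))\<^sup>2)" for n \<omega>
  have "(\<integral>\<^sup>+\<omega>. (\<Sum>n. u n \<omega>) \<partial>lborel) = (\<Sum>n. \<integral>\<^sup>+\<omega>. u n \<omega> \<partial>lborel)"
    by (rule nn_integral_suminf) (simp add: u_def)
  also have "\<dots> \<le> (\<Sum>n. ennreal ((1/2) ^ n))"
  proof (rule suminf_le)
    fix n
    have "(\<integral>\<^sup>+\<omega>. u n \<omega> \<partial>lborel) = ennreal (2 ^ n) * nrm2 (\<lambda>\<omega>. f (Suc n) \<omega> - f n \<omega>)"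
      unfolding u_def nrm2_def by (simp add: nn_integral_cmult ennreal_mult)
    also have "\<dots> \<le> ennreal (2 ^ n) * ennreal ((1/4) ^ n)" by (intro mult_left_mono d) auto
    also have "\<dots> = ennreal ((1/2) ^ n)" by (simp add: ennreal_mult[symmetric] power_mult_distrib[symmetric])
    finally show "(\<integral>\<^sup>+\<omega>. u n \<omega> \<partial>lborel) \<le> ennreal ((1/2) ^ n)" .
  qed auto
  also have "\<dots> < \<infinity>"
    by (simp add: ennreal_suminf_neq_top summable_geometric less_top)
  finally have "AE \<omega> in lborel. (\<Sum>n. u n \<omega>) \<noteq> \<infinity>"
    by (intro nn_integral_PInf_AE) (auto simp: u_def)
  then show "AE \<omega> in lborel. (\<lambda>n. f n \<omega>) \<longlonglongrightarrow> g \<omega>"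
  proof eventually_elim
    case (elim \<omega>)
    then obtain K where K: "(\<Sum>n. u n \<omega>) = ennreal K" "K \<ge> 0" by (cases "\<Sum>n. u n \<omega>") auto
    have le: "cmod (f (Suc n) \<omega> - f n \<omega>) \<le> sqrt K * (sqrt (1/2)) ^ n" for n
    proof -
      have "u n \<omega> \<le> ennreal K" unfolding K(1)[symmetric]
        using sum_le_suminf[of "\<lambda>n. u n \<omega>" "{n}"] by simp
      then have "2 ^ n * (cmod (f (Suc n) \<omega> - f n \<omega>))\<^sup>2 \<le> K" using K by (simp add: u_def)
      then have "(cmod (f (Suc n) \<omega> - f n \<omega>))\<^sup>2 \<le> K * (1/2) ^ n"
        by (simp add: field_simps power_divide)
      then have "cmod (f (Suc n) \<omega> - f n \<omega>) \<le> sqrt (K * (1/2)^n)" by (rule real_le_rsqrt)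
      then show ?thesis by (simp add: real_sqrt_mult real_sqrt_power)
    qed
    have "summable (\<lambda>n. f (Suc n) \<omega> - f n \<omega>)"
    proof (rule summable_comparison_test'[where N=0])
      show "summable (\<lambda>n. sqrt K * (sqrt (1/2)) ^ n)"
        by (intro summable_mult summable_geometric) (simp add: real_sqrt_divide)
    qed (use le in auto)
    then have "convergent (\<lambda>n. \<Sum>i<n. f (Suc i) \<omega> - f i \<omega>)"
      by (simp add: summable_iff_convergent)
    then have "convergent (\<lambda>n. f n \<omega> - f 0 \<omega>)"
      by (subst (asm) sum_lessThan_telescope)
    then have "convergent (\<lambda>n. (f n \<omega> - f 0 \<omega>) + f 0 \<omega>)"
      by (intro convergent_add convergent_const)
    then show ?case by (simp add: g_def convergent_LIMSEQ_iff)
  qed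
qed

text \<open>Fatou's lemma for the squared distances. It turns a bound on distances to the members of
  a sequence into a bound on the distance to its pointwise limit.\<close>

lemma nrm2_liminf:
  fixes f :: "nat \<Rightarrow> real \<Rightarrow> complex"
  assumes f: "\<And>n. f n \<in> borel_measurable lborel" "h \<in> borel_measurable lborel"
    and lim: "AE \<omega> in lborel. (\<lambda>n. f n \<omega>) \<longlonglongrightarrow> g \<omega>"
    and ev: "\<forall>\<^sub>F n in sequentially. nrm2 (\<lambda>\<omega>. h \<omega> - f n \<omega>) \<le> B"
  shows "nrm2 (\<lambda>\<omega>. h \<omega> - g \<omega>) \<le> B"
proof -
  note [measurable] = f
  have "nrm2 (\<lambda>\<omega>. h \<omega> - g \<omega>) = (\<integral>\<^sup>+\<omega>. liminf (\<lambda>n. ennreal ((cmod (h \<omega> - f n \<omega>))\<^sup>2)) \<partial>lborel)"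
    unfolding nrm2_def
  proof (rule nn_integral_cong_AE, use lim in eventually_elim)
    case (elim \<omega>)
    have "(\<lambda>n. ennreal ((cmod (h \<omega> - f n \<omega>))\<^sup>2)) \<longlonglongrightarrow> ennreal ((cmod (h \<omega> - g \<omega>))\<^sup>2)"
      by (intro tendsto_intros elim) 
    then show ?case by (rule lim_imp_Liminf[OF sequentially_bot, symmetric])
  qed
  also have "\<dots> \<le> liminf (\<lambda>n. nrm2 (\<lambda>\<omega>. h \<omega> - f n \<omega>))"
    unfolding nrm2_def by (rule nn_integral_liminf) measurable
  also have "\<dots> \<le> B"
    using ev by (intro Liminf_le) auto
  finally show ?thesis .
qed

section \<open>Scalar Hardy functions on vertical lines\<close>

definition line :: "(complex \<Rightarrow> complex) \<Rightarrow> real \<Rightarrow> real \<Rightarrow> complex" where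
  "line f \<xi> \<omega> = f (Complex \<xi> \<omega>)"

text \<open>The scalar case of \<open>H2\<close>, with a real bound in place of a finite supremum;
  \<open>H2_iff_hardy2\<close> reduces the matrix space to it entry by entry.\<close>

definition hardy2 :: "(complex \<Rightarrow> complex) \<Rightarrow> bool" where
  "hardy2 f \<longleftrightarrow> f holomorphic_on {s. Re s > 0} \<and>
     (\<exists>M. \<forall>\<xi>>0. nrm2 (line f \<xi>) \<le> ennreal M)"

lemma open_rhp: "open {s. Re s > 0}"
  by (rule open_halfspace_Re_gt)

lemma line_measurable:
  assumes "continuous_on {s. Re s > 0} f" "\<xi> > 0"
  shows "line f \<xi> \<in> borel_measurable lborel"
proof -
  have "continuous_on UNIV (\<lambda>\<omega>. f (Complex \<xi> \<omega>))"
    by (rule continuous_on_compose2[OF assms(1)]) (use assms(2) in \<open>auto intro!: continuous_intros\<close>)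
  then show ?thesis
    unfolding line_def[abs_def] by (simp add: borel_measurable_continuous_onI)
qed

lemma hardy2_holomorphic: "hardy2 f \<Longrightarrow> f holomorphic_on {s. Re s > 0}"
  by (simp add: hardy2_def)

lemma hardy2_measurable: "hardy2 f \<Longrightarrow> \<xi> > 0 \<Longrightarrow> line f \<xi> \<in> borel_measurable lborel"
  by (intro line_measurable holomorphic_on_imp_continuous_on hardy2_holomorphic)

lemma hardy2_sqint: "hardy2 f \<Longrightarrow> \<xi> > 0 \<Longrightarrow> sqint (line f \<xi>)"
  unfolding sqint_def using hardy2_measurable[of f \<xi>] unfolding hardy2_def
  by (auto intro: order_le_less_trans)

lemma hardy2_l2_bound:
  assumes "hardy2 f"
  obtains M where "M \<ge> 0" "\<And>\<xi>. \<xi> > 0 \<Longrightarrow> l2 (line f \<xi>) \<le> M"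
proof -
  obtain M where M: "\<And>\<xi>. \<xi> > 0 \<Longrightarrow> nrm2 (line f \<xi>) \<le> ennreal M"
    using assms by (auto simp: hardy2_def)
  show ?thesis
  proof
    fix \<xi> :: real assume "\<xi> > 0"
    then have "ennreal ((l2 (line f \<xi>))\<^sup>2) \<le> ennreal M"
      using M nrm2_eq_l2[OF hardy2_sqint[OF assms]] by simp
    then have "(l2 (line f \<xi>))\<^sup>2 \<le> max M 0"
      by (cases "M \<ge> 0") (auto simp: ennreal_neg)
    then show "l2 (line f \<xi>) \<le> sqrt (max M 0)"
      by (rule real_le_rsqrt)
  qed simp
qed

lemma hardy2_add:
  assumes "hardy2 f" "hardy2 g"
  shows "hardy2 (\<lambda>s. f s + g s)"
  unfolding hardy2_def
proof (intro conjI)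
  show "(\<lambda>s. f s + g s) holomorphic_on {s. 0 < Re s}"
    using assms by (intro holomorphic_intros hardy2_holomorphic)
  obtain M1 where M1: "\<And>\<xi>. \<xi> > 0 \<Longrightarrow> nrm2 (line f \<xi>) \<le> ennreal M1" using assms by (auto simp: hardy2_def)
  obtain M2 where M2: "\<And>\<xi>. \<xi> > 0 \<Longrightarrow> nrm2 (line g \<xi>) \<le> ennreal M2" using assms by (auto simp: hardy2_def)
  have "nrm2 (line (\<lambda>s. f s + g s) \<xi>) \<le> ennreal (2 * max 0 M1 + 2 * max 0 M2)" if "\<xi> > 0" for \<xi>
  proof -
    have "nrm2 (line (\<lambda>s. f s + g s) \<xi>) \<le> 2 * nrm2 (line f \<xi>) + 2 * nrm2 (line g \<xi>)"
      using nrm2_add_le[OF hardy2_measurable[OF assms(1) that] hardy2_measurable[OF assms(2) that]]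
      by (simp add: line_def[abs_def])
    also have "\<dots> \<le> 2 * ennreal (max 0 M1) + 2 * ennreal (max 0 M2)"
      using M1[OF that] M2[OF that]
      by (intro add_mono mult_left_mono) (auto elim!: order_trans intro!: ennreal_leI)
    also have "\<dots> = ennreal (2 * max 0 M1 + 2 * max 0 M2)"
      by (simp add: ennreal_plus ennreal_mult)
    finally show ?thesis .
  qed
  then show "\<exists>M. \<forall>\<xi>>0. nrm2 (line (\<lambda>s. f s + g s) \<xi>) \<le> ennreal M" by blast
qed

lemma hardy2_cmult:
  assumes "hardy2 f"
  shows "hardy2 (\<lambda>s. c * f s)"
  unfolding hardy2_def
proof (intro conjI)
  show "(\<lambda>s. c * f s) holomorphic_on {s. 0 < Re s}"
    using assms by (intro holomorphic_intros hardy2_holomorphic)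
  obtain M1 where M1: "\<And>\<xi>. \<xi> > 0 \<Longrightarrow> nrm2 (line f \<xi>) \<le> ennreal M1" using assms by (auto simp: hardy2_def)
  have "nrm2 (line (\<lambda>s. c * f s) \<xi>) \<le> ennreal ((cmod c)\<^sup>2 * max 0 M1)" if "\<xi> > 0" for \<xi>
  proof -
    have "nrm2 (line (\<lambda>s. c * f s) \<xi>) = ennreal ((cmod c)\<^sup>2) * nrm2 (line f \<xi>)"
      using nrm2_cmult[OF hardy2_measurable[OF assms that]] by (simp add: line_def[abs_def])
    also have "\<dots> \<le> ennreal ((cmod c)\<^sup>2) * ennreal (max 0 M1)"
      using M1[OF that] by (intro mult_left_mono) (auto elim!: order_trans intro!: ennreal_leI)
    finally show ?thesis by (simp add: ennreal_mult)
  qed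
  then show "\<exists>M. \<forall>\<xi>>0. nrm2 (line (\<lambda>s. c * f s) \<xi>) \<le> ennreal M" by blast
qed

lemma hardy2_diff: "hardy2 f \<Longrightarrow> hardy2 g \<Longrightarrow> hardy2 (\<lambda>s. f s - g s)"
  using hardy2_add[of f "\<lambda>s. (-1) * g s"] hardy2_cmult[of g "-1"] by simp

lemma hardy2_cong:
  assumes "\<And>s. Re s > 0 \<Longrightarrow> f s = g s"
  shows "hardy2 f \<longleftrightarrow> hardy2 g"
proof -
  have "line f \<xi> = line g \<xi>" if "\<xi> > 0" for \<xi>
    using assms that by (auto simp: line_def)
  moreover have "f holomorphic_on {s. 0 < Re s} \<longleftrightarrow> g holomorphic_on {s. 0 < Re s}"
    using assms by (intro holomorphic_cong) auto
  ultimately show ?thesis unfolding hardy2_def by auto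
qed

section \<open>Boundary values\<close>

text \<open>The product \<open>f(s) cnj f(2a - cnj s)\<close> is holomorphic in the strip \<open>0 < Re s < 2a\<close>, so its
  integral does not depend on the vertical line.\<close>

lemma hardy2_polarization:
  assumes f: "hardy2 f" and xy: "0 < x" "x \<le> y"
  shows "(\<integral>\<omega>. line f x \<omega> * cnj (line f y \<omega>) \<partial>lborel) = complex_of_real ((l2 (line f ((x + y) / 2)))\<^sup>2)"
proof -
  define a where "a = (x + y) / 2"
  define G where "G s = f s * cnj (f (complex_of_real (2 * a) - cnj s))" for s
  have line: "G (Complex \<xi> \<omega>) = line f \<xi> \<omega> * cnj (line f (2 * a - \<xi>) \<omega>)" for \<xi> \<omega>
  proof -
    have "complex_of_real (2 * a) - cnj (Complex \<xi> \<omega>) = Complex (2 * a - \<xi>) \<omega>"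
      by (simp add: complex_eq_iff)
    then show ?thesis by (simp add: G_def line_def)
  qed
  obtain M where M: "M \<ge> 0" "\<And>\<xi>. \<xi> > 0 \<Longrightarrow> l2 (line f \<xi>) \<le> M"
    using hardy2_l2_bound[OF f] by blast
  have "(\<integral>\<omega>. G (Complex x \<omega>) \<partial>lborel) = (\<integral>\<omega>. G (Complex a \<omega>) \<partial>lborel)"
  proof (rule line_integral_shift)
    show "0 < x" "x \<le> a" "a < 2 * a" using xy by (auto simp: a_def)
    have "(\<lambda>s. f (complex_of_real (2 * a) - s)) holomorphic_on {s. 0 < Re s \<and> Re s < 2 * a}"
    proof -
      have "(f \<circ> (\<lambda>s. complex_of_real (2 * a) - s)) holomorphic_on {s. 0 < Re s \<and> Re s < 2 * a}"
        by (rule holomorphic_on_compose_gen[OF _ hardy2_holomorphic[OF f]]) (auto intro!: holomorphic_intros)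
      then show ?thesis by (simp add: o_def)
    qed
    moreover have img: "cnj ` {s. 0 < Re s \<and> Re s < 2 * a} = {s. 0 < Re s \<and> Re s < 2 * a}"
      by (force simp: image_iff intro: exI[of _ "cnj _"])
    moreover have "open {s. 0 < Re s \<and> Re s < 2 * a}"
      using open_Int[OF open_halfspace_Re_gt[of 0] open_halfspace_Re_lt[of "2 * a"]]
      by (simp add: Collect_conj_eq)
    ultimately have "(\<lambda>s. cnj (f (complex_of_real (2 * a) - cnj s))) holomorphic_on {s. 0 < Re s \<and> Re s < 2 * a}"
      using holomorphic_on_compose_cnj_cnj[of "\<lambda>s. f (complex_of_real (2 * a) - s)" "{s. 0 < Re s \<and> Re s < 2 * a}"]
      by (simp add: o_def)
    moreover have "f holomorphic_on {s. 0 < Re s \<and> Re s < 2 * a}"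
      using hardy2_holomorphic[OF f] by (rule holomorphic_on_subset) auto
    ultimately show "G holomorphic_on {s. 0 < Re s \<and> Re s < 2 * a}"
      unfolding G_def by (intro holomorphic_intros)
    fix \<xi> assume \<xi>: "x \<le> \<xi>" "\<xi> \<le> a"
    then have pos: "\<xi> > 0" "2 * a - \<xi> > 0" using xy by (auto simp: a_def)
    have "(\<integral>\<^sup>+\<omega>. ennreal (cmod (G (Complex \<xi> \<omega>))) \<partial>lborel) \<le> ennreal (l2 (line f \<xi>) * l2 (\<lambda>\<omega>. cnj (line f (2 * a - \<xi>) \<omega>)))"
      unfolding line by (intro nn_integral_mult_le sqint_cnj hardy2_sqint f pos)
    also have "\<dots> \<le> ennreal (M * M)"
      using M pos by (intro ennreal_leI mult_mono) (auto simp: l2_def nrm2_cnj)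
    finally show "(\<integral>\<^sup>+\<omega>. ennreal (cmod (G (Complex \<xi> \<omega>))) \<partial>lborel) \<le> ennreal (M * M)" .
  qed
  \<comment> \<open>On the middle line the two factors of \<open>G\<close> are conjugate to each
    other.\<close>
  also have "\<dots> = (\<integral>\<omega>. complex_of_real ((cmod (line f a \<omega>))\<^sup>2) \<partial>lborel)"
    unfolding line by (simp add: complex_norm_square del: of_real_power)
  also have "\<dots> = complex_of_real ((l2 (line f a))\<^sup>2)"
    using xy by (subst l2_squared[OF hardy2_sqint[OF f]]) (auto simp: a_def simp del: of_real_power)
  finally have eq: "(\<integral>\<omega>. line f x \<omega> * cnj (line f (2 * a - x) \<omega>) \<partial>lborel) = complex_of_real ((l2 (line f a))\<^sup>2)"
    unfolding line .
  have "2 * a - x = y" by (simp add: a_def field_simps)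
  with eq show ?thesis by (simp only: a_def[symmetric])
qed

text \<open>After expanding the square, polarization evaluates the cross term; it is real and is the
  squared norm on the middle line.\<close>

lemma hardy2_l2_diff:
  assumes f: "hardy2 f" and xy: "0 < x" "x \<le> y"
  shows "(l2 (\<lambda>\<omega>. line f x \<omega> - line f y \<omega>))\<^sup>2
     = (l2 (line f x))\<^sup>2 + (l2 (line f y))\<^sup>2 - 2 * (l2 (line f ((x + y) / 2)))\<^sup>2"
proof -
  have sx: "sqint (line f x)" and sy: "sqint (line f y)" using f xy by (auto intro: hardy2_sqint)
  define h where "h \<omega> = line f x \<omega> * cnj (line f y \<omega>)" for \<omega>
  have h: "integrable lborel h" unfolding h_def by (rule sqint_mult_integrable[OF sx sqint_cnj[OF sy]])
  have "(l2 (\<lambda>\<omega>. line f x \<omega> - line f y \<omega>))\<^sup>2 = (\<integral>\<omega>. (cmod (line f x \<omega> - line f y \<omega>))\<^sup>2 \<partial>lborel)"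
    by (rule l2_squared[OF sqint_diff[OF sx sy]])
  also have "\<dots> = (\<integral>\<omega>. (cmod (line f x \<omega>))\<^sup>2 + (cmod (line f y \<omega>))\<^sup>2 - 2 * Re (h \<omega>) \<partial>lborel)"
    unfolding h_def
    by (intro Bochner_Integration.integral_cong refl) (simp add: cmod_power2, simp add: power2_eq_square algebra_simps)
  also have "\<dots> = (\<integral>\<omega>. (cmod (line f x \<omega>))\<^sup>2 \<partial>lborel) + (\<integral>\<omega>. (cmod (line f y \<omega>))\<^sup>2 \<partial>lborel)
      - 2 * Re (\<integral>\<omega>. h \<omega> \<partial>lborel)"
    using sqint_integrable[OF sx] sqint_integrable[OF sy] h by simp
  also have "(\<integral>\<omega>. h \<omega> \<partial>lborel) = complex_of_real ((l2 (line f ((x + y) / 2)))\<^sup>2)"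
    unfolding h_def by (rule hardy2_polarization[OF assms])
  finally show ?thesis
    by (simp only: l2_squared[OF sx] l2_squared[OF sy] Re_complex_of_real)
qed

text \<open>Midpoint convexity makes the increments along the progression \<open>a\<close>,
  \<open>a + d\<close>, \<open>a + 2 d\<close>, ... nondecreasing. A positive first increment would
  push the values above every bound.\<close>

lemma midconvex_bounded_antimono:
  fixes N :: "real \<Rightarrow> real"
  assumes mid: "\<And>x y. 0 < x \<Longrightarrow> x \<le> y \<Longrightarrow> 2 * N ((x + y) / 2) \<le> N x + N y"
    and bd: "\<And>x. 0 < x \<Longrightarrow> N x \<le> M" and ab: "0 < a" "a \<le> b"
  shows "N b \<le> N a"
proof (rule ccontr)
  assume "\<not> N b \<le> N a"
  define d where "d = b - a"
  define e where "e = N b - N a"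
  have d: "d \<ge> 0" and e: "e > 0" using ab \<open>\<not> N b \<le> N a\<close> by (auto simp: d_def e_def)
  have step: "e \<le> N (a + real (Suc n) * d) - N (a + real n * d)" for n
  proof (induction n)
    case 0 then show ?case by (simp add: d_def e_def)
  next
    case (Suc n)
    have "2 * N (((a + real n * d) + (a + real (Suc (Suc n)) * d)) / 2) \<le> N (a + real n * d) + N (a + real (Suc (Suc n)) * d)"
      using ab d by (intro mid) (auto intro!: add_pos_nonneg mult_right_mono)
    moreover have eq: "((a + real n * d) + (a + real (Suc (Suc n)) * d)) / 2 = a + real (Suc n) * d"
      by (simp add: field_simps)
    ultimately show ?case using Suc.IH unfolding eq by linarith
  qed
  have "N a + real n * e \<le> N (a + real n * d)" for n
  proof (induction n)
    case (Suc n) then show ?case using step[of n] by (simp add: algebra_simps)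
  qed simp
  moreover have "N (a + real n * d) \<le> M" for n
    using ab d by (intro bd add_pos_nonneg) auto
  ultimately have "real n * e \<le> M - N a" for n by (smt (verit))
  moreover obtain n where "real n * e > M - N a" using e ex_less_of_nat_mult by blast
  ultimately show False by (meson not_less)
qed

lemma hardy2_l2_antimono:
  assumes f: "hardy2 f" and ab: "0 < a" "a \<le> b"
  shows "l2 (line f b) \<le> l2 (line f a)"
proof -
  obtain M where M: "M \<ge> 0" "\<And>\<xi>. \<xi> > 0 \<Longrightarrow> l2 (line f \<xi>) \<le> M"
    using hardy2_l2_bound[OF f] by blast
  have "(l2 (line f b))\<^sup>2 \<le> (l2 (line f a))\<^sup>2"
  proof (rule midconvex_bounded_antimono[where N="\<lambda>\<xi>. (l2 (line f \<xi>))\<^sup>2" and M="M\<^sup>2"])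
    show "2 * (l2 (line f ((x + y) / 2)))\<^sup>2 \<le> (l2 (line f x))\<^sup>2 + (l2 (line f y))\<^sup>2" if "0 < x" "x \<le> y" for x y
      using hardy2_l2_diff[OF f that] zero_le_power2[of "l2 (\<lambda>\<omega>. line f x \<omega> - line f y \<omega>)"] by linarith
    show "(l2 (line f x))\<^sup>2 \<le> M\<^sup>2" if "0 < x" for x
      using M that by (intro power_mono) (auto simp: l2_nonneg)
  qed (use ab in auto)
  then show ?thesis by (rule power2_le_imp_le[OF _ l2_nonneg])
qed

text \<open>For \<open>x <= y\<close> the norm on the middle line is at least the norm on the line
  \<open>y\<close>, so the identity \<open>hardy2_l2_diff\<close> leaves at most
  \<open>N x - N y\<close> for the squared norms \<open>N\<close>. A bounded monotone
  \<open>N\<close> then gives the Cauchy property.\<close>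

lemma hardy2_nrm2_diff_le:
  assumes f: "hardy2 f" and xy: "0 < x" "0 < y"
  shows "nrm2 (\<lambda>\<omega>. line f x \<omega> - line f y \<omega>) \<le> ennreal \<bar>(l2 (line f x))\<^sup>2 - (l2 (line f y))\<^sup>2\<bar>"
proof -
  have *: "nrm2 (\<lambda>\<omega>. line f x \<omega> - line f y \<omega>) \<le> ennreal \<bar>(l2 (line f x))\<^sup>2 - (l2 (line f y))\<^sup>2\<bar>"
    if "0 < x" "x \<le> y" for x y
  proof -
    have "nrm2 (\<lambda>\<omega>. line f x \<omega> - line f y \<omega>) = ennreal ((l2 (\<lambda>\<omega>. line f x \<omega> - line f y \<omega>))\<^sup>2)"
      using f that by (intro nrm2_eq_l2 sqint_diff hardy2_sqint) auto
    also have "\<dots> \<le> ennreal ((l2 (line f x))\<^sup>2 - (l2 (line f y))\<^sup>2)"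
    proof (rule ennreal_leI)
      have "(l2 (line f y))\<^sup>2 \<le> (l2 (line f ((x + y) / 2)))\<^sup>2"
        using f that by (intro power_mono hardy2_l2_antimono) (auto simp: l2_nonneg)
      then show "(l2 (\<lambda>\<omega>. line f x \<omega> - line f y \<omega>))\<^sup>2 \<le> (l2 (line f x))\<^sup>2 - (l2 (line f y))\<^sup>2"
        using hardy2_l2_diff[OF f that] by linarith
    qed
    also have "\<dots> \<le> ennreal \<bar>(l2 (line f x))\<^sup>2 - (l2 (line f y))\<^sup>2\<bar>" by (intro ennreal_leI) simp
    finally show ?thesis .
  qed
  show ?thesis
  proof (cases "x \<le> y")
    case True then show ?thesis using * xy by simp
  next
    case False then show ?thesis using *[of y x] xy
      by (simp add: nrm2_minus_commute[of "line f y"] abs_minus_commute)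
  qed
qed

definition l2_boundary :: "(complex \<Rightarrow> complex) \<Rightarrow> (real \<Rightarrow> complex) \<Rightarrow> bool" where
  "l2_boundary f g \<longleftrightarrow> g \<in> borel_measurable lborel \<and>
     ((\<lambda>\<xi>. nrm2 (\<lambda>\<omega>. line f \<xi> \<omega> - g \<omega>)) \<longlongrightarrow> 0) (at_right 0)"

lemma l2_boundary_exists:
  assumes f: "hardy2 f"
  obtains g where "l2_boundary f g"
proof -
  define N where "N \<xi> = (l2 (line f \<xi>))\<^sup>2" for \<xi>
  obtain M where M: "M \<ge> 0" "\<And>\<xi>. \<xi> > 0 \<Longrightarrow> l2 (line f \<xi>) \<le> M"
    using hardy2_l2_bound[OF f] by blast
  define L where "L = (SUP \<xi>\<in>{0<..}. N \<xi>)"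
  have bdd: "bdd_above (N ` {0<..})"
    unfolding N_def using M by (intro bdd_aboveI2[where M="M\<^sup>2"] power_mono) (auto simp: l2_nonneg)
  have NL: "N \<xi> \<le> L" if "\<xi> > 0" for \<xi>
    unfolding L_def using bdd that by (intro cSUP_upper) auto
  have anti: "N b \<le> N a" if "0 < a" "a \<le> b" for a b
    unfolding N_def using hardy2_l2_antimono[OF f that] l2_nonneg by (intro power_mono)
  have ex: "\<exists>\<delta>>0. L - e < N \<delta>" if "e > 0" for e
    using less_cSUP_iff[OF _ bdd, of "L - e"] that by (auto simp: L_def)
  have "\<exists>\<delta>>0. L - (1/4)^n < N \<delta>" for n :: nat by (rule ex) simp
  then obtain \<delta> where \<delta>: "\<And>n. \<delta> n > 0" "\<And>n::nat. L - (1/4)^n < N (\<delta> n)" by metis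
  \<comment> \<open>The minimum with \<open>1 / (n + 1)\<close> forces \<open>x n\<close> to 0. By
    antitonicity \<open>N (x n)\<close> remains within \<open>4^-n\<close> of the supremum
    \<open>L\<close>, the rate that \<open>L2_limit_exists\<close> asks for.\<close>
  define x where "x n = min (\<delta> n) (inverse (real (Suc n)))" for n
  have x0: "x n > 0" for n using \<delta> by (simp add: x_def)
  have xN: "L - (1/4)^n \<le> N (x n)" for n
    using \<delta>(2)[of n] anti[OF x0, of n "\<delta> n"] by (simp add: x_def)
  have xlim: "x \<longlonglongrightarrow> 0"
  proof (rule tendsto_sandwich[OF _ _ tendsto_const LIMSEQ_inverse_real_of_nat])
    show "\<forall>\<^sub>F n in sequentially. 0 \<le> x n" using x0 by (simp add: less_imp_le)
    show "\<forall>\<^sub>F n in sequentially. x n \<le> inverse (real (Suc n))"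
      unfolding x_def by (intro always_eventually allI min.cobounded2)
  qed
  have dist: "nrm2 (\<lambda>\<omega>. line f (x (Suc n)) \<omega> - line f (x n) \<omega>) \<le> ennreal ((1/4)^n)" for n
  proof -
    have "nrm2 (\<lambda>\<omega>. line f (x (Suc n)) \<omega> - line f (x n) \<omega>) \<le> ennreal \<bar>N (x (Suc n)) - N (x n)\<bar>"
      unfolding N_def by (rule hardy2_nrm2_diff_le[OF f x0 x0])
    also have "\<dots> \<le> ennreal ((1/4)^n)"
    proof (rule ennreal_leI)
      have "(1/4::real)^Suc n \<le> (1/4)^n" by simp
      then show "\<bar>N (x (Suc n)) - N (x n)\<bar> \<le> (1/4)^n"
        using xN[of n] xN[of "Suc n"] NL[OF x0, of n] NL[OF x0, of "Suc n"] by linarith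
    qed
    finally show ?thesis .
  qed
  obtain g where g: "g \<in> borel_measurable lborel" "AE \<omega> in lborel. (\<lambda>n. line f (x n) \<omega>) \<longlonglongrightarrow> g \<omega>"
    using L2_limit_exists[of "\<lambda>n. line f (x n)", OF hardy2_measurable[OF f x0] dist] by blast
  \<comment> \<open>Comparison with the sequence \<open>x n\<close> and Fatou give a bound that
    holds for every \<xi>, hence convergence along the full one-sided limit and not only along the
    sequence.\<close>
  have le: "nrm2 (\<lambda>\<omega>. line f \<xi> \<omega> - g \<omega>) \<le> ennreal (L - N \<xi>)" if "\<xi> > 0" for \<xi>
  proof (rule nrm2_liminf[OF hardy2_measurable[OF f x0] hardy2_measurable[OF f that] g(2)])
    show "\<forall>\<^sub>F n in sequentially. nrm2 (\<lambda>\<omega>. line f \<xi> \<omega> - line f (x n) \<omega>) \<le> ennreal (L - N \<xi>)"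
      using order_tendstoD(2)[OF xlim that]
    proof eventually_elim
      case (elim n)
      have "nrm2 (\<lambda>\<omega>. line f \<xi> \<omega> - line f (x n) \<omega>) \<le> ennreal \<bar>N \<xi> - N (x n)\<bar>"
        unfolding N_def by (rule hardy2_nrm2_diff_le[OF f that x0])
      also have "\<dots> \<le> ennreal (L - N \<xi>)"
        using anti[OF x0, of n \<xi>] elim NL[OF x0, of n] by (intro ennreal_leI) auto
      finally show ?case .
    qed
  qed
  have "((\<lambda>\<xi>. nrm2 (\<lambda>\<omega>. line f \<xi> \<omega> - g \<omega>)) \<longlongrightarrow> 0) (at_right 0)"
  proof (rule tendsto_sandwich[OF _ _ tendsto_const])
    show "\<forall>\<^sub>F \<xi> in at_right 0. nrm2 (\<lambda>\<omega>. line f \<xi> \<omega> - g \<omega>) \<le> ennreal (L - N \<xi>)"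
      using eventually_at_right_less by eventually_elim (rule le)
    have "((\<lambda>\<xi>. L - N \<xi>) \<longlongrightarrow> 0) (at_right 0)"
    proof (rule tendstoI)
      fix e :: real assume "e > 0"
      obtain \<delta> where d: "\<delta> > 0" "L - e < N \<delta>" using ex[OF \<open>e > 0\<close>] by auto
      have "\<forall>\<^sub>F \<xi> in at_right 0. \<xi> \<in> {0<..<\<delta>}" using d by (intro eventually_at_rightI) auto
      then show "\<forall>\<^sub>F \<xi> in at_right 0. dist (L - N \<xi>) 0 < e"
      proof eventually_elim
        case (elim \<xi>)
        then show ?case using anti[of \<xi> \<delta>] NL[of \<xi>] d by (auto simp: dist_real_def)
      qed
    qed
    from tendsto_ennrealI[OF this] show "((\<lambda>\<xi>. ennreal (L - N \<xi>)) \<longlongrightarrow> 0) (at_right 0)" by simp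
  qed auto
  with g(1) that show ?thesis by (auto simp: l2_boundary_def)
qed

lemma l2_boundary_sqint:
  assumes "hardy2 f" "l2_boundary f g"
  shows "sqint g"
proof -
  have "\<forall>\<^sub>F \<xi> in at_right 0. nrm2 (\<lambda>\<omega>. line f \<xi> \<omega> - g \<omega>) < \<infinity>"
    using assms(2) unfolding l2_boundary_def by (intro order_tendstoD(2)) auto
  then have "\<forall>\<^sub>F \<xi> in at_right 0. \<xi> > 0 \<and> nrm2 (\<lambda>\<omega>. line f \<xi> \<omega> - g \<omega>) < \<infinity>"
    using eventually_at_right_less[of 0] by eventually_elim auto
  then obtain \<xi> where "\<xi> > 0" "nrm2 (\<lambda>\<omega>. line f \<xi> \<omega> - g \<omega>) < \<infinity>"
    using eventually_happens'[OF trivial_limit_at_right_real] by blast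
  then show ?thesis
    using sqint_limit[OF hardy2_sqint[OF assms(1)]] assms(2) by (auto simp: l2_boundary_def)
qed

lemma hardy2_inner_tendsto:
  assumes f: "hardy2 f" "l2_boundary f bf" and g: "hardy2 g" "l2_boundary g bg"
  shows "((\<lambda>\<xi>. \<integral>\<omega>. cnj (line f \<xi> \<omega>) * line g \<xi> \<omega> \<partial>lborel) \<longlongrightarrow> (\<integral>\<omega>. cnj (bf \<omega>) * bg \<omega> \<partial>lborel)) (at_right 0)"
proof (rule integral_mult_tendsto)
  show "sqint (\<lambda>\<omega>. cnj (bf \<omega>))" "sqint bg"
    using l2_boundary_sqint f g by (auto intro: sqint_cnj)
  show "\<forall>\<^sub>F \<xi> in at_right 0. sqint (\<lambda>\<omega>. cnj (line f \<xi> \<omega>))" "\<forall>\<^sub>F \<xi> in at_right 0. sqint (line g \<xi>)"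
    using eventually_at_right_less[of 0] f g by (auto intro!: sqint_cnj hardy2_sqint elim!: eventually_mono)
  have "nrm2 (\<lambda>\<omega>. cnj (line f \<xi> \<omega>) - cnj (bf \<omega>)) = nrm2 (\<lambda>\<omega>. line f \<xi> \<omega> - bf \<omega>)" for \<xi>
    using nrm2_cnj[of "\<lambda>\<omega>. line f \<xi> \<omega> - bf \<omega>"] by simp
  then show "((\<lambda>\<xi>. nrm2 (\<lambda>\<omega>. cnj (line f \<xi> \<omega>) - cnj (bf \<omega>))) \<longlongrightarrow> 0) (at_right 0)"
    using f(2) by (simp add: l2_boundary_def)
  show "((\<lambda>\<xi>. nrm2 (\<lambda>\<omega>. line g \<xi> \<omega> - bg \<omega>)) \<longlongrightarrow> 0) (at_right 0)"
    using g(2) by (simp add: l2_boundary_def)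
qed

lemma integral_cnj_self:
  assumes "sqint g"
  shows "(\<integral>\<omega>. cnj (g \<omega>) * g \<omega> \<partial>lborel) = complex_of_real ((l2 g)\<^sup>2)"
proof -
  have "(\<integral>\<omega>. cnj (g \<omega>) * g \<omega> \<partial>lborel) = (\<integral>\<omega>. complex_of_real ((cmod (g \<omega>))\<^sup>2) \<partial>lborel)"
    by (intro Bochner_Integration.integral_cong) (auto simp: complex_norm_square mult.commute simp del: of_real_power)
  then show ?thesis by (simp add: l2_squared[OF assms] del: of_real_power)
qed

text \<open>The squared norms on vertical lines grow to the boundary norm as the lines approach the
  axis. This connects estimates inside the half-plane with \<open>h2_norm\<close>, which sees
  boundary values only.\<close>

lemma hardy2_l2_le_boundary:
  assumes f: "hardy2 f" "l2_boundary f g" and x: "\<xi> > 0"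
  shows "l2 (line f \<xi>) \<le> l2 g"
proof -
  have "((\<lambda>\<xi>. Re (\<integral>\<omega>. cnj (line f \<xi> \<omega>) * line f \<xi> \<omega> \<partial>lborel)) \<longlongrightarrow> Re (\<integral>\<omega>. cnj (g \<omega>) * g \<omega> \<partial>lborel)) (at_right 0)"
    by (intro tendsto_Re hardy2_inner_tendsto f)
  then have lim: "((\<lambda>\<xi>. Re (\<integral>\<omega>. cnj (line f \<xi> \<omega>) * line f \<xi> \<omega> \<partial>lborel)) \<longlongrightarrow> (l2 g)\<^sup>2) (at_right 0)"
    by (simp add: integral_cnj_self[OF l2_boundary_sqint[OF f]] del: of_real_power)
  have "(l2 (line f \<xi>))\<^sup>2 \<le> (l2 g)\<^sup>2"
  proof (rule tendsto_lowerbound[OF lim])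
    have "\<forall>\<^sub>F \<eta> in at_right 0. \<eta> \<in> {0<..<\<xi>}" using x by (intro eventually_at_rightI) auto
    then show "\<forall>\<^sub>F \<eta> in at_right 0. (l2 (line f \<xi>))\<^sup>2 \<le> Re (\<integral>\<omega>. cnj (line f \<eta> \<omega>) * line f \<eta> \<omega> \<partial>lborel)"
    proof eventually_elim
      case (elim \<eta>)
      then show ?case
        using hardy2_l2_antimono[OF f(1), of \<eta> \<xi>] l2_nonneg
        by (simp add: integral_cnj_self[OF hardy2_sqint[OF f(1)]] power_mono del: of_real_power)
    qed
  qed (rule trivial_limit_at_right_real)
  then show ?thesis by (rule power2_le_imp_le[OF _ l2_nonneg])
qed

section \<open>Decay estimates on vertical lines\<close>

text \<open>This is the number pi; it occurs as a factor in the square norm bounds below.\<close>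

definition kernel_mass :: real where
  "kernel_mass = (\<integral>\<omega>. 1 / (1 + \<omega>\<^sup>2) \<partial>lborel)"

lemma nn_integral_kernel: "(\<integral>\<^sup>+\<omega>. ennreal (1 / (1 + \<omega>\<^sup>2)) \<partial>lborel) = ennreal kernel_mass"
proof -
  have "einterval (-\<infinity>) \<infinity> = UNIV" by (auto simp: einterval_def)
  then have "integrable lborel (\<lambda>\<omega>::real. 1 / (1 + \<omega>\<^sup>2))"
    using integrable_inverse_1_plus_square by (simp add: set_integrable_def divide_inverse)
  then show ?thesis unfolding kernel_mass_def by (rule nn_integral_eq_integral) simp
qed

lemma kernel_mass_nonneg: "kernel_mass \<ge> 0"
  unfolding kernel_mass_def by (rule integral_nonneg_AE) simp

lemma nrm2_decay_le:
  assumes "\<And>\<omega>. cmod (f \<omega>) \<le> C / (1 + \<bar>\<omega>\<bar>)"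
  shows "nrm2 f \<le> ennreal (C\<^sup>2 * kernel_mass)"
proof -
  have "nrm2 f \<le> (\<integral>\<^sup>+\<omega>. ennreal (C\<^sup>2) * ennreal (1 / (1 + \<omega>\<^sup>2)) \<partial>lborel)"
    unfolding nrm2_def
  proof (rule nn_integral_mono)
    fix \<omega> :: real
    have "(cmod (f \<omega>))\<^sup>2 \<le> (C / (1 + \<bar>\<omega>\<bar>))\<^sup>2" by (intro power_mono assms) simp
    also have "\<dots> = C\<^sup>2 / (1 + \<bar>\<omega>\<bar>)\<^sup>2" by (simp add: power_divide)
    also have "\<dots> \<le> C\<^sup>2 / (1 + \<omega>\<^sup>2)"
    proof (rule divide_left_mono)
      have "(1 + \<bar>\<omega>\<bar>)\<^sup>2 = 1 + \<omega>\<^sup>2 + 2 * \<bar>\<omega>\<bar>" by (simp add: power2_sum)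
      then show "1 + \<omega>\<^sup>2 \<le> (1 + \<bar>\<omega>\<bar>)\<^sup>2" by simp
      show "0 < (1 + \<bar>\<omega>\<bar>)\<^sup>2 * (1 + \<omega>\<^sup>2)"
        by (intro mult_pos_pos zero_less_power) (auto intro: add_pos_nonneg)
    qed simp
    finally have "ennreal ((cmod (f \<omega>))\<^sup>2) \<le> ennreal (C\<^sup>2 * (1 / (1 + \<omega>\<^sup>2)))" by (intro ennreal_leI) simp
    also have "\<dots> = ennreal (C\<^sup>2) * ennreal (1 / (1 + \<omega>\<^sup>2))" by (rule ennreal_mult) auto
    finally show "ennreal ((cmod (f \<omega>))\<^sup>2) \<le> ennreal (C\<^sup>2) * ennreal (1 / (1 + \<omega>\<^sup>2))" .
  qed
  also have "\<dots> = ennreal (C\<^sup>2) * ennreal kernel_mass"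
    by (subst nn_integral_cmult) (auto simp only: nn_integral_kernel, measurable)
  also have "\<dots> = ennreal (C\<^sup>2 * kernel_mass)" by (rule ennreal_mult[symmetric]) (auto simp: kernel_mass_nonneg)
  finally show ?thesis .
qed

lemma cmod_le_decay:
  assumes "cmod z \<le> C / (1 + cmod (Complex \<xi> \<omega>))" "C \<ge> 0"
  shows "cmod z \<le> C / (1 + \<bar>\<omega>\<bar>)"
proof -
  have "\<bar>\<omega>\<bar> \<le> cmod (Complex \<xi> \<omega>)" using abs_Im_le_cmod[of "Complex \<xi> \<omega>"] by simp
  then have "C / (1 + cmod (Complex \<xi> \<omega>)) \<le> C / (1 + \<bar>\<omega>\<bar>)"
    using assms(2) by (intro divide_left_mono) (auto intro!: mult_pos_pos add_pos_nonneg)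
  with assms(1) show ?thesis by linarith
qed

text \<open>The criterion by which rational functions enter the Hardy space: a bound of order
  \<open>1 / |s|\<close> is square integrable on each vertical line, uniformly in the line.\<close>

lemma hardy2_decay:
  assumes "f holomorphic_on {s. Re s > 0}" "C \<ge> 0"
    and "\<And>s. Re s > 0 \<Longrightarrow> cmod (f s) \<le> C / (1 + cmod s)"
  shows "hardy2 f"
proof -
  have "nrm2 (line f \<xi>) \<le> ennreal (C\<^sup>2 * kernel_mass)" if "\<xi> > 0" for \<xi>
    by (rule nrm2_decay_le, unfold line_def, rule cmod_le_decay[OF _ assms(2)], rule assms(3)) (use that in simp)
  with assms(1) show ?thesis unfolding hardy2_def by blast
qed

text \<open>With \<open>d\<close> the distance from \<open>l\<close> to the half-plane,
  \<open>|s - l| >= d\<close> and \<open>1 + |s| <= |s - l| + (1 + |l|)\<close>, which explains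
  \<open>C\<close>. For positive \<delta> the half-plane reaches past the imaginary axis, as the
  mirrored lines require.\<close>

lemma pole_decay:
  assumes "Re l < -\<delta>"
  obtains C where "C \<ge> 0" "\<And>s. Re s \<ge> -\<delta> \<Longrightarrow> cmod (1 / (s - l)) \<le> C / (1 + cmod s)"
proof
  define d where "d = -\<delta> - Re l"
  have d: "d > 0" using assms by (simp add: d_def)
  define C where "C = 1 + (1 + cmod l) / d"
  show "C \<ge> 0" using d by (auto simp: C_def intro!: add_nonneg_nonneg divide_nonneg_pos)
  fix s assume s: "Re s \<ge> -\<delta>"
  have "d \<le> Re (s - l)" using s by (simp add: d_def)
  also have "\<dots> \<le> cmod (s - l)" by (rule complex_Re_le_cmod)
  finally have ds: "d \<le> cmod (s - l)" .
  have "cmod s \<le> cmod (s - l) + cmod l" using norm_triangle_ineq[of "s - l" l] by simp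
  then have "1 + cmod s \<le> cmod (s - l) + (1 + cmod l)" by simp
  also have "1 + cmod l = (1 + cmod l) / d * d" using d by simp
  also have "\<dots> \<le> (1 + cmod l) / d * cmod (s - l)"
    using d ds by (intro mult_left_mono) (auto intro!: divide_nonneg_pos add_nonneg_nonneg)
  finally have "1 + cmod s \<le> C * cmod (s - l)" by (simp add: C_def algebra_simps)
  moreover have "cmod (s - l) > 0" "1 + cmod s > 0" using d ds by (auto intro: add_pos_nonneg)
  ultimately show "cmod (1 / (s - l)) \<le> C / (1 + cmod s)"
    by (simp add: norm_divide field_simps)
qed

lemma hardy2_pole:
  assumes "Re l < 0"
  shows "hardy2 (\<lambda>s. 1 / (s - l))"
proof -
  obtain C where "C \<ge> 0" "\<And>s. Re s \<ge> -0 \<Longrightarrow> cmod (1 / (s - l)) \<le> C / (1 + cmod s)"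
    using pole_decay[of l 0] assms by auto
  moreover have "(\<lambda>s. 1 / (s - l)) holomorphic_on {s. Re s > 0}"
    using assms by (intro holomorphic_intros) auto
  ultimately show ?thesis by (intro hardy2_decay) auto
qed

text \<open>Substitution of \<open>\<xi> * \<omega>\<close> for \<omega>. The decay in \<xi> is what
  sends line integrals to 0 far to the right.\<close>

lemma nrm2_inverse_line:
  assumes "\<xi> > 0"
  shows "nrm2 (line (\<lambda>s. 1 / s) \<xi>) = ennreal (kernel_mass / \<xi>)"
proof -
  have sq: "(cmod (1 / Complex \<xi> \<omega>))\<^sup>2 = 1 / (\<xi>\<^sup>2 + \<omega>\<^sup>2)" for \<omega>
    by (simp add: norm_divide power_divide cmod_power2)
  have "nrm2 (line (\<lambda>s. 1 / s) \<xi>) = (\<integral>\<^sup>+\<omega>. ennreal (1 / (\<xi>\<^sup>2 + \<omega>\<^sup>2)) \<partial>lborel)"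
    unfolding nrm2_def line_def sq ..
  also have "\<dots> = \<bar>\<xi>\<bar> * (\<integral>\<^sup>+\<omega>. ennreal (1 / (\<xi>\<^sup>2 + (0 + \<xi> * \<omega>)\<^sup>2)) \<partial>lborel)"
    by (rule nn_integral_real_affine) (use assms in auto)
  also have "(\<integral>\<^sup>+\<omega>. ennreal (1 / (\<xi>\<^sup>2 + (0 + \<xi> * \<omega>)\<^sup>2)) \<partial>lborel) = (\<integral>\<^sup>+\<omega>. ennreal (1 / \<xi>\<^sup>2) * ennreal (1 / (1 + \<omega>\<^sup>2)) \<partial>lborel)"
  proof (rule nn_integral_cong)
    fix \<omega> :: real
    have "\<xi>\<^sup>2 + (0 + \<xi> * \<omega>)\<^sup>2 = \<xi>\<^sup>2 * (1 + \<omega>\<^sup>2)" by (simp add: power_mult_distrib distrib_left)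
    then have "1 / (\<xi>\<^sup>2 + (0 + \<xi> * \<omega>)\<^sup>2) = (1 / \<xi>\<^sup>2) * (1 / (1 + \<omega>\<^sup>2))" by simp
    then show "ennreal (1 / (\<xi>\<^sup>2 + (0 + \<xi> * \<omega>)\<^sup>2)) = ennreal (1 / \<xi>\<^sup>2) * ennreal (1 / (1 + \<omega>\<^sup>2))"
      by (simp only: ennreal_mult[symmetric] zero_le_divide_1_iff zero_le_power2 add_nonneg_nonneg zero_le_one)
  qed
  also have "\<dots> = ennreal (1 / \<xi>\<^sup>2) * ennreal kernel_mass"
    by (subst nn_integral_cmult) (auto simp only: nn_integral_kernel, measurable)
  also have "ennreal \<bar>\<xi>\<bar> * (ennreal (1 / \<xi>\<^sup>2) * ennreal kernel_mass) = ennreal (\<bar>\<xi>\<bar> * (1 / \<xi>\<^sup>2 * kernel_mass))"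
    by (simp only: ennreal_mult[symmetric] zero_le_divide_1_iff zero_le_power2 kernel_mass_nonneg abs_ge_zero mult_nonneg_nonneg)
  also have "\<bar>\<xi>\<bar> * (1 / \<xi>\<^sup>2 * kernel_mass) = kernel_mass / \<xi>"
    using assms by (simp add: power2_eq_square)
  finally show ?thesis .
qed

lemma inverse_line_sqint:
  assumes "\<xi> > 0"
  shows "sqint (line (\<lambda>s. 1 / s) \<xi>)" "l2 (line (\<lambda>s. 1 / s) \<xi>) = sqrt (kernel_mass / \<xi>)"
proof -
  have "continuous_on {s. Re s > 0} (\<lambda>s::complex. 1 / s)" by (intro continuous_intros) auto
  then show "sqint (line (\<lambda>s. 1 / s) \<xi>)"
    unfolding sqint_def using line_measurable[OF _ assms] by (simp add: nrm2_inverse_line[OF assms])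
  show "l2 (line (\<lambda>s. 1 / s) \<xi>) = sqrt (kernel_mass / \<xi>)"
    unfolding l2_def nrm2_inverse_line[OF assms] using assms kernel_mass_nonneg by simp
qed

section \<open>Vanishing line integrals and point evaluation\<close>

text \<open>Cauchy-Schwarz with \<phi> and \<open>1 / s\<close> bounds the integral over a line far
  to the right by a constant times \<open>1 / sqrt b\<close>, and by the shift lemma the integral is
  the same on all lines. The estimate is asked only for large \<open>|s|\<close>, since in the
  applications \<open>g\<close> is a quotient of \<phi> by linear factors with zeros in the
  half-plane.\<close>

lemma hardy2_line_integral_zero:
  assumes \<phi>: "hardy2 \<phi>" and g: "g holomorphic_on {s. Re s > 0}" and C: "C \<ge> 0"
    and le: "\<And>s. Re s > 0 \<Longrightarrow> cmod s \<ge> R \<Longrightarrow> cmod (g s) \<le> C * (cmod (\<phi> s) / cmod s)"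
    and \<xi>: "\<xi> > 0"
  shows "(\<integral>\<omega>. line g \<xi> \<omega> \<partial>lborel) = 0"
proof -
  define R' where "R' = max R 1"
  define h where "h = line (\<lambda>s. 1 / s :: complex)"
  obtain M where M: "M \<ge> 0" "\<And>\<xi>. \<xi> > 0 \<Longrightarrow> l2 (line \<phi> \<xi>) \<le> M"
    using hardy2_l2_bound[OF \<phi>] by blast
  have contg: "continuous_on {s. Re s > 0} g" using g by (rule holomorphic_on_imp_continuous_on)
  have pt: "ennreal (cmod (g s)) \<le> ennreal C * ennreal (cmod (line \<phi> (Re s) (Im s) * h (Re s) (Im s)))"
    if "Re s > 0" "cmod s \<ge> R'" for s
  proof -
    have "cmod (g s) \<le> C * (cmod (\<phi> s) / cmod s)" using that by (intro le) (auto simp: R'_def)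
    also have "\<dots> = C * cmod (line \<phi> (Re s) (Im s) * h (Re s) (Im s))"
      by (simp add: line_def h_def norm_mult norm_divide)
    finally show ?thesis using C by (simp add: ennreal_mult[symmetric] ennreal_leI)
  qed
  have prod: "(\<integral>\<^sup>+\<omega>. ennreal C * ennreal (cmod (line \<phi> x \<omega> * h x \<omega>)) \<partial>lborel) \<le> ennreal (C * (M * sqrt (kernel_mass / x)))"
    if x: "x > 0" for x
  proof -
    note [measurable] = sqint_meas[OF hardy2_sqint[OF \<phi> x]] sqint_meas[OF inverse_line_sqint(1)[OF x], folded h_def]
    have "(\<integral>\<^sup>+\<omega>. ennreal C * ennreal (cmod (line \<phi> x \<omega> * h x \<omega>)) \<partial>lborel)
        = ennreal C * (\<integral>\<^sup>+\<omega>. ennreal (cmod (line \<phi> x \<omega> * h x \<omega>)) \<partial>lborel)"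
      by (rule nn_integral_cmult) measurable
    also have "\<dots> \<le> ennreal C * ennreal (l2 (line \<phi> x) * l2 (h x))"
      unfolding h_def by (intro mult_left_mono nn_integral_mult_le hardy2_sqint \<phi> inverse_line_sqint x) simp
    also have "\<dots> \<le> ennreal C * ennreal (M * sqrt (kernel_mass / x))"
      unfolding h_def inverse_line_sqint(2)[OF x]
      using M x kernel_mass_nonneg by (intro mult_left_mono ennreal_leI mult_right_mono) auto
    also have "\<dots> = ennreal (C * (M * sqrt (kernel_mass / x)))"
      using C M x kernel_mass_nonneg by (intro ennreal_mult[symmetric]) auto
    finally show ?thesis .
  qed
  have shift: "(\<integral>\<omega>. line g \<xi> \<omega> \<partial>lborel) = (\<integral>\<omega>. line g b \<omega> \<partial>lborel)" if b: "b \<ge> \<xi>" for b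
  proof -
    \<comment> \<open>Between the two lines, the points not covered by the estimate lie in this
      rectangle, where \<open>g\<close> is bounded by compactness.\<close>
    define K where "K = cbox (Complex \<xi> (-R')) (Complex b R')"
    have "compact (g ` K)" unfolding K_def
      by (intro compact_continuous_image compact_cbox continuous_on_subset[OF contg])
        (use \<xi> in \<open>auto simp: in_cbox_complex_iff\<close>)
    then obtain B where B: "\<And>s. s \<in> K \<Longrightarrow> cmod (g s) \<le> B"
      using compact_imp_bounded by (fastforce simp: bounded_iff)
    define B' where "B' = max B 0"
    show ?thesis unfolding line_def
    proof (rule line_integral_shift[where lo=0 and hi="b + 1"])
      show "g holomorphic_on {s. 0 < Re s \<and> Re s < b + 1}" using g by (rule holomorphic_on_subset) auto
      show "0 < \<xi>" "\<xi> \<le> b" "b < b + 1" using \<xi> b by auto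
      fix x assume x: "\<xi> \<le> x" "x \<le> b"
      then have x0: "x > 0" using \<xi> by simp
      note [measurable] = sqint_meas[OF hardy2_sqint[OF \<phi> x0]] sqint_meas[OF inverse_line_sqint(1)[OF x0], folded h_def]
      have "(\<integral>\<^sup>+\<omega>. ennreal (cmod (g (Complex x \<omega>))) \<partial>lborel)
        \<le> (\<integral>\<^sup>+\<omega>. ennreal B' * indicator {-R'..R'} \<omega> + ennreal C * ennreal (cmod (line \<phi> x \<omega> * h x \<omega>)) \<partial>lborel)"
      proof (rule nn_integral_mono)
        fix \<omega> :: real
        show "ennreal (cmod (g (Complex x \<omega>))) \<le> ennreal B' * indicator {-R'..R'} \<omega> + ennreal C * ennreal (cmod (line \<phi> x \<omega> * h x \<omega>))"
        proof (cases "\<omega> \<in> {-R'..R'}")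
          case True
          then have "cmod (g (Complex x \<omega>)) \<le> B'"
            using B[of "Complex x \<omega>"] x by (auto simp: K_def B'_def in_cbox_complex_iff)
          then have "ennreal (cmod (g (Complex x \<omega>))) \<le> ennreal B'" by (rule ennreal_leI)
          also have "\<dots> \<le> ennreal B' * indicator {-R'..R'} \<omega> + ennreal C * ennreal (cmod (line \<phi> x \<omega> * h x \<omega>))"
            using True by simp
          finally show ?thesis .
        next
          case False
          then have "R' \<le> \<bar>Im (Complex x \<omega>)\<bar>" by auto
          also have "\<dots> \<le> cmod (Complex x \<omega>)" by (rule abs_Im_le_cmod)
          finally show ?thesis using pt[of "Complex x \<omega>"] x0 False by simp
        qed
      qed
      also have "\<dots> = (\<integral>\<^sup>+\<omega>. ennreal B' * indicator {-R'..R'} \<omega> \<partial>lborel) + (\<integral>\<^sup>+\<omega>. ennreal C * ennreal (cmod (line \<phi> x \<omega> * h x \<omega>)) \<partial>lborel)"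
        by (rule nn_integral_add) measurable
      also have "(\<integral>\<^sup>+\<omega>. ennreal B' * indicator {-R'..R'} \<omega> \<partial>lborel) = ennreal (B' * (2 * R'))"
        by (simp add: nn_integral_cmult ennreal_mult B'_def R'_def)
      also have "ennreal (B' * (2 * R')) + (\<integral>\<^sup>+\<omega>. ennreal C * ennreal (cmod (line \<phi> x \<omega> * h x \<omega>)) \<partial>lborel)
        \<le> ennreal (B' * (2 * R')) + ennreal (C * (M * sqrt (kernel_mass / \<xi>)))"
      proof (intro add_left_mono order_trans[OF prod[OF x0]] ennreal_leI mult_left_mono)
        show "sqrt (kernel_mass / x) \<le> sqrt (kernel_mass / \<xi>)"
          using x \<xi> kernel_mass_nonneg by (intro real_sqrt_le_mono divide_left_mono) auto
      qed (use C M in auto)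
      also have "\<dots> = ennreal (B' * (2 * R') + C * (M * sqrt (kernel_mass / \<xi>)))"
        using C M \<xi> kernel_mass_nonneg by (intro ennreal_plus[symmetric]) (auto simp: B'_def R'_def)
      finally show "(\<integral>\<^sup>+\<omega>. ennreal (cmod (g (Complex x \<omega>))) \<partial>lborel) \<le> \<dots>" .
    qed
  qed
  define I where "I = (\<integral>\<omega>. line g \<xi> \<omega> \<partial>lborel)"
  \<comment> \<open>For \<open>b >= R'\<close> the entire line lies in the region of the estimate,
    so the compact part does not contribute.\<close>
  have small: "cmod I \<le> C * (M * sqrt (kernel_mass / b))" if b: "b \<ge> max \<xi> R'" for b
  proof -
    have b0: "b > 0" using \<xi> b by simp
    have I: "I = (\<integral>\<omega>. line g b \<omega> \<partial>lborel)" unfolding I_def using b by (intro shift) auto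
    have m: "line g b \<in> borel_measurable lborel" by (rule line_measurable[OF contg b0])
    have "(\<integral>\<^sup>+\<omega>. ennreal (cmod (line g b \<omega>)) \<partial>lborel) \<le> (\<integral>\<^sup>+\<omega>. ennreal C * ennreal (cmod (line \<phi> b \<omega> * h b \<omega>)) \<partial>lborel)"
    proof (rule nn_integral_mono)
      fix \<omega>
      have "b \<le> cmod (Complex b \<omega>)" using complex_Re_le_cmod[of "Complex b \<omega>"] by simp
      then show "ennreal (cmod (line g b \<omega>)) \<le> ennreal C * ennreal (cmod (line \<phi> b \<omega> * h b \<omega>))"
        using pt[of "Complex b \<omega>"] b b0 by (simp add: line_def)
    qed
    also have "\<dots> \<le> ennreal (C * (M * sqrt (kernel_mass / b)))" by (rule prod[OF b0])
    finally have n: "(\<integral>\<^sup>+\<omega>. ennreal (cmod (line g b \<omega>)) \<partial>lborel) \<le> ennreal (C * (M * sqrt (kernel_mass / b)))" .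
    then have "integrable lborel (line g b)"
      by (intro integrableI_bounded[OF m] order_le_less_trans[OF n]) simp
    from order_trans[OF integral_norm_bound_ennreal[OF this] n]
    have "ennreal (cmod I) \<le> ennreal (C * (M * sqrt (kernel_mass / b)))" by (simp add: I)
    then show ?thesis using C M b0 kernel_mass_nonneg by (subst (asm) ennreal_le_iff) auto
  qed
  have "cmod I \<le> C * (M * sqrt 0)"
  proof (rule tendsto_lowerbound)
    have "((\<lambda>b. kernel_mass / b) \<longlongrightarrow> 0) at_top"
      by (rule tendsto_divide_0[OF tendsto_const filterlim_at_top_imp_at_infinity[OF filterlim_ident]])
    then show "((\<lambda>b. C * (M * sqrt (kernel_mass / b))) \<longlongrightarrow> C * (M * sqrt 0)) at_top"
      by (intro tendsto_intros)
    show "\<forall>\<^sub>F b in at_top. cmod I \<le> C * (M * sqrt (kernel_mass / b))"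
      using eventually_ge_at_top[of "max \<xi> R'"] by eventually_elim (rule small)
  qed simp
  then show ?thesis by (simp add: I_def)
qed

text \<open>Removal of the singularity of the difference quotient. Its value at \<sigma> is the
  derivative, so a zero of the derivative allows a second factor to be split off.\<close>

lemma holomorphic_zero_factor:
  assumes "f holomorphic_on S" "open S" "\<sigma> \<in> S" "f \<sigma> = 0"
  obtains g where "g holomorphic_on S" "\<And>s. s \<in> S \<Longrightarrow> f s = (s - \<sigma>) * g s" "g \<sigma> = deriv f \<sigma>"
proof
  show "(\<lambda>z. if z = \<sigma> then deriv f \<sigma> else (f z - f \<sigma>) / (z - \<sigma>)) holomorphic_on S"
    by (rule pole_lemma_open[OF assms(1,2)])
qed (use assms in auto)

lemma cmod_diff_ge_half:
  assumes "cmod s \<ge> 2 * cmod \<sigma>"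
  shows "cmod s \<le> 2 * cmod (s - \<sigma>)"
  using norm_triangle_ineq2[of s \<sigma>] assms by linarith

text \<open>A Cauchy formula for the half-plane to the right of the line
  \<open>Re s = Re \<sigma> / 4\<close>, obtained without residues: a multiple of a pole outside the
  right half-plane is subtracted so that the rest vanishes at \<sigma>, and dividing by
  \<open>s - \<sigma>\<close> gives a vanishing line integral.\<close>

lemma hardy2_eval_bound:
  assumes \<sigma>: "Re \<sigma> > 0"
  obtains K where "K \<ge> 0" "\<And>f. hardy2 f \<Longrightarrow> cmod (f \<sigma>) \<le> K * l2 (line f (Re \<sigma> / 4))"
proof -
  define \<xi> where "\<xi> = Re \<sigma> / 4"
  define d where "d = Re \<sigma> - \<xi>"
  \<comment> \<open>The reflection of \<sigma> in the line \<open>Re s = \<xi>\<close>. Its real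
    part is \<open>2 * \<xi> - Re \<sigma>\<close>, which is negative since \<xi> is below half of
    \<open>Re \<sigma>\<close>. The factor \<open>2 * d\<close> in \<open>q\<close> equals
    \<open>\<sigma> - l\<close> and normalizes \<open>q \<sigma>\<close> to 1.\<close>
  define l where "l = of_real (2 * \<xi>) - cnj \<sigma>"
  define q where "q s = of_real (2 * d) * (1 / (s - l))" for s
  have \<xi>: "\<xi> > 0" and d: "d > 0" and l: "Re l < 0" using \<sigma> by (auto simp: \<xi>_def d_def l_def)
  have q: "hardy2 q" unfolding q_def by (intro hardy2_cmult hardy2_pole l)
  have q\<sigma>: "q \<sigma> = 1"
  proof -
    have "\<sigma> - l = of_real (2 * d)" by (simp add: l_def d_def complex_eq_iff)
    then show ?thesis using d by (simp add: q_def)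
  qed
  define k where "k = line (\<lambda>s. 1 / (s - \<sigma>)) \<xi>"
  have ne: "Complex \<xi> \<omega> - \<sigma> \<noteq> 0" for \<omega> using d by (auto simp: complex_eq_iff d_def)
  have k: "sqint k"
  proof -
    obtain C where C: "C \<ge> 0" "\<And>s. Re s \<ge> -0 \<Longrightarrow> cmod (1 / (s - Complex (-d) (Im \<sigma>))) \<le> C / (1 + cmod s)"
      using pole_decay[of "Complex (-d) (Im \<sigma>)" 0] d by auto
    have "nrm2 k \<le> ennreal (C\<^sup>2 * kernel_mass)"
    proof (rule nrm2_decay_le)
      fix \<omega>
      have "cmod (Complex \<xi> \<omega> - \<sigma>) = cmod (Complex 0 \<omega> - Complex (-d) (Im \<sigma>))"
        by (simp add: cmod_def d_def power2_eq_square algebra_simps)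
      then have "cmod (k \<omega>) = cmod (1 / (Complex 0 \<omega> - Complex (-d) (Im \<sigma>)))"
        by (simp only: k_def line_def norm_divide)
      also have "\<dots> \<le> C / (1 + cmod (Complex 0 \<omega>))" by (rule C) simp
      finally show "cmod (k \<omega>) \<le> C / (1 + \<bar>\<omega>\<bar>)" by (rule cmod_le_decay[OF _ C(1)])
    qed
    then have "nrm2 k < \<infinity>" by (rule order_le_less_trans) simp
    moreover have "continuous_on UNIV k" unfolding k_def line_def
      using ne by (intro continuous_intros) auto
    ultimately show ?thesis unfolding sqint_def by (simp add: borel_measurable_continuous_onI)
  qed
  have kpos: "l2 k > 0"
  proof (rule ccontr)
    assume "\<not> l2 k > 0"
    then have "l2 k = 0" using l2_nonneg[of k] by simp
    then have "nrm2 k = 0" using nrm2_eq_l2[OF k] by simp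
    then have "AE \<omega> in lborel. k \<omega> = 0"
      unfolding nrm2_def using sqint_meas[OF k] by (subst (asm) nn_integral_0_iff_AE) auto
    then have "AE \<omega> in (lborel :: real measure). False"
      by eventually_elim (use ne in \<open>auto simp: k_def line_def\<close>)
    then have "emeasure lborel (UNIV :: real set) = 0"
      by (subst (asm) AE_iff_measurable[of UNIV]) auto
    then show False by simp
  qed
  show ?thesis
  proof
    show "1 / (2 * d * l2 k) \<ge> 0" using d kpos by simp
    fix f assume f: "hardy2 f"
    define \<phi> where "\<phi> s = f s - f \<sigma> * q s" for s
    have \<phi>: "hardy2 \<phi>" unfolding \<phi>_def by (intro hardy2_diff hardy2_cmult f q)
    obtain g where g: "g holomorphic_on {s. Re s > 0}" "\<And>s. s \<in> {s. Re s > 0} \<Longrightarrow> \<phi> s = (s - \<sigma>) * g s"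
      using holomorphic_zero_factor[OF hardy2_holomorphic[OF \<phi>] open_rhp, of \<sigma>] \<sigma> q\<sigma> by (auto simp: \<phi>_def)
    have zero: "(\<integral>\<omega>. line g \<xi> \<omega> \<partial>lborel) = 0"
    proof (rule hardy2_line_integral_zero[OF \<phi> g(1), where C=2 and R="2 * cmod \<sigma> + 1"])
      fix s assume s: "Re s > 0" "2 * cmod \<sigma> + 1 \<le> cmod s"
      have "cmod s * cmod (g s) \<le> 2 * cmod (s - \<sigma>) * cmod (g s)"
        using s by (intro mult_right_mono cmod_diff_ge_half) auto
      also have "\<dots> = 2 * cmod (\<phi> s)" using g(2)[of s] s by (simp add: norm_mult)
      finally have "cmod s * cmod (g s) \<le> 2 * cmod (\<phi> s)" .
      moreover have "cmod s > 0" using s norm_ge_zero[of \<sigma>] by linarith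
      ultimately show "cmod (g s) \<le> 2 * (cmod (\<phi> s) / cmod s)"
        by (simp add: field_simps)
    qed (use \<xi> in auto)
    \<comment> \<open>On this line \<open>s - l = - cnj (s - \<sigma>)\<close>, so the subtracted
      term becomes \<open>f \<sigma>\<close> times a positive multiple of the squared modulus of the
      kernel. Integration therefore solves for \<open>f \<sigma>\<close>.\<close>
    have gline: "line g \<xi> \<omega> = line f \<xi> \<omega> * k \<omega> + f \<sigma> * of_real (2 * d * (cmod (k \<omega>))\<^sup>2)" for \<omega>
    proof -
      define s where "s = Complex \<xi> \<omega>"
      have ns: "s - \<sigma> \<noteq> 0" using ne by (simp add: s_def)
      define z where "z = s - \<sigma>"
      have sl: "s - l = - cnj z" by (simp add: z_def s_def l_def complex_eq_iff)
      have "1 / (s - l) * (1 / z) = - ((1 / z) * cnj (1 / z))" unfolding sl by simp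
      also have "(1 / z) * cnj (1 / z) = complex_of_real ((cmod (1 / z))\<^sup>2)"
        by (rule complex_norm_square[symmetric])
      finally have e: "1 / (s - l) * (1 / z) = - complex_of_real ((cmod (1 / z))\<^sup>2)" .
      have "g s = \<phi> s * (1 / z)" using g(2)[of s] ns \<xi> by (simp add: s_def z_def)
      also have "\<dots> = f s * (1 / z) - f \<sigma> * of_real (2 * d) * (1 / (s - l) * (1 / z))"
        unfolding \<phi>_def q_def by (simp add: algebra_simps)
      also have "\<dots> = f s * (1 / z) + f \<sigma> * of_real (2 * d * (cmod (1 / z))\<^sup>2)"
        unfolding e by simp
      finally show ?thesis
        unfolding k_def line_def s_def[symmetric] z_def .
    qed
    have "0 = (\<integral>\<omega>. line f \<xi> \<omega> * k \<omega> \<partial>lborel) + f \<sigma> * of_real (2 * d * (l2 k)\<^sup>2)"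
    proof -
      have i1: "integrable lborel (\<lambda>\<omega>. line f \<xi> \<omega> * k \<omega>)"
        by (intro sqint_mult_integrable hardy2_sqint f \<xi> k)
      have i2: "integrable lborel (\<lambda>\<omega>. complex_of_real (2 * d * (cmod (k \<omega>))\<^sup>2))"
        by (intro integrable_of_real integrable_mult_right sqint_integrable k)
      have "0 = (\<integral>\<omega>. line f \<xi> \<omega> * k \<omega> + f \<sigma> * complex_of_real (2 * d * (cmod (k \<omega>))\<^sup>2) \<partial>lborel)"
        using zero unfolding gline by (simp only:)
      also have "\<dots> = (\<integral>\<omega>. line f \<xi> \<omega> * k \<omega> \<partial>lborel) + (\<integral>\<omega>. f \<sigma> * complex_of_real (2 * d * (cmod (k \<omega>))\<^sup>2) \<partial>lborel)"
        by (intro Bochner_Integration.integral_add i1 integrable_mult_right i2)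
      also have "(\<integral>\<omega>. f \<sigma> * complex_of_real (2 * d * (cmod (k \<omega>))\<^sup>2) \<partial>lborel) = f \<sigma> * (\<integral>\<omega>. complex_of_real (2 * d * (cmod (k \<omega>))\<^sup>2) \<partial>lborel)"
        by (rule Bochner_Integration.integral_mult_right_zero)
      also have "(\<integral>\<omega>. complex_of_real (2 * d * (cmod (k \<omega>))\<^sup>2) \<partial>lborel) = complex_of_real (\<integral>\<omega>. 2 * d * (cmod (k \<omega>))\<^sup>2 \<partial>lborel)"
        by (rule integral_complex_of_real)
      also have "(\<integral>\<omega>. 2 * d * (cmod (k \<omega>))\<^sup>2 \<partial>lborel) = 2 * d * (l2 k)\<^sup>2"
        unfolding l2_squared[OF k] by (rule Bochner_Integration.integral_mult_right_zero)
      finally show ?thesis .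
    qed
    then have "f \<sigma> * of_real (2 * d * (l2 k)\<^sup>2) = - (\<integral>\<omega>. line f \<xi> \<omega> * k \<omega> \<partial>lborel)"
      by (simp add: eq_neg_iff_add_eq_0 add.commute)
    then have "cmod (f \<sigma>) * (2 * d * (l2 k)\<^sup>2) = cmod (\<integral>\<omega>. line f \<xi> \<omega> * k \<omega> \<partial>lborel)"
      using d by (metis (no_types, lifting) norm_minus_cancel norm_mult norm_of_real abs_of_nonneg less_imp_le mult_nonneg_nonneg zero_le_numeral zero_le_power2)
    also have "\<dots> \<le> l2 (line f \<xi>) * l2 k" by (intro integral_mult_le hardy2_sqint f \<xi> k)
    finally show "cmod (f \<sigma>) \<le> 1 / (2 * d * l2 k) * l2 (line f (Re \<sigma> / 4))"
      using d kpos by (simp add: field_simps power2_eq_square \<xi>_def)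
  qed
qed

text \<open>The conjugate of \<open>1 / (s' - a)\<close> at the mirror image \<open>s' = - cnj s\<close> is \<open>1 / (- cnj a - s)\<close>.\<close>

lemma hardy2_reflected_pole_zero:
  assumes \<phi>: "hardy2 \<phi>" "\<phi> (- cnj a) = 0" and \<xi>: "0 < \<xi>" "\<xi> < - Re a"
  shows "(\<integral>\<omega>. line \<phi> \<xi> \<omega> * cnj (1 / (Complex (-\<xi>) \<omega> - a)) \<partial>lborel) = 0"
proof -
  define \<sigma> where "\<sigma> = - cnj a"
  have \<sigma>: "Re \<sigma> > 0" using \<xi> by (simp add: \<sigma>_def)
  obtain g where g: "g holomorphic_on {s. Re s > 0}" "\<And>s. s \<in> {s. Re s > 0} \<Longrightarrow> \<phi> s = (s - \<sigma>) * g s"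
    using holomorphic_zero_factor[OF hardy2_holomorphic[OF \<phi>(1)] open_rhp, of \<sigma>] \<sigma> \<phi>(2) by (auto simp: \<sigma>_def)
  have zero: "(\<integral>\<omega>. line (\<lambda>s. - g s) \<xi> \<omega> \<partial>lborel) = 0"
  proof (rule hardy2_line_integral_zero[OF \<phi>(1), where C=2 and R="2 * cmod \<sigma> + 1"])
    show "(\<lambda>s. - g s) holomorphic_on {s. Re s > 0}" using g(1) by (rule holomorphic_on_minus)
    fix s assume s: "Re s > 0" "2 * cmod \<sigma> + 1 \<le> cmod s"
    have "cmod s * cmod (g s) \<le> 2 * cmod (s - \<sigma>) * cmod (g s)"
      using s by (intro mult_right_mono cmod_diff_ge_half) auto
    also have "\<dots> = 2 * cmod (\<phi> s)" using g(2)[of s] s by (simp add: norm_mult)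
    finally have "cmod s * cmod (g s) \<le> 2 * cmod (\<phi> s)" .
    moreover have "cmod s > 0" using s norm_ge_zero[of \<sigma>] by linarith
    ultimately show "cmod (- g s) \<le> 2 * (cmod (\<phi> s) / cmod s)"
      by (simp add: field_simps)
  qed (use \<xi> in auto)
  have "line \<phi> \<xi> \<omega> * cnj (1 / (Complex (-\<xi>) \<omega> - a)) = line (\<lambda>s. - g s) \<xi> \<omega>" for \<omega>
  proof -
    define s where "s = Complex \<xi> \<omega>"
    have "cnj (Complex (-\<xi>) \<omega> - a) = \<sigma> - s" by (simp add: s_def \<sigma>_def complex_eq_iff)
    then have c: "cnj (1 / (Complex (-\<xi>) \<omega> - a)) = 1 / (\<sigma> - s)" by (simp only: complex_cnj_divide complex_cnj_one)
    have "\<sigma> - s \<noteq> 0" using \<xi> by (auto simp: \<sigma>_def s_def complex_eq_iff)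
    moreover have "\<phi> s = - ((\<sigma> - s) * g s)" using g(2)[of s] \<xi> by (simp add: s_def algebra_simps)
    ultimately show ?thesis unfolding c line_def s_def[symmetric] by simp
  qed
  then show ?thesis using zero by simp
qed

text \<open>Two zeros of \<phi>, counted with multiplicity, cancel the two mirrored poles. The
  quotient gains two powers of \<open>1 / |s|\<close> and the linear numerator gives one back, which
  leaves exactly what \<open>hardy2_line_integral_zero\<close> needs.\<close>

lemma hardy2_reflected_two_poles_zero:
  assumes \<phi>: "hardy2 \<phi>" "\<phi> (- cnj a) = 0" 
    and ab: "if a = b then deriv \<phi> (- cnj a) = 0 else \<phi> (- cnj b) = 0"
    and \<xi>: "0 < \<xi>" "\<xi> < - Re a" "\<xi> < - Re b"
  shows "(\<integral>\<omega>. line \<phi> \<xi> \<omega> * cnj ((k0 + k1 * Complex (-\<xi>) \<omega>) / ((Complex (-\<xi>) \<omega> - a) * (Complex (-\<xi>) \<omega> - b))) \<partial>lborel) = 0"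
proof -
  define \<sigma> where "\<sigma> = - cnj a"
  define \<tau> where "\<tau> = - cnj b"
  have \<sigma>: "Re \<sigma> > 0" and \<tau>: "Re \<tau> > 0" using \<xi> by (simp_all add: \<sigma>_def \<tau>_def)
  obtain h where h: "h holomorphic_on {s. Re s > 0}" "\<And>s. s \<in> {s. Re s > 0} \<Longrightarrow> \<phi> s = (s - \<sigma>) * h s" "h \<sigma> = deriv \<phi> \<sigma>"
    using holomorphic_zero_factor[OF hardy2_holomorphic[OF \<phi>(1)] open_rhp, of \<sigma>] \<sigma> \<phi>(2) by (auto simp: \<sigma>_def)
  \<comment> \<open>For a double pole the value \<open>h \<sigma>\<close> is the derivative of
    \<phi>; for distinct poles the factor \<open>\<tau> - \<sigma>\<close> can be cancelled.\<close>
  have "h \<tau> = 0"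
  proof (cases "a = b")
    case True then show ?thesis using h(3) ab by (simp add: \<sigma>_def \<tau>_def)
  next
    case False
    then have "\<tau> - \<sigma> \<noteq> 0" by (auto simp: \<sigma>_def \<tau>_def)
    moreover have "(\<tau> - \<sigma>) * h \<tau> = 0" using h(2)[of \<tau>] \<tau> ab False by (simp add: \<tau>_def)
    ultimately show ?thesis by simp
  qed
  then obtain g0 where g0: "g0 holomorphic_on {s. Re s > 0}" "\<And>s. s \<in> {s. Re s > 0} \<Longrightarrow> h s = (s - \<tau>) * g0 s"
    using holomorphic_zero_factor[OF h(1) open_rhp, of \<tau>] \<tau> by auto
  define g where "g s = g0 s * (cnj k0 - cnj k1 * s)" for s
  \<comment> \<open>The 4 comes from \<open>|s| <= 2 |s - \<sigma>|\<close> and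
    \<open>|s| <= 2 |s - \<tau>|\<close>; the sum bounds the numerator by a multiple of
    \<open>|s|\<close> once \<open>|s| >= 1\<close>.\<close>
  define C where "C = 4 * (cmod k0 + cmod k1)"
  have zero: "(\<integral>\<omega>. line g \<xi> \<omega> \<partial>lborel) = 0"
  proof (rule hardy2_line_integral_zero[OF \<phi>(1), where C=C and R="2 * cmod \<sigma> + 2 * cmod \<tau> + 1"])
    show "g holomorphic_on {s. Re s > 0}" unfolding g_def by (intro holomorphic_intros g0(1))
    show "C \<ge> 0" by (simp add: C_def)
    fix s assume s: "Re s > 0" "2 * cmod \<sigma> + 2 * cmod \<tau> + 1 \<le> cmod s"
    have s1: "cmod s \<ge> 1" using s norm_ge_zero[of \<sigma>] norm_ge_zero[of \<tau>] by linarith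
    have r: "2 * cmod \<sigma> \<le> cmod s" "2 * cmod \<tau> \<le> cmod s"
      using s norm_ge_zero[of \<sigma>] norm_ge_zero[of \<tau>] by linarith+
    have "cmod s * cmod s \<le> (2 * cmod (s - \<sigma>)) * (2 * cmod (s - \<tau>))"
      by (intro mult_mono cmod_diff_ge_half r) auto
    then have "cmod s * cmod s * cmod (g0 s) \<le> (2 * cmod (s - \<sigma>)) * (2 * cmod (s - \<tau>)) * cmod (g0 s)"
      by (intro mult_right_mono) auto
    also have "\<dots> = 4 * cmod (\<phi> s)" using h(2)[of s] g0(2)[of s] s by (simp add: norm_mult)
    finally have 1: "cmod s * cmod s * cmod (g0 s) \<le> 4 * cmod (\<phi> s)" .
    have "cmod (cnj k0 - cnj k1 * s) \<le> cmod k0 + cmod k1 * cmod s"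
      using norm_triangle_ineq4[of "cnj k0" "cnj k1 * s"] by (simp add: norm_mult)
    also have "\<dots> \<le> (cmod k0 + cmod k1) * cmod s"
      using mult_left_mono[OF s1, of "cmod k0"] by (simp add: algebra_simps)
    finally have 2: "cmod (cnj k0 - cnj k1 * s) \<le> (cmod k0 + cmod k1) * cmod s" .
    have "cmod (g s) * (cmod s * cmod s) = (cmod s * cmod s * cmod (g0 s)) * cmod (cnj k0 - cnj k1 * s)"
      by (simp add: g_def norm_mult mult_ac)
    also have "\<dots> \<le> (4 * cmod (\<phi> s)) * ((cmod k0 + cmod k1) * cmod s)"
      by (rule mult_mono[OF 1 2]) auto
    also have "\<dots> = (C * cmod (\<phi> s)) * cmod s" by (simp add: C_def mult_ac)
    finally have "(cmod (g s) * cmod s) * cmod s \<le> (C * cmod (\<phi> s)) * cmod s"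
      by (simp only: mult.assoc)
    then have "cmod (g s) * cmod s \<le> C * cmod (\<phi> s)"
      by (rule mult_right_le_imp_le) (use s1 in linarith)
    moreover have "cmod s > 0" using s1 by linarith
    ultimately show "cmod (g s) \<le> C * (cmod (\<phi> s) / cmod s)"
      by (simp only: times_divide_eq_right pos_le_divide_eq)
  qed (use \<xi> in auto)
  have "line \<phi> \<xi> \<omega> * cnj ((k0 + k1 * Complex (-\<xi>) \<omega>) / ((Complex (-\<xi>) \<omega> - a) * (Complex (-\<xi>) \<omega> - b))) = line g \<xi> \<omega>" for \<omega>
  proof -
    define s where "s = Complex \<xi> \<omega>"
    have c: "cnj (Complex (-\<xi>) \<omega> - a) = \<sigma> - s" "cnj (Complex (-\<xi>) \<omega> - b) = \<tau> - s" "cnj (Complex (-\<xi>) \<omega>) = - s"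
      by (simp_all add: s_def \<sigma>_def \<tau>_def complex_eq_iff)
    have "\<sigma> - s \<noteq> 0" "\<tau> - s \<noteq> 0" using \<xi> by (auto simp: \<sigma>_def \<tau>_def s_def complex_eq_iff)
    moreover have "\<phi> s = (\<sigma> - s) * (\<tau> - s) * g0 s"
    proof -
      have "\<phi> s = (s - \<sigma>) * ((s - \<tau>) * g0 s)" using h(2)[of s] g0(2)[of s] \<xi> by (simp add: s_def)
      then show ?thesis by (simp add: algebra_simps)
    qed
    ultimately show ?thesis
      unfolding complex_cnj_divide complex_cnj_mult complex_cnj_add c line_def s_def[symmetric] g_def by simp
  qed
  then show ?thesis using zero by simp
qed

section \<open>Inner products on mirrored lines\<close>

text \<open>Dominated convergence: both lines tend pointwise to the values on the imaginary axis,
  where \<open>E\<close> is still continuous, and the decay bound is a square integrable majorant.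
  The lines are indexed by a sequence to suit that theorem.\<close>

lemma reflected_line_tendsto:
  fixes E :: "complex \<Rightarrow> complex" and X :: "nat \<Rightarrow> real"
  assumes cont: "continuous_on {s. Re s \<ge> -\<delta>} E" and C: "C \<ge> 0"
    and decay: "\<And>s. Re s \<ge> -\<delta> \<Longrightarrow> cmod (E s) \<le> C / (1 + cmod s)"
    and X: "\<And>n. 0 < X n" "\<And>n. X n \<le> \<delta>" "X \<longlonglongrightarrow> 0"
  shows "(\<lambda>n. nrm2 (\<lambda>\<omega>. line E (- X n) \<omega> - line E (X n) \<omega>)) \<longlonglongrightarrow> 0"
proof -
  have contl: "continuous_on UNIV (line E x)" if "x \<ge> -\<delta>" for x
    unfolding line_def by (rule continuous_on_compose2[OF cont]) (use that in \<open>auto intro!: continuous_intros\<close>)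
  have X': "- X n \<ge> -\<delta>" "X n \<ge> -\<delta>" for n using X(1)[of n] X(2)[of n] by linarith+
  have [measurable]: "line E (- X n) \<in> borel_measurable borel" "line E (X n) \<in> borel_measurable borel" for n
    using contl X' by (auto intro: borel_measurable_continuous_onI)
  have "(\<lambda>n. \<integral>\<^sup>+\<omega>. ennreal ((cmod (line E (- X n) \<omega> - line E (X n) \<omega>))\<^sup>2) \<partial>lborel) \<longlonglongrightarrow> (\<integral>\<^sup>+(\<omega>::real). 0 \<partial>lborel)"
  proof (rule nn_integral_dominated_convergence[where w="\<lambda>\<omega>. ennreal ((2 * C / (1 + \<bar>\<omega>\<bar>))\<^sup>2)"])
    have le: "cmod (line E x \<omega>) \<le> C / (1 + \<bar>\<omega>\<bar>)" if "x \<ge> -\<delta>" for x \<omega>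
      unfolding line_def by (rule cmod_le_decay[OF decay C]) (use that in simp)
    show "AE \<omega> in lborel. ennreal ((cmod (line E (- X n) \<omega> - line E (X n) \<omega>))\<^sup>2) \<le> ennreal ((2 * C / (1 + \<bar>\<omega>\<bar>))\<^sup>2)" for n
    proof (intro AE_I2 ennreal_leI power_mono)
      fix \<omega>
      have "cmod (line E (- X n) \<omega> - line E (X n) \<omega>) \<le> cmod (line E (- X n) \<omega>) + cmod (line E (X n) \<omega>)"
        by (rule norm_triangle_ineq4)
      also have "\<dots> \<le> C / (1 + \<bar>\<omega>\<bar>) + C / (1 + \<bar>\<omega>\<bar>)" by (intro add_mono le X')
      finally show "cmod (line E (- X n) \<omega> - line E (X n) \<omega>) \<le> 2 * C / (1 + \<bar>\<omega>\<bar>)" by simp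
    qed simp
    have "nrm2 (\<lambda>\<omega>. complex_of_real (2 * C / (1 + \<bar>\<omega>\<bar>))) \<le> ennreal ((2 * C)\<^sup>2 * kernel_mass)"
    proof (rule nrm2_decay_le)
      fix \<omega> :: real
      show "cmod (complex_of_real (2 * C / (1 + \<bar>\<omega>\<bar>))) \<le> 2 * C / (1 + \<bar>\<omega>\<bar>)"
        unfolding norm_of_real using C by simp
    qed
    then have "nrm2 (\<lambda>\<omega>. complex_of_real (2 * C / (1 + \<bar>\<omega>\<bar>))) < \<infinity>" by (rule order_le_less_trans) simp
    then show "(\<integral>\<^sup>+(\<omega>::real). ennreal ((2 * C / (1 + \<bar>\<omega>\<bar>))\<^sup>2) \<partial>lborel) < \<infinity>"
      unfolding nrm2_def norm_of_real by (simp only: power2_abs)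
    show "AE \<omega> in lborel. (\<lambda>n. ennreal ((cmod (line E (- X n) \<omega> - line E (X n) \<omega>))\<^sup>2)) \<longlonglongrightarrow> 0"
    proof (rule AE_I2)
      fix \<omega> :: real
      have E0: "(\<lambda>n. line E (Y n) \<omega>) \<longlonglongrightarrow> line E 0 \<omega>" if "Y \<longlonglongrightarrow> 0" "\<And>n. Y n \<ge> -\<delta>" for Y
        unfolding line_def
      proof (rule continuous_on_tendsto_compose[OF cont])
        show "(\<lambda>n. Complex (Y n) \<omega>) \<longlonglongrightarrow> Complex 0 \<omega>" by (intro tendsto_intros that)
        show "Complex 0 \<omega> \<in> {s. -\<delta> \<le> Re s}" using X(1)[of 0] X(2)[of 0] by simp
      qed (use that in auto)
      have "(\<lambda>n. line E (- X n) \<omega> - line E (X n) \<omega>) \<longlonglongrightarrow> line E 0 \<omega> - line E 0 \<omega>"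
        by (intro tendsto_diff E0 X(3) X' tendsto_minus[OF X(3), simplified])
      then have "(\<lambda>n. (cmod (line E (- X n) \<omega> - line E (X n) \<omega>))\<^sup>2) \<longlonglongrightarrow> (cmod 0)\<^sup>2"
        by (intro tendsto_power tendsto_norm) simp
      then show "(\<lambda>n. ennreal ((cmod (line E (- X n) \<omega> - line E (X n) \<omega>))\<^sup>2)) \<longlonglongrightarrow> 0"
        using tendsto_ennrealI by fastforce
    qed
  qed measurable
  then show ?thesis by (simp add: nrm2_def)
qed

text \<open>The boundary inner product may be computed with \<open>f\<close> to the right of the
  axis and the continuation \<open>E\<close> of \<open>V\<close> to the left, because the two lines
  of \<open>E\<close> at distance \<open>X n\<close> from the axis become equal in the limit. The
  conjugated product on mirrored lines extends to a meromorphic function, to which the vanishing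
  lemmas apply.\<close>

lemma hardy2_inner_reflected_tendsto:
  fixes E :: "complex \<Rightarrow> complex" and X :: "nat \<Rightarrow> real"
  assumes f: "hardy2 f" "l2_boundary f bf" and V: "hardy2 V" "l2_boundary V bV"
    and VE: "\<And>s. Re s > 0 \<Longrightarrow> V s = E s"
    and cont: "continuous_on {s. Re s \<ge> -\<delta>} E" and C: "C \<ge> 0"
    and decay: "\<And>s. Re s \<ge> -\<delta> \<Longrightarrow> cmod (E s) \<le> C / (1 + cmod s)"
    and X: "\<And>n. 0 < X n" "\<And>n. X n \<le> \<delta>" "X \<longlonglongrightarrow> 0"
  shows "(\<lambda>n. \<integral>\<omega>. cnj (line f (X n) \<omega>) * line E (- X n) \<omega> \<partial>lborel) \<longlonglongrightarrow> (\<integral>\<omega>. cnj (bf \<omega>) * bV \<omega> \<partial>lborel)"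
proof -
  have F: "filterlim X (at_right 0) sequentially"
    by (simp add: filterlim_at X(1) X(3) less_imp_neq[OF X(1), symmetric])
  have contl: "continuous_on UNIV (line E x)" if "x \<ge> -\<delta>" for x
    unfolding line_def by (rule continuous_on_compose2[OF cont]) (use that in \<open>auto intro!: continuous_intros\<close>)
  have sq: "sqint (line E x)" if "x \<ge> -\<delta>" for x
  proof -
    have "nrm2 (line E x) \<le> ennreal (C\<^sup>2 * kernel_mass)"
      by (rule nrm2_decay_le, unfold line_def, rule cmod_le_decay[OF decay C]) (use that in simp)
    then have "nrm2 (line E x) < \<infinity>" by (rule order_le_less_trans) simp
    then show ?thesis using contl[OF that] by (simp add: sqint_def borel_measurable_continuous_onI)
  qed
  have X': "- X n \<ge> -\<delta>" "X n \<ge> -\<delta>" for n using X(1)[of n] X(2)[of n] by linarith+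
  have sqn: "sqint (line E (- X n))" for n by (rule sq[OF X'(1)])
  have VX: "line V (X n) = line E (X n)" for n using VE X(1)[of n] by (auto simp: line_def)
  show "(\<lambda>n. \<integral>\<omega>. cnj (line f (X n) \<omega>) * line E (- X n) \<omega> \<partial>lborel) \<longlonglongrightarrow> (\<integral>\<omega>. cnj (bf \<omega>) * bV \<omega> \<partial>lborel)"
  proof (rule integral_mult_tendsto)
    show "sqint (\<lambda>\<omega>. cnj (bf \<omega>))" "sqint bV"
      using l2_boundary_sqint f V by (auto intro: sqint_cnj)
    show "\<forall>\<^sub>F n in sequentially. sqint (\<lambda>\<omega>. cnj (line f (X n) \<omega>))"
      "\<forall>\<^sub>F n in sequentially. sqint (line E (- X n))"
      using f X sqn by (auto intro!: always_eventually sqint_cnj hardy2_sqint)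
    have "nrm2 (\<lambda>\<omega>. cnj (line f \<xi> \<omega>) - cnj (bf \<omega>)) = nrm2 (\<lambda>\<omega>. line f \<xi> \<omega> - bf \<omega>)" for \<xi>
      using nrm2_cnj[of "\<lambda>\<omega>. line f \<xi> \<omega> - bf \<omega>"] by simp
    then show "(\<lambda>n. nrm2 (\<lambda>\<omega>. cnj (line f (X n) \<omega>) - cnj (bf \<omega>))) \<longlonglongrightarrow> 0"
      using f(2) filterlim_compose[OF _ F] by (auto simp: l2_boundary_def)
    have bm: "bV \<in> borel_measurable lborel" using V(2) by (simp add: l2_boundary_def)
    have lim1: "(\<lambda>n. nrm2 (\<lambda>\<omega>. line E (X n) \<omega> - bV \<omega>)) \<longlonglongrightarrow> 0"
      using V(2) filterlim_compose[OF _ F, of "\<lambda>\<xi>. nrm2 (\<lambda>\<omega>. line V \<xi> \<omega> - bV \<omega>)"] by (auto simp: l2_boundary_def VX)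
    have lim2: "(\<lambda>n. nrm2 (\<lambda>\<omega>. line E (- X n) \<omega> - line E (X n) \<omega>)) \<longlonglongrightarrow> 0"
      by (rule reflected_line_tendsto[OF cont C decay X])
    show "(\<lambda>n. nrm2 (\<lambda>\<omega>. line E (- X n) \<omega> - bV \<omega>)) \<longlonglongrightarrow> 0"
    proof (rule tendsto_sandwich[OF _ _ tendsto_const])
      show "\<forall>\<^sub>F n in sequentially. nrm2 (\<lambda>\<omega>. line E (- X n) \<omega> - bV \<omega>)
         \<le> 2 * nrm2 (\<lambda>\<omega>. line E (- X n) \<omega> - line E (X n) \<omega>) + 2 * nrm2 (\<lambda>\<omega>. line E (X n) \<omega> - bV \<omega>)"
      proof (intro always_eventually allI)
        fix n
        have "nrm2 (\<lambda>\<omega>. (line E (- X n) \<omega> - line E (X n) \<omega>) + (line E (X n) \<omega> - bV \<omega>))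
          \<le> 2 * nrm2 (\<lambda>\<omega>. line E (- X n) \<omega> - line E (X n) \<omega>) + 2 * nrm2 (\<lambda>\<omega>. line E (X n) \<omega> - bV \<omega>)"
          using sqint_meas[OF sq[OF X'(1)]] sqint_meas[OF sq[OF X'(2)]] bm
          by (intro nrm2_add_le borel_measurable_diff)
        then show "nrm2 (\<lambda>\<omega>. line E (- X n) \<omega> - bV \<omega>)
         \<le> 2 * nrm2 (\<lambda>\<omega>. line E (- X n) \<omega> - line E (X n) \<omega>) + 2 * nrm2 (\<lambda>\<omega>. line E (X n) \<omega> - bV \<omega>)"
          by simp
      qed
      have "(\<lambda>n. 2 * nrm2 (\<lambda>\<omega>. line E (- X n) \<omega> - line E (X n) \<omega>) + 2 * nrm2 (\<lambda>\<omega>. line E (X n) \<omega> - bV \<omega>)) \<longlonglongrightarrow> 2 * 0 + 2 * 0"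
        by (intro tendsto_add ennreal_tendsto_cmult lim1 lim2) auto
      then show "(\<lambda>n. 2 * nrm2 (\<lambda>\<omega>. line E (- X n) \<omega> - line E (X n) \<omega>) + 2 * nrm2 (\<lambda>\<omega>. line E (X n) \<omega> - bV \<omega>)) \<longlonglongrightarrow> 0"
        by simp
    qed simp
  qed
qed

section \<open>The matrix-valued Hardy space\<close>

lemma mult_mat_index:
  assumes "A \<in> carrier_mat a b" "B \<in> carrier_mat b c" "i < a" "j < c"
  shows "(A * B) $$ (i, j) = (\<Sum>k<b. A $$ (i, k) * B $$ (k, j))"
  using assms by (auto simp: scalar_prod_def atLeast0LessThan)

lemma zero_lt_one_nat: "(0::nat) < 1"
  by simp

lemma mat_adjoint_carrier: "A \<in> carrier_mat a b \<Longrightarrow> mat_adjoint A \<in> carrier_mat b a"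
  by (auto simp: mat_adjoint_def)

lemma mat_adjoint_index:
  assumes "A \<in> carrier_mat a b" "i < b" "j < a"
  shows "mat_adjoint A $$ (i, j) = cnj (A $$ (j, i))"
  using assms by (auto simp: mat_adjoint_def mat_of_rows_index)

lemma frob_norm_sq:
  assumes "A \<in> carrier_mat p m"
  shows "(frob_norm A)\<^sup>2 = (\<Sum>i<p. \<Sum>j<m. (cmod (A $$ (i, j)))\<^sup>2)"
  using assms unfolding frob_norm_def by (simp add: sum_nonneg)

lemma nn_integral_frob:
  assumes "\<And>\<omega>. A \<omega> \<in> carrier_mat p m"
    and "\<And>i j. i < p \<Longrightarrow> j < m \<Longrightarrow> (\<lambda>\<omega>. A \<omega> $$ (i, j)) \<in> borel_measurable lborel"
  shows "(\<integral>\<^sup>+\<omega>. ennreal ((frob_norm (A \<omega>))\<^sup>2) \<partial>lborel) = (\<Sum>i<p. \<Sum>j<m. nrm2 (\<lambda>\<omega>. A \<omega> $$ (i, j)))"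
proof -
  have "(\<integral>\<^sup>+\<omega>. ennreal ((frob_norm (A \<omega>))\<^sup>2) \<partial>lborel)
      = (\<integral>\<^sup>+\<omega>. (\<Sum>i<p. \<Sum>j<m. ennreal ((cmod (A \<omega> $$ (i, j)))\<^sup>2)) \<partial>lborel)"
    by (intro nn_integral_cong) (simp add: frob_norm_sq[OF assms(1)] sum_ennreal sum_nonneg)
  also have "\<dots> = (\<Sum>i<p. \<integral>\<^sup>+\<omega>. (\<Sum>j<m. ennreal ((cmod (A \<omega> $$ (i, j)))\<^sup>2)) \<partial>lborel)"
  proof (rule nn_integral_sum)
    fix i assume "i \<in> {..<p}"
    show "(\<lambda>\<omega>. \<Sum>j<m. ennreal ((cmod (A \<omega> $$ (i, j)))\<^sup>2)) \<in> borel_measurable lborel"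
    proof (rule borel_measurable_sum)
      fix j assume "j \<in> {..<m}"
      then have [measurable]: "(\<lambda>\<omega>. A \<omega> $$ (i, j)) \<in> borel_measurable lborel"
        using assms(2) \<open>i \<in> {..<p}\<close> by auto
      show "(\<lambda>\<omega>. ennreal ((cmod (A \<omega> $$ (i, j)))\<^sup>2)) \<in> borel_measurable lborel" by measurable
    qed
  qed
  also have "\<dots> = (\<Sum>i<p. \<Sum>j<m. nrm2 (\<lambda>\<omega>. A \<omega> $$ (i, j)))"
  proof (intro sum.cong refl)
    fix i assume "i \<in> {..<p}"
    show "(\<integral>\<^sup>+\<omega>. (\<Sum>j<m. ennreal ((cmod (A \<omega> $$ (i, j)))\<^sup>2)) \<partial>lborel) = (\<Sum>j<m. nrm2 (\<lambda>\<omega>. A \<omega> $$ (i, j)))"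
      unfolding nrm2_def
    proof (rule nn_integral_sum)
      fix j assume "j \<in> {..<m}"
      then have [measurable]: "(\<lambda>\<omega>. A \<omega> $$ (i, j)) \<in> borel_measurable lborel"
        using assms(2) \<open>i \<in> {..<p}\<close> by auto
      show "(\<lambda>\<omega>. ennreal ((cmod (A \<omega> $$ (i, j)))\<^sup>2)) \<in> borel_measurable lborel" by measurable
    qed
  qed
  finally show ?thesis .
qed

lemma entry_le_frob:
  assumes "A \<in> carrier_mat p m" "i < p" "j < m"
  shows "(cmod (A $$ (i, j)))\<^sup>2 \<le> (frob_norm A)\<^sup>2"
proof -
  have "(cmod (A $$ (i, j)))\<^sup>2 \<le> (\<Sum>j<m. (cmod (A $$ (i, j)))\<^sup>2)"
    using assms by (intro member_le_sum) auto
  also have "\<dots> \<le> (\<Sum>i<p. \<Sum>j<m. (cmod (A $$ (i, j)))\<^sup>2)"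
    using assms by (intro member_le_sum[of i "{..<p}" "\<lambda>i. \<Sum>j<m. (cmod (A $$ (i, j)))\<^sup>2"]) (auto intro: sum_nonneg)
  finally show ?thesis by (simp add: frob_norm_sq[OF assms(1)])
qed

text \<open>Each entry is dominated by the Frobenius norm, and the squared Frobenius norm is a
  finite sum over entries. From here on the analysis is scalar.\<close>

lemma H2_iff_hardy2:
  "F \<in> H2 p m \<longleftrightarrow> (\<forall>s. Re s > 0 \<longrightarrow> F s \<in> carrier_mat p m) \<and> (\<forall>i<p. \<forall>j<m. hardy2 (\<lambda>s. F s $$ (i, j)))"
  (is "_ \<longleftrightarrow> ?car \<and> ?har")
proof
  define S where "S = (SUP \<xi>\<in>{0<..}. \<integral>\<^sup>+\<omega>. ennreal ((frob_norm (F (Complex \<xi> \<omega>)))\<^sup>2) \<partial>lborel)"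
  assume F: "F \<in> H2 p m"
  then have car: ?car and holo: "\<forall>i<p. \<forall>j<m. (\<lambda>s. F s $$ (i, j)) holomorphic_on {s. Re s > 0}" and S: "S < \<infinity>"
    unfolding H2_def S_def by auto
  have "nrm2 (line (\<lambda>s. F s $$ (i, j)) \<xi>) \<le> ennreal (enn2real S)" if ij: "i < p" "j < m" "\<xi> > 0" for i j \<xi>
  proof -
    have "nrm2 (line (\<lambda>s. F s $$ (i, j)) \<xi>) \<le> (\<integral>\<^sup>+\<omega>. ennreal ((frob_norm (F (Complex \<xi> \<omega>)))\<^sup>2) \<partial>lborel)"
      unfolding nrm2_def line_def
      using car ij by (intro nn_integral_mono ennreal_leI entry_le_frob[where p=p and m=m]) auto
    also have "\<dots> \<le> S" unfolding S_def using ij by (intro SUP_upper) auto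
    also have "\<dots> = ennreal (enn2real S)" using S by simp
    finally show ?thesis .
  qed
  then show "?car \<and> ?har" using car holo unfolding hardy2_def by blast
next
  assume asm: "?car \<and> ?har"
  define M where "M i j = (SOME M. \<forall>\<xi>>0. nrm2 (line (\<lambda>s. F s $$ (i, j)) \<xi>) \<le> ennreal M)" for i j
  have M: "nrm2 (line (\<lambda>s. F s $$ (i, j)) \<xi>) \<le> ennreal (M i j)" if "i < p" "j < m" "\<xi> > 0" for i j \<xi>
  proof -
    have "\<exists>M. \<forall>\<xi>>0. nrm2 (line (\<lambda>s. F s $$ (i, j)) \<xi>) \<le> ennreal M" using asm that by (auto simp: hardy2_def)
    from someI_ex[OF this] show ?thesis using that by (simp add: M_def)
  qed
  have "(SUP \<xi>\<in>{0<..}. \<integral>\<^sup>+\<omega>. ennreal ((frob_norm (F (Complex \<xi> \<omega>)))\<^sup>2) \<partial>lborel) \<le> (\<Sum>i<p. \<Sum>j<m. ennreal (M i j))"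
  proof (rule SUP_least)
    fix \<xi> :: real assume "\<xi> \<in> {0<..}"
    then have \<xi>: "\<xi> > 0" by simp
    have "(\<integral>\<^sup>+\<omega>. ennreal ((frob_norm (F (Complex \<xi> \<omega>)))\<^sup>2) \<partial>lborel) = (\<Sum>i<p. \<Sum>j<m. nrm2 (\<lambda>\<omega>. F (Complex \<xi> \<omega>) $$ (i, j)))"
    proof (rule nn_integral_frob)
      show "F (Complex \<xi> \<omega>) \<in> carrier_mat p m" for \<omega> using asm \<xi> by simp
      show "(\<lambda>\<omega>. F (Complex \<xi> \<omega>) $$ (i, j)) \<in> borel_measurable lborel" if "i < p" "j < m" for i j
        using hardy2_measurable[OF _ \<xi>, of "\<lambda>s. F s $$ (i, j)"] asm that by (simp add: line_def[abs_def])
    qed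
    also have "\<dots> \<le> (\<Sum>i<p. \<Sum>j<m. ennreal (M i j))"
      using M[OF _ _ \<xi>] by (intro sum_mono) (simp add: line_def[abs_def])
    finally show "(\<integral>\<^sup>+\<omega>. ennreal ((frob_norm (F (Complex \<xi> \<omega>)))\<^sup>2) \<partial>lborel) \<le> (\<Sum>i<p. \<Sum>j<m. ennreal (M i j))" .
  qed
  also have "\<dots> < \<infinity>" by (simp add: less_top[symmetric])
  finally show "F \<in> H2 p m" using asm unfolding H2_def by (auto simp: hardy2_holomorphic)
qed

lemma H2_carrier: "F \<in> H2 p m \<Longrightarrow> Re s > 0 \<Longrightarrow> F s \<in> carrier_mat p m"
  by (simp add: H2_iff_hardy2)

lemma H2_hardy2: "F \<in> H2 p m \<Longrightarrow> i < p \<Longrightarrow> j < m \<Longrightarrow> hardy2 (\<lambda>s. F s $$ (i, j))"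
  by (simp add: H2_iff_hardy2)

lemma H2_diff:
  assumes F: "F \<in> H2 p m" and G: "G \<in> H2 p m"
  shows "(\<lambda>s. F s - G s) \<in> H2 p m"
proof -
  have "hardy2 (\<lambda>s. (F s - G s) $$ (i, j))" if ij: "i < p" "j < m" for i j
  proof (rule hardy2_cong[THEN iffD1, OF _ hardy2_diff[OF H2_hardy2[OF F ij] H2_hardy2[OF G ij]]])
    fix s :: complex assume "Re s > 0"
    then show "F s $$ (i, j) - G s $$ (i, j) = (F s - G s) $$ (i, j)"
      using carrier_matD[OF H2_carrier[OF G]] ij by simp
  qed
  then show ?thesis using minus_carrier_mat[OF H2_carrier[OF G]] by (auto simp: H2_iff_hardy2)
qed

lemma H2_smult:
  assumes F: "F \<in> H2 p m"
  shows "(\<lambda>s. c \<cdot>\<^sub>m F s) \<in> H2 p m"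
proof -
  have "hardy2 (\<lambda>s. (c \<cdot>\<^sub>m F s) $$ (i, j))" if ij: "i < p" "j < m" for i j
  proof (rule hardy2_cong[THEN iffD1, OF _ hardy2_cmult[OF H2_hardy2[OF F ij], of c]])
    fix s :: complex assume "Re s > 0"
    then show "c * F s $$ (i, j) = (c \<cdot>\<^sub>m F s) $$ (i, j)"
      using carrier_matD[OF H2_carrier[OF F]] ij by simp
  qed
  then show ?thesis using H2_carrier[OF F] by (auto simp: H2_iff_hardy2)
qed

text \<open>\<open>boundary_function\<close> is a choice, so existence has to be secured: the scalar
  boundary functions of the entries are assembled into a matrix. Whatever function is chosen, its
  entries are then boundary functions of the entries, by domination.\<close>

lemma boundary_function_l2_boundary:
  assumes F: "F \<in> H2 p m"
  shows "boundary_function p m F \<omega> \<in> carrier_mat p m"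
    and "i < p \<Longrightarrow> j < m \<Longrightarrow> l2_boundary (\<lambda>s. F s $$ (i, j)) (\<lambda>\<omega>. boundary_function p m F \<omega> $$ (i, j))"
proof -
  have frob: "(\<integral>\<^sup>+\<omega>. ennreal ((frob_norm (F (Complex \<xi> \<omega>) - f \<omega>))\<^sup>2) \<partial>lborel)
      = (\<Sum>i<p. \<Sum>j<m. nrm2 (\<lambda>\<omega>. line (\<lambda>s. F s $$ (i, j)) \<xi> \<omega> - f \<omega> $$ (i, j)))"
    if f: "\<And>\<omega>. f \<omega> \<in> carrier_mat p m" "\<And>i j. i < p \<Longrightarrow> j < m \<Longrightarrow> (\<lambda>\<omega>. f \<omega> $$ (i, j)) \<in> borel_measurable lborel"
      and \<xi>: "\<xi> > 0" for f \<xi>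
  proof -
    have idx: "(F (Complex \<xi> \<omega>) - f \<omega>) $$ (i, j) = line (\<lambda>s. F s $$ (i, j)) \<xi> \<omega> - f \<omega> $$ (i, j)"
      if "i < p" "j < m" for i j \<omega> using f(1)[of \<omega>] that by (auto simp: line_def)
    have "(\<integral>\<^sup>+\<omega>. ennreal ((frob_norm (F (Complex \<xi> \<omega>) - f \<omega>))\<^sup>2) \<partial>lborel)
      = (\<Sum>i<p. \<Sum>j<m. nrm2 (\<lambda>\<omega>. (F (Complex \<xi> \<omega>) - f \<omega>) $$ (i, j)))"
    proof (rule nn_integral_frob)
      show "F (Complex \<xi> \<omega>) - f \<omega> \<in> carrier_mat p m" for \<omega> using f(1)[of \<omega>] by auto
      fix i j assume ij: "i < p" "j < m"
      show "(\<lambda>\<omega>. (F (Complex \<xi> \<omega>) - f \<omega>) $$ (i, j)) \<in> borel_measurable lborel"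
        unfolding idx[OF ij] by (intro borel_measurable_diff hardy2_measurable H2_hardy2[OF F] f \<xi> ij)
    qed
    also have "\<dots> = (\<Sum>i<p. \<Sum>j<m. nrm2 (\<lambda>\<omega>. line (\<lambda>s. F s $$ (i, j)) \<xi> \<omega> - f \<omega> $$ (i, j)))"
      by (intro sum.cong refl) (simp add: idx)
    finally show ?thesis .
  qed
  have "\<exists>f. is_boundary_function p m F f"
  proof -
    define B where "B i j = (SOME g. l2_boundary (\<lambda>s. F s $$ (i, j)) g)" for i j
    have B: "l2_boundary (\<lambda>s. F s $$ (i, j)) (B i j)" if "i < p" "j < m" for i j
    proof -
      have "\<exists>g. l2_boundary (\<lambda>s. F s $$ (i, j)) g" using l2_boundary_exists[OF H2_hardy2[OF F that]] by blast
      from someI_ex[OF this] show ?thesis by (simp add: B_def)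
    qed
    define f where "f \<omega> = Matrix.mat p m (\<lambda>(i, j). B i j \<omega>)" for \<omega>
    have fc: "f \<omega> \<in> carrier_mat p m" for \<omega> by (simp add: f_def)
    have fi: "(\<lambda>\<omega>. f \<omega> $$ (i, j)) = B i j" if "i < p" "j < m" for i j using that by (auto simp: f_def)
    have fm: "(\<lambda>\<omega>. f \<omega> $$ (i, j)) \<in> borel_measurable lborel" if "i < p" "j < m" for i j
      unfolding fi[OF that] using B[OF that] by (simp add: l2_boundary_def)
    have "((\<lambda>\<xi>. \<Sum>i<p. \<Sum>j<m. nrm2 (\<lambda>\<omega>. line (\<lambda>s. F s $$ (i, j)) \<xi> \<omega> - f \<omega> $$ (i, j))) \<longlongrightarrow> (\<Sum>i<p. \<Sum>j<m. 0)) (at_right 0)"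
    proof (intro tendsto_sum)
      fix i j assume "i \<in> {..<p}" "j \<in> {..<m}"
      then have ij: "i < p" "j < m" by auto
      have eq: "f \<omega> $$ (i, j) = B i j \<omega>" for \<omega> using ij by (simp add: f_def)
      show "((\<lambda>\<xi>. nrm2 (\<lambda>\<omega>. line (\<lambda>s. F s $$ (i, j)) \<xi> \<omega> - f \<omega> $$ (i, j))) \<longlongrightarrow> 0) (at_right 0)"
        using B[OF ij] unfolding eq l2_boundary_def by blast
    qed
    then have "((\<lambda>\<xi>. \<Sum>i<p. \<Sum>j<m. nrm2 (\<lambda>\<omega>. line (\<lambda>s. F s $$ (i, j)) \<xi> \<omega> - f \<omega> $$ (i, j))) \<longlongrightarrow> 0) (at_right 0)"
      by simp
    then have "((\<lambda>\<xi>. \<integral>\<^sup>+\<omega>. ennreal ((frob_norm (F (Complex \<xi> \<omega>) - f \<omega>))\<^sup>2) \<partial>lborel) \<longlongrightarrow> 0) (at_right 0)"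
    proof (rule Lim_transform_eventually)
      show "\<forall>\<^sub>F \<xi> in at_right 0. (\<Sum>i<p. \<Sum>j<m. nrm2 (\<lambda>\<omega>. line (\<lambda>s. F s $$ (i, j)) \<xi> \<omega> - f \<omega> $$ (i, j)))
         = (\<integral>\<^sup>+\<omega>. ennreal ((frob_norm (F (Complex \<xi> \<omega>) - f \<omega>))\<^sup>2) \<partial>lborel)"
        using eventually_at_right_less[of 0] by eventually_elim (rule frob[symmetric, OF fc fm])
    qed
    then have "is_boundary_function p m F f"
      unfolding is_boundary_function_def using fc fm by blast
    then show ?thesis by blast
  qed
  then have b: "is_boundary_function p m F (boundary_function p m F)"
    unfolding boundary_function_def by (rule someI_ex)
  show c: "boundary_function p m F \<omega> \<in> carrier_mat p m" for \<omega>
    using b by (simp add: is_boundary_function_def)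
  have m: "(\<lambda>\<omega>. boundary_function p m F \<omega> $$ (i, j)) \<in> borel_measurable lborel" if "i < p" "j < m" for i j
    using b that unfolding is_boundary_function_def by blast
  assume ij: "i < p" "j < m"
  have lim: "((\<lambda>\<xi>. \<integral>\<^sup>+\<omega>. ennreal ((frob_norm (F (Complex \<xi> \<omega>) - boundary_function p m F \<omega>))\<^sup>2) \<partial>lborel) \<longlongrightarrow> 0) (at_right 0)"
    using b unfolding is_boundary_function_def by blast
  have "((\<lambda>\<xi>. nrm2 (\<lambda>\<omega>. line (\<lambda>s. F s $$ (i, j)) \<xi> \<omega> - boundary_function p m F \<omega> $$ (i, j))) \<longlongrightarrow> 0) (at_right 0)"
  proof (rule tendsto_sandwich[OF _ _ tendsto_const lim])
    show "\<forall>\<^sub>F \<xi> in at_right 0. nrm2 (\<lambda>\<omega>. line (\<lambda>s. F s $$ (i, j)) \<xi> \<omega> - boundary_function p m F \<omega> $$ (i, j))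
      \<le> (\<integral>\<^sup>+\<omega>. ennreal ((frob_norm (F (Complex \<xi> \<omega>) - boundary_function p m F \<omega>))\<^sup>2) \<partial>lborel)"
      using eventually_at_right_less[of 0]
    proof eventually_elim
      case (elim \<xi>)
      define N where "N i j = nrm2 (\<lambda>\<omega>. line (\<lambda>s. F s $$ (i, j)) \<xi> \<omega> - boundary_function p m F \<omega> $$ (i, j))" for i j
      have "N i j \<le> (\<Sum>j<m. N i j)" using ij by (intro member_le_sum) auto
      also have "\<dots> \<le> (\<Sum>i<p. \<Sum>j<m. N i j)"
        using ij by (intro member_le_sum[of i "{..<p}" "\<lambda>i. \<Sum>j<m. N i j"]) auto
      finally have le: "N i j \<le> (\<Sum>i<p. \<Sum>j<m. N i j)" .
      have "(\<integral>\<^sup>+\<omega>. ennreal ((frob_norm (F (Complex \<xi> \<omega>) - boundary_function p m F \<omega>))\<^sup>2) \<partial>lborel) = (\<Sum>i<p. \<Sum>j<m. N i j)"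
        unfolding N_def by (rule frob[OF c m elim])
      with le show ?case unfolding N_def by simp
    qed
  qed simp
  then show "l2_boundary (\<lambda>s. F s $$ (i, j)) (\<lambda>\<omega>. boundary_function p m F \<omega> $$ (i, j))"
    unfolding l2_boundary_def using m[OF ij] by blast
qed

lemma h2_inner_eq:
  assumes F: "F \<in> H2 p m" and G: "G \<in> H2 p m"
  shows "h2_inner p m F G = 1 / (2 * of_real pi) *
    (\<Sum>j<m. \<Sum>i<p. \<integral>\<omega>. cnj (boundary_function p m F \<omega> $$ (i, j)) * boundary_function p m G \<omega> $$ (i, j) \<partial>lborel)"
proof -
  let ?f = "boundary_function p m F" and ?g = "boundary_function p m G"
  have int: "integrable lborel (\<lambda>\<omega>. cnj (?f \<omega> $$ (i, j)) * ?g \<omega> $$ (i, j))" if "i < p" "j < m" for i j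
    by (intro sqint_mult_integrable sqint_cnj l2_boundary_sqint[OF H2_hardy2[OF F that] boundary_function_l2_boundary(2)[OF F that]]
       l2_boundary_sqint[OF H2_hardy2[OF G that] boundary_function_l2_boundary(2)[OF G that]])
  have "mat_trace (mat_adjoint (?f \<omega>) * ?g \<omega>) = (\<Sum>j<m. \<Sum>i<p. cnj (?f \<omega> $$ (i, j)) * ?g \<omega> $$ (i, j))" for \<omega>
  proof -
    note c = boundary_function_l2_boundary(1)[OF F, of \<omega>] boundary_function_l2_boundary(1)[OF G, of \<omega>]
    note a = mat_adjoint_carrier[OF c(1)]
    have "dim_row (mat_adjoint (?f \<omega>) * ?g \<omega>) = m" using a by auto
    then show ?thesis unfolding mat_trace_def
      by (intro sum.cong refl) (auto simp: mult_mat_index[OF a c(2)] mat_adjoint_index[OF c(1)])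
  qed
  then have "h2_inner p m F G = 1 / (2 * of_real pi) *
     (\<integral>\<omega>. (\<Sum>j<m. \<Sum>i<p. cnj (?f \<omega> $$ (i, j)) * ?g \<omega> $$ (i, j)) \<partial>lborel)"
    unfolding h2_inner_def by simp
  also have "(\<integral>\<omega>. (\<Sum>j<m. \<Sum>i<p. cnj (?f \<omega> $$ (i, j)) * ?g \<omega> $$ (i, j)) \<partial>lborel)
     = (\<Sum>j<m. \<integral>\<omega>. (\<Sum>i<p. cnj (?f \<omega> $$ (i, j)) * ?g \<omega> $$ (i, j)) \<partial>lborel)"
    using int by (intro Bochner_Integration.integral_sum Bochner_Integration.integrable_sum) auto
  also have "\<dots> = (\<Sum>j<m. \<Sum>i<p. \<integral>\<omega>. cnj (?f \<omega> $$ (i, j)) * ?g \<omega> $$ (i, j) \<partial>lborel)"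
    using int by (intro sum.cong refl Bochner_Integration.integral_sum) auto
  finally show ?thesis .
qed

text \<open>This makes convergence in the Hardy norm imply convergence at each point. The factor
  \<open>sqrt (2 * pi)\<close> undoes the normalization of \<open>h2_inner\<close>.\<close>

lemma h2_norm_eval_bound:
  assumes ij: "i < p" "j < m" and s: "Re s > 0"
  obtains K where "K \<ge> 0" "\<And>F. F \<in> H2 p m \<Longrightarrow> cmod (F s $$ (i, j)) \<le> K * h2_norm p m F"
proof -
  obtain K where K: "K \<ge> 0" "\<And>f. hardy2 f \<Longrightarrow> cmod (f s) \<le> K * l2 (line f (Re s / 4))"
    using hardy2_eval_bound[OF s] by blast
  show ?thesis
  proof
    show "K * sqrt (2 * pi) \<ge> 0" using K by simp
    fix F assume F: "F \<in> H2 p m"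
    define b where "b i j \<omega> = boundary_function p m F \<omega> $$ (i, j)" for i j \<omega>
    have b: "l2_boundary (\<lambda>s. F s $$ (i, j)) (b i j)" if "i < p" "j < m" for i j
      using boundary_function_l2_boundary(2)[OF F that] unfolding b_def[abs_def] .
    have sq: "sqint (b i j)" if "i < p" "j < m" for i j
      by (rule l2_boundary_sqint[OF H2_hardy2[OF F that] b[OF that]])
    have "h2_inner p m F F = 1 / (2 * of_real pi) * (\<Sum>j<m. \<Sum>i<p. complex_of_real ((l2 (b i j))\<^sup>2))"
      unfolding h2_inner_eq[OF F F] b_def[symmetric]
      by (intro arg_cong2[where f="(*)"] refl sum.cong integral_cnj_self sq) auto
    also have "\<dots> = complex_of_real (1 / (2 * pi) * (\<Sum>j<m. \<Sum>i<p. (l2 (b i j))\<^sup>2))" by simp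
    finally have n: "h2_norm p m F = sqrt (1 / (2 * pi) * (\<Sum>j<m. \<Sum>i<p. (l2 (b i j))\<^sup>2))"
      unfolding h2_norm_def by (simp only: Re_complex_of_real)
    have "(l2 (b i j))\<^sup>2 \<le> (\<Sum>i<p. (l2 (b i j))\<^sup>2)" using ij by (intro member_le_sum) auto
    also have "\<dots> \<le> (\<Sum>j<m. \<Sum>i<p. (l2 (b i j))\<^sup>2)"
      using ij by (intro member_le_sum[of j "{..<m}" "\<lambda>j. \<Sum>i<p. (l2 (b i j))\<^sup>2"]) (auto intro: sum_nonneg)
    finally have "l2 (b i j) \<le> sqrt (\<Sum>j<m. \<Sum>i<p. (l2 (b i j))\<^sup>2)" by (rule real_le_rsqrt)
    also have "\<dots> = sqrt (2 * pi) * h2_norm p m F" unfolding n by (simp add: real_sqrt_mult[symmetric])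
    finally have "l2 (b i j) \<le> sqrt (2 * pi) * h2_norm p m F" .
    moreover have "l2 (line (\<lambda>s. F s $$ (i, j)) (Re s / 4)) \<le> l2 (b i j)"
      using s by (intro hardy2_l2_le_boundary[OF H2_hardy2[OF F ij] b[OF ij]]) simp
    ultimately have "K * l2 (line (\<lambda>s. F s $$ (i, j)) (Re s / 4)) \<le> K * (sqrt (2 * pi) * h2_norm p m F)"
      using K(1) by (intro mult_left_mono) auto
    then show "cmod (F s $$ (i, j)) \<le> K * sqrt (2 * pi) * h2_norm p m F"
      using K(2)[OF H2_hardy2[OF F ij]] by (simp add: mult.assoc)
  qed
qed

section \<open>Inverses depending on a parameter\<close>

text \<open>Cramer's rule as a total function: the entries are explicit rational expressions in the
  entries of \<open>A\<close>, so limits and holomorphy pass through. For a singular matrix division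
  by 0 gives the zero matrix, of the same size.\<close>

definition minv :: "complex mat \<Rightarrow> complex mat" where
  "minv A = (1 / Determinant.det A) \<cdot>\<^sub>m adj_mat A"

lemma minv:
  assumes A: "A \<in> carrier_mat n n" and d: "Determinant.det A \<noteq> 0"
  shows "minv A \<in> carrier_mat n n" "A * minv A = 1\<^sub>m n" "minv A * A = 1\<^sub>m n"
proof -
  note a = adj_mat[OF A]
  show "minv A \<in> carrier_mat n n" using a(1) by (simp add: minv_def)
  have "A * minv A = (1 / Determinant.det A) \<cdot>\<^sub>m (Determinant.det A \<cdot>\<^sub>m 1\<^sub>m n)"
    unfolding minv_def mult_smult_distrib[OF A a(1)] a(2) ..
  also have "\<dots> = 1\<^sub>m n" using d by (intro eq_matI) auto
  finally show "A * minv A = 1\<^sub>m n" .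
  have "minv A * A = (1 / Determinant.det A) \<cdot>\<^sub>m (Determinant.det A \<cdot>\<^sub>m 1\<^sub>m n)"
    unfolding minv_def mult_smult_assoc_mat[OF a(1) A] a(3) ..
  also have "\<dots> = 1\<^sub>m n" using d by (intro eq_matI) auto
  finally show "minv A * A = 1\<^sub>m n" .
qed

lemma minv_carrier: "A \<in> carrier_mat n n \<Longrightarrow> minv A \<in> carrier_mat n n"
  unfolding minv_def by (intro smult_carrier_mat adj_mat(1))

lemma minv_unique:
  assumes A: "A \<in> carrier_mat n n" and B: "B \<in> carrier_mat n n" and AB: "A * B = 1\<^sub>m n"
  shows "minv A = B" "Determinant.det A \<noteq> 0"
proof -
  have "Determinant.det A * Determinant.det B = 1"
    using Determinant.det_mult[OF A B] AB by simp
  then show d: "Determinant.det A \<noteq> 0" by auto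
  have "minv A = minv A * (A * B)" using minv_carrier[OF A] by (simp add: AB)
  also have "\<dots> = (minv A * A) * B" using minv_carrier[OF A] A B by simp
  also have "\<dots> = B" using B by (simp add: minv(3)[OF A d])
  finally show "minv A = B" .
qed

text \<open>Entrywise convergence. The sizes are required at every \<open>x\<close>, not only
  eventually, so that the index formulas for products and determinants can be rewritten under the
  limit.\<close>

definition mat_lim :: "nat \<Rightarrow> nat \<Rightarrow> ('b \<Rightarrow> complex mat) \<Rightarrow> complex mat \<Rightarrow> 'b filter \<Rightarrow> bool" where
  "mat_lim a b M L F \<longleftrightarrow> L \<in> carrier_mat a b \<and> (\<forall>x. M x \<in> carrier_mat a b) \<and>
     (\<forall>i<a. \<forall>j<b. ((\<lambda>x. M x $$ (i, j)) \<longlongrightarrow> L $$ (i, j)) F)"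

lemma mat_lim_const: "L \<in> carrier_mat a b \<Longrightarrow> mat_lim a b (\<lambda>x. L) L F"
  by (simp add: mat_lim_def)

lemma mat_lim_mult:
  assumes M: "mat_lim a b M L F" and N: "mat_lim b c N K F"
  shows "mat_lim a c (\<lambda>x. M x * N x) (L * K) F"
proof -
  have c: "L \<in> carrier_mat a b" "\<And>x. M x \<in> carrier_mat a b" "K \<in> carrier_mat b c" "\<And>x. N x \<in> carrier_mat b c"
    using M N by (auto simp: mat_lim_def)
  have "((\<lambda>x. (M x * N x) $$ (i, j)) \<longlongrightarrow> (L * K) $$ (i, j)) F" if ij: "i < a" "j < c" for i j
    unfolding mult_mat_index[OF c(2) c(4) ij] mult_mat_index[OF c(1) c(3) ij]
    using M N ij by (intro tendsto_sum tendsto_mult) (auto simp: mat_lim_def)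
  then show ?thesis
    unfolding mat_lim_def using mult_carrier_mat[OF c(1) c(3)] mult_carrier_mat[OF c(2) c(4)] by blast
qed

lemma mat_lim_diff:
  assumes M: "mat_lim a b M L F" and N: "mat_lim a b N K F"
  shows "mat_lim a b (\<lambda>x. M x - N x) (L - K) F"
proof -
  have c: "L \<in> carrier_mat a b" "\<And>x. M x \<in> carrier_mat a b" "K \<in> carrier_mat a b" "\<And>x. N x \<in> carrier_mat a b"
    using M N by (auto simp: mat_lim_def)
  have "((\<lambda>x. (M x - N x) $$ (i, j)) \<longlongrightarrow> (L - K) $$ (i, j)) F" if ij: "i < a" "j < b" for i j
  proof -
    have "(\<lambda>x. (M x - N x) $$ (i, j)) = (\<lambda>x. M x $$ (i, j) - N x $$ (i, j))"
      using c(4) ij by (intro ext) (simp add: carrier_matD[OF c(4)])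
    moreover have "(L - K) $$ (i, j) = L $$ (i, j) - K $$ (i, j)" using c(3) ij by simp
    ultimately show ?thesis using M N ij by (auto simp: mat_lim_def intro!: tendsto_diff)
  qed
  then show ?thesis
    unfolding mat_lim_def using minus_carrier_mat[OF c(3)] minus_carrier_mat[OF c(4)] by blast
qed

lemma mat_lim_det:
  assumes M: "mat_lim n n M L F"
  shows "((\<lambda>x. Determinant.det (M x)) \<longlongrightarrow> Determinant.det L) F"
proof -
  have c: "L \<in> carrier_mat n n" "\<And>x. M x \<in> carrier_mat n n"
    using M by (auto simp: mat_lim_def)
  show ?thesis unfolding det_def'[OF c(1)] det_def'[OF c(2)]
  proof (intro tendsto_sum tendsto_mult tendsto_const tendsto_prod)
    fix \<pi> i assume "\<pi> \<in> {\<pi>. \<pi> permutes {0..<n}}" "i \<in> {0..<n}"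
    then have "\<pi> i < n" "i < n" using permutes_in_image[of \<pi> "{0..<n}" i] by auto
    then show "((\<lambda>x. M x $$ (i, \<pi> i)) \<longlongrightarrow> L $$ (i, \<pi> i)) F" using M by (auto simp: mat_lim_def)
  qed
qed

lemma mat_delete_index':
  assumes "A \<in> carrier_mat n n" "i' < n - 1" "j' < n - 1"
  shows "mat_delete A i j $$ (i', j') = A $$ (if i' < i then i' else Suc i', if j' < j then j' else Suc j')"
  using assms by (auto simp: mat_delete_def)

lemma mat_lim_minv:
  assumes M: "mat_lim n n M L F" and d: "Determinant.det L \<noteq> 0"
  shows "mat_lim n n (\<lambda>x. minv (M x)) (minv L) F"
proof -
  have c: "L \<in> carrier_mat n n" "\<And>x. M x \<in> carrier_mat n n"
    using M by (auto simp: mat_lim_def)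
  have adj: "adj_mat A $$ (i, j) = (-1)^(j + i) * Determinant.det (mat_delete A j i)"
    if "A \<in> carrier_mat n n" "i < n" "j < n" for A :: "complex mat" and i j
    using that by (simp add: adj_mat_def cofactor_def)
  have del: "mat_lim (n - 1) (n - 1) (\<lambda>x. mat_delete (M x) j i) (mat_delete L j i) F" for i j
    unfolding mat_lim_def
  proof (intro conjI allI impI)
    fix i' j' assume ij': "i' < n - 1" "j' < n - 1"
    show "((\<lambda>x. mat_delete (M x) j i $$ (i', j')) \<longlongrightarrow> mat_delete L j i $$ (i', j')) F"
      unfolding mat_delete_index'[OF c(1) ij'] mat_delete_index'[OF c(2) ij']
      using M ij' by (auto simp: mat_lim_def)
  qed (rule mat_delete_carrier[OF c(1)], rule mat_delete_carrier[OF c(2)])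
  have idx: "minv A $$ (i, j) = 1 / Determinant.det A * ((-1)^(j + i) * Determinant.det (mat_delete A j i))"
    if "A \<in> carrier_mat n n" "i < n" "j < n" for A i j
    using that adj_mat(1)[OF that(1)] adj[OF that] by (simp add: minv_def)
  have "((\<lambda>x. minv (M x) $$ (i, j)) \<longlongrightarrow> minv L $$ (i, j)) F" if ij: "i < n" "j < n" for i j
    unfolding idx[OF c(1) ij] idx[OF c(2) ij]
    by (intro tendsto_mult tendsto_divide tendsto_const mat_lim_det[OF M] mat_lim_det[OF del] d)
  then show ?thesis using c by (auto simp: mat_lim_def minv_carrier)
qed

lemma holomorphic_on_det:
  assumes c: "\<And>s. M s \<in> carrier_mat n n"
    and h: "\<And>i j. i < n \<Longrightarrow> j < n \<Longrightarrow> (\<lambda>s. M s $$ (i, j)) holomorphic_on S"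
  shows "(\<lambda>s. Determinant.det (M s)) holomorphic_on S"
  unfolding det_def'[OF c]
proof (intro holomorphic_on_sum holomorphic_on_mult holomorphic_on_const holomorphic_on_prod)
  fix \<pi> i assume "\<pi> \<in> {\<pi>. \<pi> permutes {0..<n}}" "i \<in> {0..<n}"
  then have "\<pi> i < n" "i < n" using permutes_in_image[of \<pi> "{0..<n}" i] by auto
  then show "(\<lambda>s. M s $$ (i, \<pi> i)) holomorphic_on S" using h by auto
qed

lemma holomorphic_on_minv:
  assumes c: "\<And>s. M s \<in> carrier_mat n n"
    and h: "\<And>i j. i < n \<Longrightarrow> j < n \<Longrightarrow> (\<lambda>s. M s $$ (i, j)) holomorphic_on S"
    and d: "\<And>s. s \<in> S \<Longrightarrow> Determinant.det (M s) \<noteq> 0" and ij: "i < n" "j < n"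
  shows "(\<lambda>s. minv (M s) $$ (i, j)) holomorphic_on S"
proof -
  have idx: "minv A $$ (i, j) = 1 / Determinant.det A * ((-1)^(j + i) * Determinant.det (mat_delete A j i))"
    if "A \<in> carrier_mat n n" for A
    using that adj_mat(1)[OF that(1)] ij by (simp add: minv_def adj_mat_def cofactor_def)
  have del: "(\<lambda>s. Determinant.det (mat_delete (M s) j i)) holomorphic_on S"
  proof (rule holomorphic_on_det[where n="n - 1"])
    fix i' j' assume ij': "i' < n - 1" "j' < n - 1"
    show "(\<lambda>s. mat_delete (M s) j i $$ (i', j')) holomorphic_on S"
      unfolding mat_delete_index'[OF c ij'] using ij' by (intro h) auto
  qed (rule mat_delete_carrier[OF c])
  show ?thesis unfolding idx[OF c]
    by (intro holomorphic_on_mult holomorphic_on_divide holomorphic_on_const holomorphic_on_det[OF c h] del d)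
qed

section \<open>Resolvents and transfer functions\<close>

definition resolvent :: "complex mat \<Rightarrow> complex \<Rightarrow> complex mat" where
  "resolvent A s = minv (s \<cdot>\<^sub>m 1\<^sub>m (dim_row A) - A)"

lemma shift_carrier: "A \<in> carrier_mat n n \<Longrightarrow> s \<cdot>\<^sub>m 1\<^sub>m n - A \<in> carrier_mat n n"
  by auto

lemma det_shift_eigenvalue:
  fixes A :: "complex mat"
  assumes A: "A \<in> carrier_mat n n"
  shows "Determinant.det (s \<cdot>\<^sub>m 1\<^sub>m n - A) = 0 \<longleftrightarrow> eigenvalue A s"
proof -
  have "s \<cdot>\<^sub>m 1\<^sub>m n - A = - char_matrix A s"
    using A by (intro eq_matI) (auto simp: char_matrix_def)
  then have "Determinant.det (s \<cdot>\<^sub>m 1\<^sub>m n - A) = 0 \<longleftrightarrow> Determinant.det (char_matrix A s) = 0"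
    using det_0_negate[of "char_matrix A s" n] A by simp
  then show ?thesis using eigenvalue_det[OF A] by simp
qed

lemma resolvent:
  assumes A: "A \<in> carrier_mat n n" and s: "\<not> eigenvalue A s"
  shows "resolvent A s \<in> carrier_mat n n"
    "(s \<cdot>\<^sub>m 1\<^sub>m n - A) * resolvent A s = 1\<^sub>m n" "resolvent A s * (s \<cdot>\<^sub>m 1\<^sub>m n - A) = 1\<^sub>m n"
  using minv[OF shift_carrier[OF A], of s] det_shift_eigenvalue[OF A, of s] A s
  by (auto simp: resolvent_def)

lemma resolvent_carrier: "A \<in> carrier_mat n n \<Longrightarrow> resolvent A s \<in> carrier_mat n n"
  unfolding resolvent_def by (auto intro!: minv_carrier)

text \<open>Off the spectrum Gauss-Jordan elimination succeeds, and uniqueness of inverses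
  identifies its result with \<open>minv\<close>.\<close>

lemma transfer_eq_resolvent:
  assumes A: "A \<in> carrier_mat n n" and s: "\<not> eigenvalue A s"
  shows "transfer A B C s = C * resolvent A s * B"
proof -
  let ?X = "s \<cdot>\<^sub>m 1\<^sub>m n - A"
  have X: "?X \<in> carrier_mat n n" and d: "Determinant.det ?X \<noteq> 0"
    using det_shift_eigenvalue[OF A, of s] s A by auto
  have "mat_inverse ?X \<noteq> None"
    using mat_inverse(1)[OF X, where b="()"] det_non_zero_imp_unit[OF X d, where b="()"] by blast
  then obtain Y where Y: "mat_inverse ?X = Some Y" by blast
  with mat_inverse(2)[OF X Y] have "minv ?X = Y" using minv_unique(1)[OF X, of Y] by blast
  then show ?thesis using A Y by (simp add: transfer_def resolvent_def)
qed

text \<open>Both follow from \<open>s - A = (s - z) + (z - A)\<close>; the second, the resolvent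
  identity, is the case \<open>s = w\<close>.\<close>

lemma resolvent_product:
  assumes A: "A \<in> carrier_mat n n" and z: "\<not> eigenvalue A z" and w: "\<not> eigenvalue A w"
  shows "resolvent A z * (s \<cdot>\<^sub>m 1\<^sub>m n - A) * resolvent A w = (s - z) \<cdot>\<^sub>m (resolvent A z * resolvent A w) + resolvent A w"
    and "(w - z) \<cdot>\<^sub>m (resolvent A z * resolvent A w) = resolvent A z - resolvent A w"
proof -
  let ?Z = "resolvent A z" and ?W = "resolvent A w"
  note Z = resolvent[OF A z] and W = resolvent[OF A w]
  have gen: "?Z * (s \<cdot>\<^sub>m 1\<^sub>m n - A) * ?W = (s - z) \<cdot>\<^sub>m (?Z * ?W) + ?W" for s
  proof -
    have "s \<cdot>\<^sub>m 1\<^sub>m n - A = (s - z) \<cdot>\<^sub>m 1\<^sub>m n + (z \<cdot>\<^sub>m 1\<^sub>m n - A)"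
      using A by (intro eq_matI) (auto simp: algebra_simps)
    then have "?Z * (s \<cdot>\<^sub>m 1\<^sub>m n - A) = ?Z * ((s - z) \<cdot>\<^sub>m 1\<^sub>m n) + ?Z * (z \<cdot>\<^sub>m 1\<^sub>m n - A)"
      using mult_add_distrib_mat[OF Z(1) smult_carrier_mat[OF one_carrier_mat] shift_carrier[OF A, of z]] by simp
    also have "\<dots> = (s - z) \<cdot>\<^sub>m ?Z + 1\<^sub>m n"
      unfolding Z(3) using mult_smult_distrib[OF Z(1) one_carrier_mat, of "s - z"] Z(1) by simp
    finally have "?Z * (s \<cdot>\<^sub>m 1\<^sub>m n - A) * ?W = ((s - z) \<cdot>\<^sub>m ?Z) * ?W + 1\<^sub>m n * ?W"
      using add_mult_distrib_mat[of "(s - z) \<cdot>\<^sub>m ?Z" n n "1\<^sub>m n" ?W n] Z(1) W(1) by simp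
    then show ?thesis using mult_smult_assoc_mat[OF Z(1) W(1)] W(1) by simp
  qed
  then show "?Z * (s \<cdot>\<^sub>m 1\<^sub>m n - A) * ?W = (s - z) \<cdot>\<^sub>m (?Z * ?W) + ?W" .
  have "?Z * (w \<cdot>\<^sub>m 1\<^sub>m n - A) * ?W = ?Z * ((w \<cdot>\<^sub>m 1\<^sub>m n - A) * ?W)"
    using Z(1) W(1) A by (intro assoc_mult_mat) auto
  also have "\<dots> = ?Z" unfolding W(2) using Z(1) by simp
  finally have eq: "?Z = (w - z) \<cdot>\<^sub>m (?Z * ?W) + ?W" unfolding gen by simp
  show "(w - z) \<cdot>\<^sub>m (?Z * ?W) = ?Z - ?W"
    by (subst (2) eq) (use Z(1) W(1) in \<open>auto intro!: eq_matI\<close>)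
qed

section \<open>Reconstruction from point values\<close>

text \<open>The tangential data \<open>u\<close>, \<open>v\<close> are the same at all interpolation points; they reduce the
  shifted Loewner matrix to the values of the scalar function \<open>u\<^sup>T G v\<close>.\<close>

locale loewner =
  fixes p m r :: nat and u v :: "nat \<Rightarrow> complex" and mu nu :: "nat \<Rightarrow> complex"
begin

definition U :: "complex mat" where "U = Matrix.mat 1 p (\<lambda>(i, j). u j)"
definition V :: "complex mat" where "V = Matrix.mat m 1 (\<lambda>(i, j). v i)"

definition gval :: "(complex \<Rightarrow> complex mat) \<Rightarrow> complex \<Rightarrow> complex" where
  "gval G z = (\<Sum>j<p. \<Sum>l<m. u j * G z $$ (j, l) * v l)"

text \<open>The Loewner pencil \<open>Ls - s L\<close> of the scalar function \<open>gval G\<close>,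
  with \<open>L\<close> the Loewner and \<open>Ls\<close> the shifted Loewner matrix. Its entry is
  \<open>u^T C R(mu i) (s - A) R(nu j) B v\<close>, with \<open>R\<close> the resolvent, written in
  point values. Separate point sets \<open>mu\<close> and \<open>nu\<close> keep derivatives of
  \<open>G\<close> out of it.\<close>

definition LK :: "complex \<Rightarrow> (complex \<Rightarrow> complex mat) \<Rightarrow> complex mat" where
  "LK s G = Matrix.mat r r (\<lambda>(i, j). (s - mu i) * ((gval G (mu i) - gval G (nu j)) / (nu j - mu i)) + gval G (nu j))"

definition LW :: "(complex \<Rightarrow> complex mat) \<Rightarrow> complex mat" where
  "LW G = Matrix.mat p r (\<lambda>(a, j). \<Sum>l<m. G (nu j) $$ (a, l) * v l)"

definition LY :: "(complex \<Rightarrow> complex mat) \<Rightarrow> complex mat" where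
  "LY G = Matrix.mat r m (\<lambda>(i, l). \<Sum>j<p. u j * G (mu i) $$ (j, l))"

text \<open>\<open>LO\<close> and \<open>LR\<close> are the generalized observability and
  reachability matrices of rational Krylov methods: the rows of \<open>LO\<close> are
  \<open>u^T C R(mu i)\<close> and the columns of \<open>LR\<close> are
  \<open>R(nu j) B v\<close>.\<close>

definition LO :: "complex mat \<Rightarrow> complex mat \<Rightarrow> complex mat" where
  "LO A C = Matrix.mat r r (\<lambda>(i, k). ((U * C) * resolvent A (mu i)) $$ (0, k))"

definition LR :: "complex mat \<Rightarrow> complex mat \<Rightarrow> complex mat" where
  "LR A B = Matrix.mat r r (\<lambda>(k, j). (resolvent A (nu j) * (B * V)) $$ (k, 0))"

lemma L_carrier [simp]:
  "U \<in> carrier_mat 1 p" "V \<in> carrier_mat m 1"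
  "LK s G \<in> carrier_mat r r" "LW G \<in> carrier_mat p r" "LY G \<in> carrier_mat r m"
  "LO A C \<in> carrier_mat r r" "LR A B \<in> carrier_mat r r"
  by (simp_all add: U_def V_def LK_def LW_def LY_def LO_def LR_def)

lemma GV_index:
  assumes "X \<in> carrier_mat a m" "i < a"
  shows "(X * V) $$ (i, 0) = (\<Sum>l<m. X $$ (i, l) * v l)"
  using mult_mat_index[OF assms(1) L_carrier(2) assms(2), of 0] by (simp add: V_def)

lemma UG_index:
  assumes "X \<in> carrier_mat p b" "l < b"
  shows "(U * X) $$ (0, l) = (\<Sum>j<p. u j * X $$ (j, l))"
  using mult_mat_index[OF L_carrier(1) assms(1), of 0 l] assms(2) by (simp add: U_def)

lemma gval_eq:
  assumes G: "G z \<in> carrier_mat p m"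
  shows "gval G z = (U * G z * V) $$ (0, 0)"
proof -
  have UG: "U * G z \<in> carrier_mat 1 m" by (rule mult_carrier_mat[OF L_carrier(1) G])
  have "(U * G z * V) $$ (0, 0) = (\<Sum>l<m. (U * G z) $$ (0, l) * v l)" by (rule GV_index[OF UG]) simp
  also have "\<dots> = (\<Sum>l<m. (\<Sum>j<p. u j * G z $$ (j, l)) * v l)"
    by (intro sum.cong refl) (simp add: UG_index[OF G])
  also have "\<dots> = gval G z"
    unfolding gval_def sum_distrib_right by (rule sum.swap)
  finally show ?thesis ..
qed

text \<open>The resolvent identity turns the product of resolvents at \<open>mu i\<close> and
  \<open>nu j\<close> into a divided difference of point values. Hence the realization occurs only
  on the right-hand sides.\<close>

lemma loewner_factor:
  assumes ABC: "realization p m r A B C"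
    and mu: "\<And>i. i < r \<Longrightarrow> \<not> eigenvalue A (mu i)" and nu: "\<And>i. i < r \<Longrightarrow> \<not> eigenvalue A (nu i)"
    and mn: "\<And>i j. i < r \<Longrightarrow> j < r \<Longrightarrow> mu i \<noteq> nu j"
    and Gmu: "\<And>i. i < r \<Longrightarrow> G (mu i) = C * resolvent A (mu i) * B"
    and Gnu: "\<And>i. i < r \<Longrightarrow> G (nu i) = C * resolvent A (nu i) * B"
  shows "LK s G = LO A C * (s \<cdot>\<^sub>m 1\<^sub>m r - A) * LR A B" "LW G = C * LR A B" "LY G = LO A C * B"
proof -
  have A: "A \<in> carrier_mat r r" and B: "B \<in> carrier_mat r m" and C: "C \<in> carrier_mat p r"
    using ABC by (auto simp: realization_def)
  let ?S = "s \<cdot>\<^sub>m 1\<^sub>m r - A"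
  have S: "?S \<in> carrier_mat r r" using A by auto
  define a where "a = U * C"
  define b where "b = B * V"
  have a: "a \<in> carrier_mat 1 r" unfolding a_def by (rule mult_carrier_mat[OF L_carrier(1) C])
  have b: "b \<in> carrier_mat r 1" unfolding b_def by (rule mult_carrier_mat[OF B L_carrier(2)])
  \<comment> \<open>The linear functional \<open>X |-> u^T C X B v\<close>, which reads the scalar
    data off a resolvent.\<close>
  define \<Phi> where "\<Phi> X = (\<Sum>k<r. (\<Sum>n<r. a $$ (0, n) * X $$ (n, k)) * b $$ (k, 0))" for X
  have Phi: "(a * X * b) $$ (0, 0) = \<Phi> X" if X: "X \<in> carrier_mat r r" for X
  proof -
    have aX: "a * X \<in> carrier_mat 1 r" by (rule mult_carrier_mat[OF a X])
    show ?thesis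
      unfolding \<Phi>_def mult_mat_index[OF aX b zero_lt_one_nat zero_lt_one_nat]
      by (intro sum.cong refl) (simp only: mult_mat_index[OF a X zero_lt_one_nat] lessThan_iff)
  qed
  have R: "resolvent A z \<in> carrier_mat r r" for z by (rule resolvent_carrier[OF A])
  have gv: "gval (\<lambda>z. C * resolvent A z * B) z = \<Phi> (resolvent A z)" for z
  proof -
    have CR: "C * resolvent A z \<in> carrier_mat p r" by (rule mult_carrier_mat[OF C R])
    have CRB: "C * resolvent A z * B \<in> carrier_mat p m" by (rule mult_carrier_mat[OF CR B])
    have "U * (C * resolvent A z * B) * V = (U * (C * resolvent A z)) * B * V"
      by (simp only: assoc_mult_mat[OF L_carrier(1) CR B])
    also have "\<dots> = (U * (C * resolvent A z)) * (B * V)"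
      by (rule assoc_mult_mat[OF mult_carrier_mat[OF L_carrier(1) CR] B L_carrier(2)])
    also have "\<dots> = a * resolvent A z * b"
      by (simp only: a_def b_def assoc_mult_mat[OF L_carrier(1) C R])
    finally show ?thesis using gval_eq[of "\<lambda>z. C * resolvent A z * B" z] CRB Phi[OF R] by simp
  qed
  have gmu: "gval G (mu i) = \<Phi> (resolvent A (mu i))" if "i < r" for i
    using gv[of "mu i"] Gmu[OF that] by (simp add: gval_def)
  have gnu: "gval G (nu i) = \<Phi> (resolvent A (nu i))" if "i < r" for i
    using gv[of "nu i"] Gnu[OF that] by (simp add: gval_def)
  have \<Phi>_add: "\<Phi> (X + Y) = \<Phi> X + \<Phi> Y" if "X \<in> carrier_mat r r" "Y \<in> carrier_mat r r" for X Y
    using that unfolding \<Phi>_def by (simp add: carrier_matD[OF that(2)] sum.distrib distrib_left distrib_right)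
  have \<Phi>_diff: "\<Phi> (X - Y) = \<Phi> X - \<Phi> Y" if "X \<in> carrier_mat r r" "Y \<in> carrier_mat r r" for X Y
    using that unfolding \<Phi>_def by (simp add: carrier_matD[OF that(2)] sum_subtractf right_diff_distrib left_diff_distrib)
  have \<Phi>_smult: "\<Phi> (c \<cdot>\<^sub>m X) = c * \<Phi> X" if "X \<in> carrier_mat r r" for c X
    using that unfolding \<Phi>_def by (simp add: carrier_matD[OF that] sum_distrib_left mult_ac)
  have LOi: "LO A C $$ (i, k) = (\<Sum>n<r. a $$ (0, n) * resolvent A (mu i) $$ (n, k))" if "i < r" "k < r" for i k
    using that by (simp only: LO_def index_mat(1) prod.case a_def[symmetric] mult_mat_index[OF a R zero_lt_one_nat])
  have LRi: "LR A B $$ (k, j) = (\<Sum>n<r. resolvent A (nu j) $$ (k, n) * b $$ (n, 0))" if "k < r" "j < r" for k j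
    using that by (simp only: LR_def index_mat(1) prod.case b_def[symmetric] mult_mat_index[OF R b _ zero_lt_one_nat])
  show "LK s G = LO A C * ?S * LR A B"
  proof (rule eq_matI)
    show "dim_row (LK s G) = dim_row (LO A C * ?S * LR A B)" "dim_col (LK s G) = dim_col (LO A C * ?S * LR A B)"
      using S by (auto simp: carrier_matD[OF L_carrier(3)] carrier_matD[OF L_carrier(6)] carrier_matD[OF L_carrier(7)])
    fix i j assume "i < dim_row (LO A C * ?S * LR A B)" "j < dim_col (LO A C * ?S * LR A B)"
    then have ij: "i < r" "j < r"
      by (auto simp: carrier_matD[OF L_carrier(6)] carrier_matD[OF L_carrier(7)])
    let ?M = "resolvent A (mu i)" and ?N = "resolvent A (nu j)"
    have MS: "?M * ?S \<in> carrier_mat r r" by (rule mult_carrier_mat[OF R S])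
    have OS: "LO A C * ?S \<in> carrier_mat r r" by (rule mult_carrier_mat[OF L_carrier(6) S])
    have aM: "a * ?M \<in> carrier_mat 1 r" by (rule mult_carrier_mat[OF a R])
    have Nb: "?N * b \<in> carrier_mat r 1" by (rule mult_carrier_mat[OF R b])
    have aMi: "(a * ?M) $$ (0, k) = LO A C $$ (i, k)" if "k < r" for k
      using that ij by (simp only: LO_def index_mat(1) prod.case a_def)
    have Nbi: "(?N * b) $$ (k, 0) = LR A B $$ (k, j)" if "k < r" for k
      using that ij by (simp only: LR_def index_mat(1) prod.case b_def)
    have aMS: "a * ?M * ?S \<in> carrier_mat 1 r" by (rule mult_carrier_mat[OF aM S])
    have "(LO A C * ?S * LR A B) $$ (i, j) = (\<Sum>k<r. (LO A C * ?S) $$ (i, k) * LR A B $$ (k, j))"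
      by (rule mult_mat_index[OF OS L_carrier(7) ij])
    also have "\<dots> = (\<Sum>k<r. (a * ?M * ?S) $$ (0, k) * (?N * b) $$ (k, 0))"
    proof (rule sum.cong[OF refl])
      fix k assume "k \<in> {..<r}"
      then have k: "k < r" by simp
      have "(LO A C * ?S) $$ (i, k) = (a * ?M * ?S) $$ (0, k)"
        unfolding mult_mat_index[OF L_carrier(6) S ij(1) k] mult_mat_index[OF aM S zero_lt_one_nat k]
        by (intro sum.cong refl) (simp only: aMi lessThan_iff)
      then show "(LO A C * ?S) $$ (i, k) * LR A B $$ (k, j) = (a * ?M * ?S) $$ (0, k) * (?N * b) $$ (k, 0)"
        by (simp only: Nbi[OF k])
    qed
    also have "\<dots> = (a * ?M * ?S * (?N * b)) $$ (0, 0)"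
      by (rule mult_mat_index[OF aMS Nb zero_lt_one_nat zero_lt_one_nat, symmetric])
    also have "a * ?M * ?S * (?N * b) = a * (?M * ?S * ?N) * b"
    proof -
      have MSN: "?M * ?S * ?N \<in> carrier_mat r r" by (rule mult_carrier_mat[OF MS R])
      have "a * ?M * ?S * (?N * b) = a * (?M * ?S) * (?N * b)" by (simp only: assoc_mult_mat[OF a R S])
      also have "\<dots> = a * (?M * ?S) * ?N * b"
        by (rule assoc_mult_mat[symmetric, OF mult_carrier_mat[OF a MS] R b])
      also have "\<dots> = a * (?M * ?S * ?N) * b" by (simp only: assoc_mult_mat[OF a MS R])
      finally show ?thesis .
    qed
    also have "(a * (?M * ?S * ?N) * b) $$ (0, 0) = \<Phi> (?M * ?S * ?N)"
      by (rule Phi[OF mult_carrier_mat[OF MS R]])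
    also have "\<dots> = (s - mu i) * \<Phi> (?M * ?N) + \<Phi> ?N"
    proof -
      have MN: "?M * ?N \<in> carrier_mat r r" by (rule mult_carrier_mat[OF R R])
      show ?thesis
        unfolding resolvent_product(1)[OF A mu[OF ij(1)] nu[OF ij(2)]]
        by (simp only: \<Phi>_add[OF smult_carrier_mat[OF MN] R] \<Phi>_smult[OF MN])
    qed
    also have "\<Phi> (?M * ?N) = (gval G (mu i) - gval G (nu j)) / (nu j - mu i)"
    proof -
      have MN: "?M * ?N \<in> carrier_mat r r" by (rule mult_carrier_mat[OF R R])
      have "(nu j - mu i) * \<Phi> (?M * ?N) = \<Phi> (?M - ?N)"
        by (simp only: \<Phi>_smult[OF MN, symmetric] resolvent_product(2)[OF A mu[OF ij(1)] nu[OF ij(2)]])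
      also have "\<dots> = gval G (mu i) - gval G (nu j)"
        by (simp only: \<Phi>_diff[OF R R] gmu[OF ij(1)] gnu[OF ij(2)])
      finally show ?thesis using mn[OF ij] by (simp add: field_simps)
    qed
    also have "\<Phi> ?N = gval G (nu j)" by (rule gnu[OF ij(2), symmetric])
    finally show "LK s G $$ (i, j) = (LO A C * ?S * LR A B) $$ (i, j)"
      using ij by (simp add: LK_def)
  qed
  show "LW G = C * LR A B"
  proof (rule eq_matI)
    show "dim_row (LW G) = dim_row (C * LR A B)" "dim_col (LW G) = dim_col (C * LR A B)"
      using C by (auto simp: carrier_matD[OF L_carrier(4)] carrier_matD[OF L_carrier(7)])
    fix i j assume "i < dim_row (C * LR A B)" "j < dim_col (C * LR A B)"
    then have ij: "i < p" "j < r" using C by (auto simp: carrier_matD[OF L_carrier(7)])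
    have CR: "C * resolvent A (nu j) \<in> carrier_mat p r" by (rule mult_carrier_mat[OF C R])
    have CRB: "C * resolvent A (nu j) * B \<in> carrier_mat p m" by (rule mult_carrier_mat[OF CR B])
    have Nb: "resolvent A (nu j) * b \<in> carrier_mat r 1" by (rule mult_carrier_mat[OF R b])
    have "LW G $$ (i, j) = (\<Sum>l<m. (C * resolvent A (nu j) * B) $$ (i, l) * v l)"
      using ij by (simp add: LW_def Gnu)
    also have "\<dots> = (C * resolvent A (nu j) * B * V) $$ (i, 0)" by (rule GV_index[OF CRB ij(1), symmetric])
    also have "C * resolvent A (nu j) * B * V = C * resolvent A (nu j) * b"
      unfolding b_def by (rule assoc_mult_mat[OF CR B L_carrier(2)])
    also have "\<dots> = C * (resolvent A (nu j) * b)" by (rule assoc_mult_mat[OF C R b])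
    also have "(C * (resolvent A (nu j) * b)) $$ (i, 0) = (\<Sum>k<r. C $$ (i, k) * (resolvent A (nu j) * b) $$ (k, 0))"
      by (rule mult_mat_index[OF C Nb ij(1) zero_lt_one_nat])
    also have "\<dots> = (\<Sum>k<r. C $$ (i, k) * LR A B $$ (k, j))"
      using ij by (intro sum.cong refl) (simp only: LR_def index_mat(1) prod.case b_def lessThan_iff)
    also have "\<dots> = (C * LR A B) $$ (i, j)" by (rule mult_mat_index[OF C L_carrier(7) ij, symmetric])
    finally show "LW G $$ (i, j) = (C * LR A B) $$ (i, j)" .
  qed
  show "LY G = LO A C * B"
  proof (rule eq_matI)
    show "dim_row (LY G) = dim_row (LO A C * B)" "dim_col (LY G) = dim_col (LO A C * B)"
      using B by (auto simp: carrier_matD[OF L_carrier(5)] carrier_matD[OF L_carrier(6)])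
    fix i j assume "i < dim_row (LO A C * B)" "j < dim_col (LO A C * B)"
    then have ij: "i < r" "j < m" using B by (auto simp: carrier_matD[OF L_carrier(6)])
    let ?M = "resolvent A (mu i)"
    have CM: "C * ?M \<in> carrier_mat p r" by (rule mult_carrier_mat[OF C R])
    have CMB: "C * ?M * B \<in> carrier_mat p m" by (rule mult_carrier_mat[OF CM B])
    have aM: "a * ?M \<in> carrier_mat 1 r" by (rule mult_carrier_mat[OF a R])
    have "LY G $$ (i, j) = (\<Sum>k<p. u k * (C * ?M * B) $$ (k, j))"
      using ij by (simp add: LY_def Gmu)
    also have "\<dots> = (U * (C * ?M * B)) $$ (0, j)" by (rule UG_index[OF CMB ij(2), symmetric])
    also have "U * (C * ?M * B) = U * (C * ?M) * B" by (rule assoc_mult_mat[OF L_carrier(1) CM B, symmetric])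
    also have "\<dots> = a * ?M * B" by (simp only: a_def assoc_mult_mat[OF L_carrier(1) C R])
    also have "(a * ?M * B) $$ (0, j) = (\<Sum>k<r. (a * ?M) $$ (0, k) * B $$ (k, j))"
      by (rule mult_mat_index[OF aM B zero_lt_one_nat ij(2)])
    also have "\<dots> = (\<Sum>k<r. LO A C $$ (i, k) * B $$ (k, j))"
      using ij by (intro sum.cong refl) (simp only: LO_def index_mat(1) prod.case a_def lessThan_iff)
    also have "\<dots> = (LO A C * B) $$ (i, j)" by (rule mult_mat_index[OF L_carrier(6) B ij, symmetric])
    finally show "LY G $$ (i, j) = (LO A C * B) $$ (i, j)" .
  qed
qed

text \<open>The factorization gives \<open>K^-1 = LR^-1 R(s) LO^-1\<close>, and the unknown factors
  \<open>LO\<close> and \<open>LR\<close> cancel against \<open>Y\<close> and \<open>W\<close>. The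
  value at \<open>s\<close> is thus a fixed expression in point values, whichever realization of
  order \<open>r\<close> lies behind it.\<close>

lemma loewner_recover:
  assumes ABC: "realization p m r A B C"
    and mu: "\<And>i. i < r \<Longrightarrow> \<not> eigenvalue A (mu i)" and nu: "\<And>i. i < r \<Longrightarrow> \<not> eigenvalue A (nu i)"
    and mn: "\<And>i j. i < r \<Longrightarrow> j < r \<Longrightarrow> mu i \<noteq> nu j"
    and Gmu: "\<And>i. i < r \<Longrightarrow> G (mu i) = C * resolvent A (mu i) * B"
    and Gnu: "\<And>i. i < r \<Longrightarrow> G (nu i) = C * resolvent A (nu i) * B"
    and s: "\<not> eigenvalue A s" and d: "Determinant.det (LK s G) \<noteq> 0"
  shows "LW G * minv (LK s G) = C * resolvent A s * minv (LO A C)"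
    "minv (LK s G) * LY G = minv (LR A B) * resolvent A s * B"
    "LW G * (minv (LK s G) * LY G) = C * resolvent A s * B"
proof -
  have A: "A \<in> carrier_mat r r" and B: "B \<in> carrier_mat r m" and C: "C \<in> carrier_mat p r"
    using ABC by (auto simp: realization_def)
  let ?S = "s \<cdot>\<^sub>m 1\<^sub>m r - A" and ?O = "LO A C" and ?R = "LR A B" and ?P = "resolvent A s"
  have S: "?S \<in> carrier_mat r r" using A by auto
  note P = resolvent[OF A s]
  have O: "?O \<in> carrier_mat r r" and R: "?R \<in> carrier_mat r r" by simp_all
  have fac: "LK s G = ?O * ?S * ?R" "LW G = C * ?R" "LY G = ?O * B"
    by (rule loewner_factor[OF ABC mu nu mn Gmu Gnu]; assumption)+
  note K = fac(1)
  have OS: "?O * ?S \<in> carrier_mat r r" by (rule mult_carrier_mat[OF O S])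
  \<comment> \<open>Nonsingularity of the pencil passes to both outer factors, so no separate rank
    condition on the realization appears.\<close>
  have "Determinant.det (LK s G) = Determinant.det ?O * Determinant.det ?S * Determinant.det ?R"
    unfolding K Determinant.det_mult[OF OS R] Determinant.det_mult[OF O S] ..
  with d have dO: "Determinant.det ?O \<noteq> 0" and dR: "Determinant.det ?R \<noteq> 0" by auto
  note Oi = minv[OF O dO] and Ri = minv[OF R dR]
  let ?X = "minv ?R * ?P * minv ?O"
  have RP: "minv ?R * ?P \<in> carrier_mat r r" by (rule mult_carrier_mat[OF Ri(1) P(1)])
  have X: "?X \<in> carrier_mat r r" by (rule mult_carrier_mat[OF RP Oi(1)])
  have PO: "?P * minv ?O \<in> carrier_mat r r" by (rule mult_carrier_mat[OF P(1) Oi(1)])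
  have RX: "?R * ?X = ?P * minv ?O"
  proof -
    have "?R * ?X = ?R * (minv ?R * (?P * minv ?O))" by (simp only: assoc_mult_mat[OF Ri(1) P(1) Oi(1)])
    also have "\<dots> = ?R * minv ?R * (?P * minv ?O)" by (rule assoc_mult_mat[OF R Ri(1) PO, symmetric])
    also have "\<dots> = ?P * minv ?O" by (simp only: Ri(2) left_mult_one_mat[OF PO])
    finally show ?thesis .
  qed
  have XO: "?X * ?O = minv ?R * ?P"
    by (simp only: assoc_mult_mat[OF RP Oi(1) O] Oi(3) right_mult_one_mat[OF RP])
  have "LK s G * ?X = 1\<^sub>m r"
  proof -
    have "LK s G * ?X = ?O * ?S * (?P * minv ?O)" unfolding K assoc_mult_mat[OF OS R X] RX ..
    also have "\<dots> = ?O * (?S * (?P * minv ?O))" by (rule assoc_mult_mat[OF O S PO])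
    also have "?S * (?P * minv ?O) = ?S * ?P * minv ?O" by (rule assoc_mult_mat[OF S P(1) Oi(1), symmetric])
    also have "\<dots> = minv ?O" by (simp only: P(2) left_mult_one_mat[OF Oi(1)])
    also have "?O * minv ?O = 1\<^sub>m r" by (rule Oi(2))
    finally show ?thesis .
  qed
  then have Ki: "minv (LK s G) = ?X" by (rule minv_unique(1)[OF L_carrier(3) X])
  have CP: "C * ?P \<in> carrier_mat p r" by (rule mult_carrier_mat[OF C P(1)])
  have "LW G * minv (LK s G) = C * (?R * ?X)" by (simp only: Ki fac(2) assoc_mult_mat[OF C R X])
  also have "\<dots> = C * ?P * minv ?O" unfolding RX by (rule assoc_mult_mat[OF C P(1) Oi(1), symmetric])
  finally show 1: "LW G * minv (LK s G) = C * ?P * minv ?O" .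
  have "minv (LK s G) * LY G = ?X * ?O * B" by (simp only: Ki fac(3) assoc_mult_mat[OF X O B])
  then show 2: "minv (LK s G) * LY G = minv ?R * ?P * B" unfolding XO .
  have "LW G * (minv (LK s G) * LY G) = LW G * minv (LK s G) * LY G"
    by (rule assoc_mult_mat[OF L_carrier(4) minv_carrier[OF L_carrier(3)] L_carrier(5), symmetric])
  also have "\<dots> = C * ?P * minv ?O * (?O * B)" unfolding 1 fac(3) ..
  also have "\<dots> = C * ?P * (minv ?O * (?O * B))" by (rule assoc_mult_mat[OF CP Oi(1) mult_carrier_mat[OF O B]])
  also have "minv ?O * (?O * B) = minv ?O * ?O * B" by (rule assoc_mult_mat[OF Oi(1) O B, symmetric])
  also have "\<dots> = B" by (simp only: Oi(3) left_mult_one_mat[OF B])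
  finally show "LW G * (minv (LK s G) * LY G) = C * ?P * B" .
qed

lemma gval_linear:
  assumes "G z \<in> carrier_mat p m" "G' z \<in> carrier_mat p m"
  shows "gval (\<lambda>z. c \<cdot>\<^sub>m (G z - G' z)) z = c * (gval G z - gval G' z)"
  using assms unfolding gval_def
  by (simp add: carrier_matD[OF assms(2)] sum_distrib_left sum_subtractf[symmetric] algebra_simps)

lemma L_linear:
  assumes mu: "\<And>i. i < r \<Longrightarrow> G (mu i) \<in> carrier_mat p m" "\<And>i. i < r \<Longrightarrow> G' (mu i) \<in> carrier_mat p m"
    and nu: "\<And>i. i < r \<Longrightarrow> G (nu i) \<in> carrier_mat p m" "\<And>i. i < r \<Longrightarrow> G' (nu i) \<in> carrier_mat p m"
  shows "LK s (\<lambda>z. c \<cdot>\<^sub>m (G z - G' z)) = c \<cdot>\<^sub>m (LK s G - LK s G')"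
    "LW (\<lambda>z. c \<cdot>\<^sub>m (G z - G' z)) = c \<cdot>\<^sub>m (LW G - LW G')"
    "LY (\<lambda>z. c \<cdot>\<^sub>m (G z - G' z)) = c \<cdot>\<^sub>m (LY G - LY G')"
proof -
  \<comment> \<open>The case \<open>y = 0\<close> covers coinciding points, where the quotient is 0
    by convention and linearity persists.\<close>
  have lin: "(s - x) * (c * g1 - c * g1' - (c * g2 - c * g2')) / y + (c * g2 - c * g2')
    = c * ((s - x) * (g1 - g2) / y + g2 - ((s - x) * (g1' - g2') / y + g2'))" for x y g1 g1' g2 g2'
    by (cases "y = 0") (simp_all add: field_simps)
  show "LK s (\<lambda>z. c \<cdot>\<^sub>m (G z - G' z)) = c \<cdot>\<^sub>m (LK s G - LK s G')"
  proof -
    have "gval (\<lambda>z. c \<cdot>\<^sub>m (G z - G' z)) (mu i) = c * gval G (mu i) - c * gval G' (mu i)" 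
      "gval (\<lambda>z. c \<cdot>\<^sub>m (G z - G' z)) (nu i) = c * gval G (nu i) - c * gval G' (nu i)" if "i < r" for i
      using gval_linear[of G "mu i" G' c] gval_linear[of G "nu i" G' c] mu[OF that] nu[OF that]
      by (simp_all add: right_diff_distrib)
    then show ?thesis by (intro eq_matI) (simp_all add: LK_def lin)
  qed
  show "LW (\<lambda>z. c \<cdot>\<^sub>m (G z - G' z)) = c \<cdot>\<^sub>m (LW G - LW G')"
  proof (rule eq_matI)
    fix i j assume "i < dim_row (c \<cdot>\<^sub>m (LW G - LW G'))" "j < dim_col (c \<cdot>\<^sub>m (LW G - LW G'))"
    then have ij: "i < p" "j < r" by (auto simp: LW_def)
    then show "LW (\<lambda>z. c \<cdot>\<^sub>m (G z - G' z)) $$ (i, j) = (c \<cdot>\<^sub>m (LW G - LW G')) $$ (i, j)"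
      by (simp add: LW_def carrier_matD[OF nu(2)[OF ij(2)]] sum_distrib_left sum_subtractf[symmetric] algebra_simps)
  qed (simp_all add: LW_def)
  show "LY (\<lambda>z. c \<cdot>\<^sub>m (G z - G' z)) = c \<cdot>\<^sub>m (LY G - LY G')"
  proof (rule eq_matI)
    fix i j assume "i < dim_row (c \<cdot>\<^sub>m (LY G - LY G'))" "j < dim_col (c \<cdot>\<^sub>m (LY G - LY G'))"
    then have ij: "i < r" "j < m" by (auto simp: LY_def)
    then show "LY (\<lambda>z. c \<cdot>\<^sub>m (G z - G' z)) $$ (i, j) = (c \<cdot>\<^sub>m (LY G - LY G')) $$ (i, j)"
      by (simp add: LY_def carrier_matD[OF mu(2)[OF ij(1)]] sum_distrib_left sum_subtractf[symmetric] algebra_simps)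
  qed (simp_all add: LY_def)
qed

lemma L_tendsto:
  assumes mu: "\<And>i j l. i < r \<Longrightarrow> j < p \<Longrightarrow> l < m \<Longrightarrow> ((\<lambda>h. G h (mu i) $$ (j, l)) \<longlongrightarrow> G' (mu i) $$ (j, l)) F"
    and nu: "\<And>i j l. i < r \<Longrightarrow> j < p \<Longrightarrow> l < m \<Longrightarrow> ((\<lambda>h. G h (nu i) $$ (j, l)) \<longlongrightarrow> G' (nu i) $$ (j, l)) F"
  shows "mat_lim r r (\<lambda>h. LK s (G h)) (LK s G') F" "mat_lim p r (\<lambda>h. LW (G h)) (LW G') F"
    "mat_lim r m (\<lambda>h. LY (G h)) (LY G') F"
proof -
  have gmu: "((\<lambda>h. gval (G h) (mu i)) \<longlongrightarrow> gval G' (mu i)) F" if "i < r" for i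
    unfolding gval_def by (intro tendsto_sum tendsto_mult tendsto_const mu[OF that]) auto
  have gnu: "((\<lambda>h. gval (G h) (nu i)) \<longlongrightarrow> gval G' (nu i)) F" if "i < r" for i
    unfolding gval_def by (intro tendsto_sum tendsto_mult tendsto_const nu[OF that]) auto
  have div: "((\<lambda>h. f h / y) \<longlongrightarrow> l / y) F" if "(f \<longlongrightarrow> l) F" for f l and y :: complex
    using tendsto_mult[OF that tendsto_const[of "inverse y"]] by (simp add: divide_inverse)
  show "mat_lim r r (\<lambda>h. LK s (G h)) (LK s G') F"
    unfolding mat_lim_def by (auto simp: LK_def intro!: tendsto_add tendsto_mult tendsto_const div tendsto_diff gmu gnu)
  show "mat_lim p r (\<lambda>h. LW (G h)) (LW G') F"
    unfolding mat_lim_def by (auto simp: LW_def intro!: tendsto_sum tendsto_mult tendsto_const nu)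
  show "mat_lim r m (\<lambda>h. LY (G h)) (LY G') F"
    unfolding mat_lim_def by (auto simp: LY_def intro!: tendsto_sum tendsto_mult tendsto_const mu)
qed

end

section \<open>Diagonal realizations and Cauchy matrices\<close>

lemma resolvent_mat_diag:
  assumes z: "\<And>k. k < r \<Longrightarrow> z \<noteq> lam k"
  shows "resolvent (mat_diag r lam) z = mat_diag r (\<lambda>k. 1 / (z - lam k))" "\<not> eigenvalue (mat_diag r lam) z"
proof -
  have A: "mat_diag r lam \<in> carrier_mat r r" by simp
  have S: "z \<cdot>\<^sub>m 1\<^sub>m r - mat_diag r lam = mat_diag r (\<lambda>k. z - lam k)"
    by (rule eq_matI) (auto simp: mat_diag_def)
  have "mat_diag r (\<lambda>k. z - lam k) * mat_diag r (\<lambda>k. 1 / (z - lam k)) = 1\<^sub>m r"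
    unfolding mat_diag_diag by (rule eq_matI) (auto simp: mat_diag_def z)
  from minv_unique[OF mat_diag_dim mat_diag_dim this]
  have 1: "minv (mat_diag r (\<lambda>k. z - lam k)) = mat_diag r (\<lambda>k. 1 / (z - lam k))"
    and 2: "Determinant.det (mat_diag r (\<lambda>k. z - lam k)) \<noteq> 0" by auto
  show "resolvent (mat_diag r lam) z = mat_diag r (\<lambda>k. 1 / (z - lam k))"
    using 1 S by (simp add: resolvent_def carrier_matD[OF A])
  show "\<not> eigenvalue (mat_diag r lam) z"
    using 2 det_shift_eigenvalue[OF A, of z] unfolding S by simp
qed

text \<open>A kernel vector \<open>x\<close> gives the rational function with poles
  \<open>lam k\<close> and residues \<open>a k * x k\<close>. Its numerator has degree below
  \<open>r\<close> and vanishes at the \<open>r\<close> points \<open>mu i\<close>, hence is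
  zero.\<close>

lemma cauchy_det_nonzero:
  fixes mu lam a :: "nat \<Rightarrow> complex"
  assumes mu: "inj_on mu {..<r}" and lam: "inj_on lam {..<r}"
    and ml: "\<And>i k. i < r \<Longrightarrow> k < r \<Longrightarrow> mu i \<noteq> lam k" and a: "\<And>k. k < r \<Longrightarrow> a k \<noteq> 0"
  shows "Determinant.det (Matrix.mat r r (\<lambda>(i, k). a k / (mu i - lam k))) \<noteq> 0"
proof
  let ?M = "Matrix.mat r r (\<lambda>(i, k). a k / (mu i - lam k))"
  assume "Determinant.det ?M = 0"
  then obtain x where x: "x \<in> carrier_vec r" "x \<noteq> 0\<^sub>v r" "?M *\<^sub>v x = 0\<^sub>v r"
    using det_0_iff_vec_prod_zero[of ?M r] by auto
  have sum0: "(\<Sum>k<r. a k / (mu i - lam k) * vec_index x k) = 0" if i: "i < r" for i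
  proof -
    have "vec_index (?M *\<^sub>v x) i = (\<Sum>k<r. a k / (mu i - lam k) * vec_index x k)"
      using i x(1) by (simp add: scalar_prod_def atLeast0LessThan)
    then show ?thesis using x(3) i by simp
  qed
  \<comment> \<open>\<open>P\<close> is the numerator of that rational function over the common
    denominator.\<close>
  define Q where "Q k = (\<Prod>l\<in>{..<r} - {k}. [:- lam l, 1:])" for k
  define P where "P = (\<Sum>k<r. Polynomial.smult (a k * vec_index x k) (Q k))"
  have degQ: "degree (Q k) \<le> r - 1" if "k < r" for k
  proof -
    have "degree (Q k) \<le> (\<Sum>l\<in>{..<r} - {k}. degree [:- lam l, 1:])" unfolding Q_def using degree_prod_sum_le[of "{..<r} - {k}" "\<lambda>l. [:- lam l, 1:]"] by (simp add: o_def)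
    also have "\<dots> = r - 1" using that by simp
    finally show ?thesis .
  qed
  have "P = 0"
  proof (cases "r = 0")
    \<comment> \<open>Here the truncated \<open>r - 1\<close> is 0, and there are no points to
      exceed the degree bound.\<close>
    case True then show ?thesis by (simp add: P_def)
  next
    case False
    have "degree P \<le> r - 1" unfolding P_def
    proof (rule degree_sum_le)
      fix k assume "k \<in> {..<r}"
      then have "degree (Q k) \<le> r - 1" by (intro degQ) simp
      then show "degree (Polynomial.smult (a k * vec_index x k) (Q k)) \<le> r - 1"
        using degree_smult_le order_trans by blast
    qed simp
    moreover have "card (mu ` {..<r}) = r" using card_image[OF mu] by simp
    ultimately show "P = 0"
    proof (intro poly_eqI_degree[where A="mu ` {..<r}"])
      fix z assume "z \<in> mu ` {..<r}"
      then obtain i where i: "i < r" "z = mu i" by auto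
      have "poly P z = (\<Sum>k<r. a k * vec_index x k * (\<Prod>l\<in>{..<r} - {k}. z - lam l))"
        by (simp add: P_def Q_def poly_sum poly_prod)
      also have "\<dots> = (\<Sum>k<r. (\<Prod>l<r. z - lam l) * (a k / (mu i - lam k) * vec_index x k))"
      proof (rule sum.cong[OF refl])
        fix k assume k: "k \<in> {..<r}"
        have "(\<Prod>l<r. z - lam l) = (z - lam k) * (\<Prod>l\<in>{..<r} - {k}. z - lam l)"
          using k by (intro prod.remove) auto
        then show "a k * vec_index x k * (\<Prod>l\<in>{..<r} - {k}. z - lam l) = (\<Prod>l<r. z - lam l) * (a k / (mu i - lam k) * vec_index x k)"
          using ml[OF i(1), of k] k i by simp
      qed
      also have "\<dots> = (\<Prod>l<r. z - lam l) * (\<Sum>k<r. a k / (mu i - lam k) * vec_index x k)"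
        by (simp only: sum_distrib_left)
      also have "\<dots> = 0" by (simp only: sum0[OF i(1)] mult_zero_right)
      finally show "poly P z = poly 0 z" by simp
    qed (use False in auto)
  qed
  \<comment> \<open>At \<open>lam k\<close> every summand of \<open>P\<close> but the
    \<open>k\<close>-th contains a vanishing factor.\<close>
  have "vec_index x k = 0" if k: "k < r" for k
  proof -
    have "0 = poly P (lam k)" using \<open>P = 0\<close> by simp
    also have "\<dots> = (\<Sum>n<r. a n * vec_index x n * (\<Prod>l\<in>{..<r} - {n}. lam k - lam l))"
      by (simp add: P_def Q_def poly_sum poly_prod)
    also have "\<dots> = (\<Sum>n\<in>{k}. a n * vec_index x n * (\<Prod>l\<in>{..<r} - {n}. lam k - lam l))"
      by (rule sum.mono_neutral_right) (use k in \<open>auto intro!: prod_zero bexI[of _ k]\<close>)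
    finally have "a k * vec_index x k * (\<Prod>l\<in>{..<r} - {k}. lam k - lam l) = 0" by simp
    moreover have "(\<Prod>l\<in>{..<r} - {k}. lam k - lam l) \<noteq> 0"
      using lam k by (auto simp: inj_on_def)
    ultimately show ?thesis using a[OF k] by simp
  qed
  then have "x = 0\<^sub>v r" using x(1) by (intro eq_vecI) auto
  with x(2) show False ..
qed

lemma mat_lim_add:
  assumes M: "mat_lim a b M L F" and N: "mat_lim a b N K F"
  shows "mat_lim a b (\<lambda>x. M x + N x) (L + K) F"
proof -
  have c: "L \<in> carrier_mat a b" "\<And>x. M x \<in> carrier_mat a b" "K \<in> carrier_mat a b" "\<And>x. N x \<in> carrier_mat a b"
    using M N by (auto simp: mat_lim_def)
  have "((\<lambda>x. (M x + N x) $$ (i, j)) \<longlongrightarrow> (L + K) $$ (i, j)) F" if ij: "i < a" "j < b" for i j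
  proof -
    have "(\<lambda>x. (M x + N x) $$ (i, j)) = (\<lambda>x. M x $$ (i, j) + N x $$ (i, j))"
      using c(4) ij by (intro ext) (simp add: carrier_matD[OF c(4)])
    moreover have "(L + K) $$ (i, j) = L $$ (i, j) + K $$ (i, j)" using c(3) ij by simp
    ultimately show ?thesis using M N ij by (auto simp: mat_lim_def intro!: tendsto_add)
  qed
  then show ?thesis
    unfolding mat_lim_def using add_carrier_mat[OF c(3)] add_carrier_mat[OF c(4)] by blast
qed

lemma mat_lim_unique:
  assumes M: "mat_lim a b M L F" and F: "F \<noteq> bot" and ij: "i < a" "j < b"
    and N: "((\<lambda>x. N x $$ (i, j)) \<longlongrightarrow> l) F" and eq: "\<forall>\<^sub>F x in F. N x = M x"
  shows "l = L $$ (i, j)"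
proof -
  have "((\<lambda>x. M x $$ (i, j)) \<longlongrightarrow> l) F"
    by (rule Lim_transform_eventually[OF N]) (use eq in eventually_elim, simp)
  moreover have "((\<lambda>x. M x $$ (i, j)) \<longlongrightarrow> L $$ (i, j)) F" using M ij by (auto simp: mat_lim_def)
  ultimately show ?thesis using tendsto_unique[OF F] by blast
qed

text \<open>The difference quotient of a product \<open>W K\<^sup>-\<^sup>1 Y\<close> around a base point at which
  \<open>W\<^sub>0 = X K\<^sub>0\<close>; only the factor \<open>Z = K\<^sup>-\<^sup>1 Y\<close> at the moving point appears.\<close>

lemma difference_quotient:
  fixes W0 W X K K0 Y Y0 Z :: "complex mat"
  assumes c: "W0 \<in> carrier_mat p r" "W \<in> carrier_mat p r" "X \<in> carrier_mat p r"
      "K \<in> carrier_mat r r" "K0 \<in> carrier_mat r r" "Y \<in> carrier_mat r m" "Y0 \<in> carrier_mat r m" "Z \<in> carrier_mat r m"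
    and W0: "X * K0 = W0" and Z: "K * Z = Y"
  shows "c \<cdot>\<^sub>m (W * Z - X * Y0) = X * (c \<cdot>\<^sub>m (Y - Y0)) + (c \<cdot>\<^sub>m (W - W0) - X * (c \<cdot>\<^sub>m (K - K0))) * Z"
proof -
  have XK: "X * K \<in> carrier_mat p r" by (rule mult_carrier_mat[OF c(3,4)])
  have XY: "X * Y \<in> carrier_mat p m" and XY0: "X * Y0 \<in> carrier_mat p m" and WZ: "W * Z \<in> carrier_mat p m"
    using mult_carrier_mat c by blast+
  have cancel: "c \<cdot>\<^sub>m (P - R) - c \<cdot>\<^sub>m (Q - R) = c \<cdot>\<^sub>m (P - Q)"
    "c \<cdot>\<^sub>m (P - R) = c \<cdot>\<^sub>m (Q - R) + c \<cdot>\<^sub>m (P - Q)"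
    if "P \<in> carrier_mat a b" "Q \<in> carrier_mat a b" "R \<in> carrier_mat a b" for P Q R :: "complex mat" and a b
    using that by (auto intro!: eq_matI simp: algebra_simps)
  have 1: "X * (c \<cdot>\<^sub>m (Y - Y0)) = c \<cdot>\<^sub>m (X * Y - X * Y0)"
    by (simp only: mult_smult_distrib[OF c(3) minus_carrier_mat[OF c(7)]] mult_minus_distrib_mat[OF c(3,6,7)])
  have "X * (c \<cdot>\<^sub>m (K - K0)) = c \<cdot>\<^sub>m (X * K - W0)"
    by (simp only: mult_smult_distrib[OF c(3) minus_carrier_mat[OF c(5)]] mult_minus_distrib_mat[OF c(3,4,5)] W0)
  then have "c \<cdot>\<^sub>m (W - W0) - X * (c \<cdot>\<^sub>m (K - K0)) = c \<cdot>\<^sub>m (W - X * K)"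
    using cancel(1)[OF c(2) XK c(1)] by simp
  then have "(c \<cdot>\<^sub>m (W - W0) - X * (c \<cdot>\<^sub>m (K - K0))) * Z = c \<cdot>\<^sub>m (W * Z - X * Y)"
    by (simp only: mult_smult_assoc_mat[OF minus_carrier_mat[OF XK] c(8)] minus_mult_distrib_mat[OF c(2) XK c(8)]
        assoc_mult_mat[OF c(3,4,8)] Z)
  with 1 show ?thesis using cancel(2)[OF WZ XY XY0] by (simp only:)
qed

section \<open>Differentiating the reconstruction formula\<close>

context loewner
begin

text \<open>The product rule for \<open>W K^-1 Y\<close> in the form
  \<open>X Y' + (W' - X K') Z\<close>, with \<open>X = W K^-1\<close> and \<open>Z = K^-1 Y\<close>
  at the base point. The derivatives \<open>W'\<close>, \<open>K'\<close>, \<open>Y'\<close> are the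
  same matrices built from \<open>D\<close>, by linearity, and the diagonal realization makes
  \<open>X\<close> and \<open>Z\<close> explicit.\<close>

lemma tangent_formula:
  assumes B0: "B0 \<in> carrier_mat r m" and C0: "C0 \<in> carrier_mat p r"
    and lam: "inj_on lam {..<r}" "\<And>k. k < r \<Longrightarrow> Re (lam k) < 0"
    and mu: "inj_on mu {..<r}" "\<And>k. k < r \<Longrightarrow> Re (mu k) > 0"
    and nu: "inj_on nu {..<r}" "\<And>k. k < r \<Longrightarrow> Re (nu k) > 0"
    and mn: "\<And>i j. i < r \<Longrightarrow> j < r \<Longrightarrow> mu i \<noteq> nu j"
    and uC: "\<And>k. k < r \<Longrightarrow> (U * C0) $$ (0, k) \<noteq> 0" and Bv: "\<And>k. k < r \<Longrightarrow> (B0 * V) $$ (k, 0) \<noteq> 0"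
    and G0: "\<And>s. Re s > 0 \<Longrightarrow> G 0 s = C0 * resolvent (mat_diag r lam) s * B0"
    and \<epsilon>: "\<epsilon> > 0"
    and Gh: "\<And>h. \<bar>h\<bar> < \<epsilon> \<Longrightarrow> \<exists>A B C. realization p m r A B C \<and> hurwitz A \<and> (\<forall>s. Re s > 0 \<longrightarrow> G h s = transfer A B C s)"
    and lim: "\<And>s j l. Re s > 0 \<Longrightarrow> j < p \<Longrightarrow> l < m \<Longrightarrow>
      ((\<lambda>h. (complex_of_real (1 / h) \<cdot>\<^sub>m (G h s - G 0 s)) $$ (j, l)) \<longlongrightarrow> D s $$ (j, l)) (at 0)"
    and s: "Re s > 0" and jl: "j < p" "l < m"
  shows "D s $$ (j, l) = ((C0 * resolvent (mat_diag r lam) s * minv (LO (mat_diag r lam) C0)) * LY D +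
      (LW D - (C0 * resolvent (mat_diag r lam) s * minv (LO (mat_diag r lam) C0)) * LK s D) *
      (minv (LR (mat_diag r lam) B0) * resolvent (mat_diag r lam) s * B0)) $$ (j, l)"
proof -
  let ?A = "mat_diag r lam"
  have A: "?A \<in> carrier_mat r r" by simp
  have ne: "z \<noteq> lam k" if "Re z > 0" "k < r" for z k using lam(2)[OF that(2)] that by auto
  have ev: "\<not> eigenvalue ?A z" if "Re z > 0" for z by (rule resolvent_mat_diag(2)) (use ne that in auto)
  have R: "resolvent ?A z = mat_diag r (\<lambda>k. 1 / (z - lam k))" if "Re z > 0" for z
    by (rule resolvent_mat_diag(1)) (use ne that in auto)
  have UC: "U * C0 \<in> carrier_mat 1 r" and BV: "B0 * V \<in> carrier_mat r 1"
    by (rule mult_carrier_mat[OF L_carrier(1) C0], rule mult_carrier_mat[OF B0 L_carrier(2)])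
  \<comment> \<open>A Cauchy matrix with its columns scaled by the entries of \<open>U * C0\<close>;
    likewise \<open>LR\<close> below, up to transposition.\<close>
  have LO: "LO ?A C0 = Matrix.mat r r (\<lambda>(i, k). (U * C0) $$ (0, k) / (mu i - lam k))"
    unfolding LO_def
    by (rule cong_mat) (simp_all add: R[OF mu(2)] mat_diag_mult_right[OF UC] del: index_mult_mat(1))
  have LR: "LR ?A B0 = transpose_mat (Matrix.mat r r (\<lambda>(j, k). (B0 * V) $$ (k, 0) / (nu j - lam k)))"
    unfolding LR_def
    by (rule eq_matI) (simp_all add: R[OF nu(2)] mat_diag_mult_left[OF BV] del: index_mult_mat(1))
  have dO: "Determinant.det (LO ?A C0) \<noteq> 0"
    unfolding LO by (rule cauchy_det_nonzero[OF mu(1) lam(1) _ uC]) (use ne mu in auto)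
  have "Determinant.det (Matrix.mat r r (\<lambda>(j, k). (B0 * V) $$ (k, 0) / (nu j - lam k))) \<noteq> 0"
    by (rule cauchy_det_nonzero[OF nu(1) lam(1) _ Bv]) (use ne nu in auto)
  then have dR: "Determinant.det (LR ?A B0) \<noteq> 0"
    unfolding LR by (subst Determinant.det_transpose[where n=r]) auto
  have real0: "realization p m r ?A B0 C0" using B0 C0 by (simp add: realization_def)
  have fac0: "LK s (G 0) = LO ?A C0 * (s \<cdot>\<^sub>m 1\<^sub>m r - ?A) * LR ?A B0"
    by (rule loewner_factor(1)[OF real0 ev[OF mu(2)] ev[OF nu(2)] mn G0[OF mu(2)] G0[OF nu(2)]])
  have S: "s \<cdot>\<^sub>m 1\<^sub>m r - ?A \<in> carrier_mat r r" by (rule shift_carrier[OF A])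
  have dK0: "Determinant.det (LK s (G 0)) \<noteq> 0"
    unfolding fac0 Determinant.det_mult[OF mult_carrier_mat[OF L_carrier(6) S] L_carrier(7)] Determinant.det_mult[OF L_carrier(6) S]
    using dO dR det_shift_eigenvalue[OF A, of s] ev[OF s] by simp
  have rec0: "LW (G 0) * minv (LK s (G 0)) = C0 * resolvent ?A s * minv (LO ?A C0)"
    "minv (LK s (G 0)) * LY (G 0) = minv (LR ?A B0) * resolvent ?A s * B0"
    "LW (G 0) * (minv (LK s (G 0)) * LY (G 0)) = C0 * resolvent ?A s * B0"
    by (rule loewner_recover[OF real0 ev[OF mu(2)] ev[OF nu(2)] mn G0[OF mu(2)] G0[OF nu(2)] ev[OF s] dK0]; assumption)+
  define X where "X = C0 * resolvent ?A s * minv (LO ?A C0)"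
  have K0i: "minv (LK s (G 0)) \<in> carrier_mat r r" by (rule minv_carrier[OF L_carrier(3)])
  have X: "X \<in> carrier_mat p r" unfolding X_def rec0(1)[symmetric] by (rule mult_carrier_mat[OF L_carrier(4) K0i])
  have XK0: "X * LK s (G 0) = LW (G 0)"
    unfolding X_def rec0(1)[symmetric]
    by (simp only: assoc_mult_mat[OF L_carrier(4) K0i L_carrier(3)] minv(3)[OF L_carrier(3) dK0] right_mult_one_mat[OF L_carrier(4)])
  have XY0: "X * LY (G 0) = G 0 s"
    unfolding X_def rec0(1)[symmetric] G0[OF s] rec0(3)[symmetric]
    by (rule assoc_mult_mat[OF L_carrier(4) K0i L_carrier(5)])
  have car: "G h z \<in> carrier_mat p m" if "\<bar>h\<bar> < \<epsilon>" "Re z > 0" for h z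
  proof -
    note h = that
    obtain A B C where ABC: "realization p m r A B C" "hurwitz A" "\<forall>s. Re s > 0 \<longrightarrow> G h s = transfer A B C s"
      using Gh[OF h(1)] by blast
    then have r: "A \<in> carrier_mat r r" "B \<in> carrier_mat r m" "C \<in> carrier_mat p r" by (auto simp: realization_def)
    have "\<not> eigenvalue A z" using ABC(2) h(2) by (auto simp: hurwitz_def)
    then have "G h z = C * resolvent A z * B" using ABC(3) h(2) transfer_eq_resolvent[OF r(1)] by simp
    then show ?thesis using mult_carrier_mat[OF mult_carrier_mat[OF r(3) resolvent_carrier[OF r(1)]] r(2)] by simp
  qed
  define q where "q h z = complex_of_real (1 / h) \<cdot>\<^sub>m (G h z - G 0 z)" for h z
  have near: "\<forall>\<^sub>F h in at 0. \<bar>h\<bar> < \<epsilon> \<and> h \<noteq> 0"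
    using \<epsilon> by (auto simp: eventually_at intro!: exI[of _ \<epsilon>])
  \<comment> \<open>Continuity at 0 comes from multiplying the convergent difference quotient by
    \<open>h\<close>.\<close>
  have cont: "((\<lambda>h. G h z $$ (j, l)) \<longlongrightarrow> G 0 z $$ (j, l)) (at 0)" if z: "Re z > 0" and jl: "j < p" "l < m" for z j l
  proof -
    have "((\<lambda>h. complex_of_real h * (complex_of_real (1 / h) \<cdot>\<^sub>m (G h z - G 0 z)) $$ (j, l) + G 0 z $$ (j, l))
        \<longlongrightarrow> complex_of_real 0 * D z $$ (j, l) + G 0 z $$ (j, l)) (at 0)"
      by (intro tendsto_add tendsto_mult tendsto_of_real tendsto_ident_at tendsto_const lim[OF z jl])
    then have "((\<lambda>h. complex_of_real h * (complex_of_real (1 / h) \<cdot>\<^sub>m (G h z - G 0 z)) $$ (j, l) + G 0 z $$ (j, l))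
        \<longlongrightarrow> G 0 z $$ (j, l)) (at 0)" by simp
    then show ?thesis
    proof (rule Lim_transform_eventually)
      show "\<forall>\<^sub>F h in at 0. complex_of_real h * (complex_of_real (1 / h) \<cdot>\<^sub>m (G h z - G 0 z)) $$ (j, l) + G 0 z $$ (j, l) = G h z $$ (j, l)"
        using near
      proof eventually_elim
        case (elim h)
        then show ?case using carrier_matD[OF car[of 0 z]] carrier_matD[OF car[of h z]] \<epsilon> z jl by simp
      qed
    qed
  qed
  have limK: "mat_lim r r (\<lambda>h. LK s (G h)) (LK s (G 0)) (at 0)"
    and limY: "mat_lim r m (\<lambda>h. LY (G h)) (LY (G 0)) (at 0)"
    by (rule L_tendsto; intro cont mu nu; assumption)+
  have limq: "mat_lim r r (\<lambda>h. LK s (q h)) (LK s D) (at 0)" "mat_lim p r (\<lambda>h. LW (q h)) (LW D) (at 0)"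
    "mat_lim r m (\<lambda>h. LY (q h)) (LY D) (at 0)"
    unfolding q_def by (rule L_tendsto; intro lim mu nu; assumption)+
  have Z0: "minv (LK s (G 0)) * LY (G 0) = minv (LR ?A B0) * resolvent ?A s * B0" by (rule rec0(2))
  have limZ: "mat_lim r m (\<lambda>h. minv (LK s (G h)) * LY (G h)) (minv (LR ?A B0) * resolvent ?A s * B0) (at 0)"
    unfolding Z0[symmetric] by (rule mat_lim_mult[OF mat_lim_minv[OF limK dK0] limY])
  have limR: "mat_lim p m (\<lambda>h. X * LY (q h) + (LW (q h) - X * LK s (q h)) * (minv (LK s (G h)) * LY (G h)))
     (X * LY D + (LW D - X * LK s D) * (minv (LR ?A B0) * resolvent ?A s * B0)) (at 0)"
    by (intro mat_lim_add mat_lim_mult[OF mat_lim_const[OF X] limq(3)] mat_lim_mult[OF _ limZ]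
        mat_lim_diff limq(2) mat_lim_mult[OF mat_lim_const[OF X] limq(1)])
  \<comment> \<open>The pencil stays invertible for small \<open>h\<close>, so the reconstruction
    applies to the moving point as well.\<close>
  have evd: "\<forall>\<^sub>F h in at 0. Determinant.det (LK s (G h)) \<noteq> 0"
    by (rule tendsto_imp_eventually_ne[OF mat_lim_det[OF limK] dK0])
  have "\<forall>\<^sub>F h in at 0. q h s = X * LY (q h) + (LW (q h) - X * LK s (q h)) * (minv (LK s (G h)) * LY (G h))"
    using near evd
  proof eventually_elim
    case (elim h)
    obtain A B C where ABC: "realization p m r A B C" "hurwitz A" "\<forall>s. Re s > 0 \<longrightarrow> G h s = transfer A B C s"
      using Gh elim by blast
    then have r: "A \<in> carrier_mat r r" by (auto simp: realization_def)
    have evh: "\<not> eigenvalue A z" if "Re z > 0" for z using ABC(2) that by (auto simp: hurwitz_def)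
    have Ghz: "G h z = C * resolvent A z * B" if "Re z > 0" for z
      using ABC(3) that transfer_eq_resolvent[OF r evh[OF that]] by simp
    let ?Z = "minv (LK s (G h)) * LY (G h)"
    have rech: "LW (G h) * ?Z = C * resolvent A s * B"
      by (rule loewner_recover(3)[OF ABC(1) evh[OF mu(2)] evh[OF nu(2)] mn Ghz[OF mu(2)] Ghz[OF nu(2)] evh[OF s] elim(2)])
    have Ki: "minv (LK s (G h)) \<in> carrier_mat r r" by (rule minv_carrier[OF L_carrier(3)])
    have KZ: "LK s (G h) * ?Z = LY (G h)"
      by (simp only: assoc_mult_mat[OF L_carrier(3) Ki L_carrier(5), symmetric] minv(2)[OF L_carrier(3) elim(2)] left_mult_one_mat[OF L_carrier(5)])
    have c0: "\<bar>0::real\<bar> < \<epsilon>" using \<epsilon> by simp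
    have ch: "\<bar>h\<bar> < \<epsilon>" using elim by simp
    have lin: "LK s (q h) = complex_of_real (1 / h) \<cdot>\<^sub>m (LK s (G h) - LK s (G 0))"
      "LW (q h) = complex_of_real (1 / h) \<cdot>\<^sub>m (LW (G h) - LW (G 0))"
      "LY (q h) = complex_of_real (1 / h) \<cdot>\<^sub>m (LY (G h) - LY (G 0))"
      unfolding q_def[abs_def]
      by (rule L_linear[OF car[OF ch mu(2)] car[OF c0 mu(2)] car[OF ch nu(2)] car[OF c0 nu(2)]]; assumption)+
    have "q h s = complex_of_real (1 / h) \<cdot>\<^sub>m (LW (G h) * ?Z - X * LY (G 0))"
      unfolding q_def rech XY0 by (simp only: Ghz[OF s])
    also have "\<dots> = X * LY (q h) + (LW (q h) - X * LK s (q h)) * ?Z"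
      unfolding lin
      by (rule difference_quotient[OF L_carrier(4) L_carrier(4) X L_carrier(3) L_carrier(3) L_carrier(5) L_carrier(5)
           mult_carrier_mat[OF Ki L_carrier(5)] XK0 KZ])
    finally show ?case .
  qed
  from mat_lim_unique[OF limR _ jl _ this, of "D s $$ (j, l)"] lim[OF s jl]
  show "D s $$ (j, l) = ((C0 * resolvent ?A s * minv (LO ?A C0)) * LY D +
      (LW D - (C0 * resolvent ?A s * minv (LO ?A C0)) * LK s D) * (minv (LR ?A B0) * resolvent ?A s * B0)) $$ (j, l)"
    by (simp add: q_def X_def del: index_add_mat index_mult_mat)
qed

text \<open>In the tangent formula only the diagonal resolvents and \<open>LK\<close> depend on
  \<open>s\<close>, the latter affinely. All other factors are constant matrices and supply the
  coefficients.\<close>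

lemma tangent_explicit:
  assumes B0: "B0 \<in> carrier_mat r m" and C0: "C0 \<in> carrier_mat p r"
    and lam: "inj_on lam {..<r}" "\<And>k. k < r \<Longrightarrow> Re (lam k) < 0"
    and mu: "inj_on mu {..<r}" "\<And>k. k < r \<Longrightarrow> Re (mu k) > 0"
    and nu: "inj_on nu {..<r}" "\<And>k. k < r \<Longrightarrow> Re (nu k) > 0"
    and mn: "\<And>i j. i < r \<Longrightarrow> j < r \<Longrightarrow> mu i \<noteq> nu j"
    and uC: "\<And>k. k < r \<Longrightarrow> (U * C0) $$ (0, k) \<noteq> 0" and Bv: "\<And>k. k < r \<Longrightarrow> (B0 * V) $$ (k, 0) \<noteq> 0"
    and G0: "\<And>s. Re s > 0 \<Longrightarrow> G 0 s = C0 * resolvent (mat_diag r lam) s * B0"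
    and \<epsilon>: "\<epsilon> > 0"
    and Gh: "\<And>h. \<bar>h\<bar> < \<epsilon> \<Longrightarrow> \<exists>A B C. realization p m r A B C \<and> hurwitz A \<and> (\<forall>s. Re s > 0 \<longrightarrow> G h s = transfer A B C s)"
    and lim: "\<And>s j l. Re s > 0 \<Longrightarrow> j < p \<Longrightarrow> l < m \<Longrightarrow>
      ((\<lambda>h. (complex_of_real (1 / h) \<cdot>\<^sub>m (G h s - G 0 s)) $$ (j, l)) \<longlongrightarrow> D s $$ (j, l)) (at 0)"
  obtains al be k0 k1 :: "nat \<Rightarrow> nat \<Rightarrow> complex" where
    "\<And>s j l. Re s > 0 \<Longrightarrow> j < p \<Longrightarrow> l < m \<Longrightarrow> D s $$ (j, l) =
       (\<Sum>k<r. C0 $$ (j, k) * be k l * (1 / (s - lam k))) + (\<Sum>k<r. al j k * B0 $$ (k, l) * (1 / (s - lam k)))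
       - (\<Sum>k<r. \<Sum>n<r. C0 $$ (j, k) * B0 $$ (n, l) * ((k0 k n + k1 k n * s) / ((s - lam k) * (s - lam n))))"
proof -
  let ?A = "mat_diag r lam"
  define Oi where "Oi = minv (LO ?A C0)"
  define Ri where "Ri = minv (LR ?A B0)"
  have Oi: "Oi \<in> carrier_mat r r" and Ri: "Ri \<in> carrier_mat r r"
    unfolding Oi_def Ri_def by (intro minv_carrier L_carrier)+
  define be where "be k l = (Oi * LY D) $$ (k, l)" for k l
  define al where "al j k = (LW D * Ri) $$ (j, k)" for j k
  \<comment> \<open>The split of the pencil formed from \<open>D\<close>: its \<open>(i, j)\<close>
    entry is \<open>P0 i j + s * P1 i j\<close>. Multiplication by the constant inverses on both
    sides gives \<open>k0\<close> and \<open>k1\<close>.\<close>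
  define P1 where "P1 i j = (gval D (mu i) - gval D (nu j)) / (nu j - mu i)" for i j
  define P0 where "P0 i j = gval D (nu j) - mu i * P1 i j" for i j
  define k0 where "k0 k n = (\<Sum>j<r. (\<Sum>i<r. Oi $$ (k, i) * P0 i j) * Ri $$ (j, n))" for k n
  define k1 where "k1 k n = (\<Sum>j<r. (\<Sum>i<r. Oi $$ (k, i) * P1 i j) * Ri $$ (j, n))" for k n
  have "D s $$ (j, l) =
       (\<Sum>k<r. C0 $$ (j, k) * be k l * (1 / (s - lam k))) + (\<Sum>k<r. al j k * B0 $$ (k, l) * (1 / (s - lam k)))
       - (\<Sum>k<r. \<Sum>n<r. C0 $$ (j, k) * B0 $$ (n, l) * ((k0 k n + k1 k n * s) / ((s - lam k) * (s - lam n))))"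
    if s: "Re s > 0" and j: "j < p" and l: "l < m" for s j l
  proof -
    define f where "f k = 1 / (s - lam k)" for k
    have ne: "s \<noteq> lam k" if "k < r" for k using lam(2)[OF that] s by auto
    have R: "resolvent ?A s = mat_diag r f" unfolding f_def by (rule resolvent_mat_diag(1)) (use ne in auto)
    define N where "N = C0 * mat_diag r f"
    define M where "M = mat_diag r f * B0"
    define K where "K = Oi * LK s D * Ri"
    have N: "N \<in> carrier_mat p r" and M: "M \<in> carrier_mat r m"
      unfolding N_def M_def by (rule mult_carrier_mat[OF C0 mat_diag_dim], rule mult_carrier_mat[OF mat_diag_dim B0])
    have OLK: "Oi * LK s D \<in> carrier_mat r r" by (rule mult_carrier_mat[OF Oi L_carrier(3)])
    have K: "K \<in> carrier_mat r r" unfolding K_def by (rule mult_carrier_mat[OF OLK Ri])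
    have OLY: "Oi * LY D \<in> carrier_mat r m" by (rule mult_carrier_mat[OF Oi L_carrier(5)])
    have LWR: "LW D * Ri \<in> carrier_mat p r" by (rule mult_carrier_mat[OF L_carrier(4) Ri])
    have Ni: "N $$ (j, k) = C0 $$ (j, k) * f k" if "k < r" for k
      unfolding N_def mat_diag_mult_right[OF C0] using j that by simp
    have Mi: "M $$ (k, l) = f k * B0 $$ (k, l)" if "k < r" for k
      unfolding M_def mat_diag_mult_left[OF B0] using l that by simp
    have NO: "N * Oi \<in> carrier_mat p r" by (rule mult_carrier_mat[OF N Oi])
    have RM: "Ri * M \<in> carrier_mat r m" by (rule mult_carrier_mat[OF Ri M])
    have NOK: "N * Oi * LK s D \<in> carrier_mat p r" by (rule mult_carrier_mat[OF NO L_carrier(3)])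
    have NK: "N * K \<in> carrier_mat p r" by (rule mult_carrier_mat[OF N K])
    have t1: "N * Oi * LY D = N * (Oi * LY D)" by (rule assoc_mult_mat[OF N Oi L_carrier(5)])
    have t2: "LW D * (Ri * M) = LW D * Ri * M" by (rule assoc_mult_mat[OF L_carrier(4) Ri M, symmetric])
    have t3: "N * Oi * LK s D * (Ri * M) = N * K * M"
    proof -
      have "N * Oi * LK s D * (Ri * M) = N * (Oi * LK s D) * (Ri * M)"
        by (simp only: assoc_mult_mat[OF N Oi L_carrier(3)])
      also have "\<dots> = N * (Oi * LK s D) * Ri * M"
        by (rule assoc_mult_mat[OF mult_carrier_mat[OF N OLK] Ri M, symmetric])
      also have "\<dots> = N * K * M" by (simp only: K_def assoc_mult_mat[OF N OLK Ri])
      finally show ?thesis .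
    qed
    have Ki: "K $$ (k, n) = k0 k n + k1 k n * s" if kn: "k < r" "n < r" for k n
    proof -
      have "K $$ (k, n) = (\<Sum>j<r. (\<Sum>i<r. Oi $$ (k, i) * LK s D $$ (i, j)) * Ri $$ (j, n))"
        unfolding K_def mult_mat_index[OF OLK Ri kn]
        by (intro sum.cong refl) (simp only: mult_mat_index[OF Oi L_carrier(3) kn(1)] lessThan_iff)
      also have "\<dots> = (\<Sum>j<r. (\<Sum>i<r. Oi $$ (k, i) * (P0 i j + s * P1 i j)) * Ri $$ (j, n))"
        by (intro sum.cong refl arg_cong2[where f="(*)"]) (simp add: LK_def P0_def P1_def left_diff_distrib diff_divide_distrib)
      also have "\<dots> = (\<Sum>j<r. (\<Sum>i<r. Oi $$ (k, i) * P0 i j) * Ri $$ (j, n) + s * ((\<Sum>i<r. Oi $$ (k, i) * P1 i j) * Ri $$ (j, n)))"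
        by (intro sum.cong refl) (simp add: distrib_left distrib_right sum.distrib sum_distrib_left sum_distrib_right mult_ac)
      also have "\<dots> = k0 k n + k1 k n * s"
        by (simp add: k0_def k1_def sum.distrib sum_distrib_left[symmetric] mult.commute)
      finally show ?thesis .
    qed
    have form: "D s $$ (j, l) = ((C0 * resolvent ?A s * minv (LO ?A C0)) * LY D +
      (LW D - (C0 * resolvent ?A s * minv (LO ?A C0)) * LK s D) *
      (minv (LR ?A B0) * resolvent ?A s * B0)) $$ (j, l)"
      by (rule tangent_formula[OF B0 C0 lam mu nu mn uC Bv G0 \<epsilon> Gh lim s j l])
    have "minv (LR ?A B0) * resolvent ?A s * B0 = Ri * M"
      unfolding R Ri_def[symmetric] M_def by (rule assoc_mult_mat[OF Ri mat_diag_dim B0])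
    then have "D s $$ (j, l) = (N * Oi * LY D + (LW D - N * Oi * LK s D) * (Ri * M)) $$ (j, l)"
      using form unfolding R Oi_def[symmetric] N_def[symmetric] by (simp only:)
    also have "\<dots> = (N * (Oi * LY D) + (LW D * Ri * M - N * K * M)) $$ (j, l)"
      by (simp only: minus_mult_distrib_mat[OF L_carrier(4) NOK RM] t1 t2 t3)
    also have "\<dots> = (N * (Oi * LY D)) $$ (j, l) + ((LW D * Ri * M) $$ (j, l) - (N * K * M) $$ (j, l))"
      using carrier_matD[OF N] carrier_matD[OF M] carrier_matD[OF NK] carrier_matD[OF LWR] j l
      by (simp del: index_mult_mat(1))
    also have "(N * (Oi * LY D)) $$ (j, l) = (\<Sum>k<r. C0 $$ (j, k) * be k l * (1 / (s - lam k)))"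
      unfolding mult_mat_index[OF N OLY j l] be_def[symmetric]
      by (intro sum.cong refl) (simp add: Ni f_def)
    also have "(LW D * Ri * M) $$ (j, l) = (\<Sum>k<r. al j k * B0 $$ (k, l) * (1 / (s - lam k)))"
      unfolding mult_mat_index[OF LWR M j l] al_def[symmetric]
      by (intro sum.cong refl) (simp add: Mi f_def)
    also have "(N * K * M) $$ (j, l) = (\<Sum>n<r. (\<Sum>k<r. N $$ (j, k) * K $$ (k, n)) * M $$ (n, l))"
      unfolding mult_mat_index[OF NK M j l]
      by (intro sum.cong refl) (simp only: mult_mat_index[OF N K j] lessThan_iff)
    also have "\<dots> = (\<Sum>n<r. \<Sum>k<r. C0 $$ (j, k) * B0 $$ (n, l) * ((k0 k n + k1 k n * s) / ((s - lam k) * (s - lam n))))"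
      unfolding sum_distrib_right
      by (intro sum.cong refl) (simp add: Ni Mi Ki f_def)
    also have "\<dots> = (\<Sum>k<r. \<Sum>n<r. C0 $$ (j, k) * B0 $$ (n, l) * ((k0 k n + k1 k n * s) / ((s - lam k) * (s - lam n))))"
      by (rule sum.swap)
    finally show ?thesis by simp
  qed
  then show thesis by (rule that)
qed

end

section \<open>Poles and residues of a minimal realization\<close>

lemma diag_realization_index:
  assumes C: "C \<in> carrier_mat p q" and B: "B \<in> carrier_mat q m" and s: "\<And>k. k < q \<Longrightarrow> s \<noteq> lam k"
    and jl: "j < p" "l < m"
  shows "(C * resolvent (mat_diag q lam) s * B) $$ (j, l) = (\<Sum>k<q. C $$ (j, k) * B $$ (k, l) / (s - lam k))"
proof -
  have R: "resolvent (mat_diag q lam) s = mat_diag q (\<lambda>k. 1 / (s - lam k))"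
    by (rule resolvent_mat_diag(1)[OF s])
  have CR: "C * mat_diag q (\<lambda>k. 1 / (s - lam k)) \<in> carrier_mat p q" by (rule mult_carrier_mat[OF C mat_diag_dim])
  show ?thesis
    unfolding R mult_mat_index[OF CR B jl] unfolding mat_diag_mult_right[OF C]
    using jl by (intro sum.cong refl) simp
qed

lemma mat_diag_not_eigenvalue:
  fixes lam :: "nat \<Rightarrow> complex"
  assumes "\<not> eigenvalue (mat_diag q lam) z" "i < q"
  shows "z \<noteq> lam i"
proof
  assume "z = lam i"
  have A: "mat_diag q lam \<in> carrier_mat q q" by simp
  have S: "z \<cdot>\<^sub>m 1\<^sub>m q - mat_diag q lam = mat_diag q (\<lambda>k. z - lam k)"
    by (rule eq_matI) (auto simp: mat_diag_def)
  note R = resolvent[OF A assms(1)]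
  have "(mat_diag q (\<lambda>k. z - lam k) * resolvent (mat_diag q lam) z) $$ (i, i) = (1\<^sub>m q) $$ (i, i)"
    using R(2) unfolding S by simp
  then show False
    unfolding mat_diag_mult_left[OF R(1)] using assms(2) \<open>z = lam i\<close> by simp
qed

lemma finite_eigenvalues:
  fixes A :: "complex mat"
  assumes A: "A \<in> carrier_mat n n"
  shows "finite {s. eigenvalue A s}"
proof -
  have "char_poly A \<noteq> 0" using degree_monic_char_poly[OF A] by auto
  then have "finite {s. poly (char_poly A) s = 0}" by (rule poly_roots_finite)
  then show ?thesis by (simp add: eigenvalue_root_char_poly[OF A])
qed

lemma transfer_holomorphic:
  assumes ABC: "realization p m r A B C" and jl: "j < p" "l < m"
    and S: "\<And>s. s \<in> S \<Longrightarrow> \<not> eigenvalue A s"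
  shows "(\<lambda>s. transfer A B C s $$ (j, l)) holomorphic_on S"
proof -
  have A: "A \<in> carrier_mat r r" and B: "B \<in> carrier_mat r m" and C: "C \<in> carrier_mat p r"
    using ABC by (auto simp: realization_def)
  have R: "resolvent A s \<in> carrier_mat r r" for s by (rule resolvent_carrier[OF A])
  have Rd: "resolvent A s = minv (s \<cdot>\<^sub>m 1\<^sub>m r - A)" for s using A by (simp add: resolvent_def)
  have "(\<lambda>s. \<Sum>k<r. (\<Sum>n<r. C $$ (j, n) * resolvent A s $$ (n, k)) * B $$ (k, l)) holomorphic_on S"
  proof (intro holomorphic_on_sum holomorphic_on_mult holomorphic_on_const)
    fix k n assume kn: "k \<in> {..<r}" "n \<in> {..<r}"
    show "(\<lambda>s. resolvent A s $$ (n, k)) holomorphic_on S"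
      unfolding Rd
    proof (rule holomorphic_on_minv)
      show "s \<cdot>\<^sub>m 1\<^sub>m r - A \<in> carrier_mat r r" for s by (rule shift_carrier[OF A])
      show "(\<lambda>s. (s \<cdot>\<^sub>m 1\<^sub>m r - A) $$ (i, j)) holomorphic_on S" if "i < r" "j < r" for i j
        using that A by (auto intro!: holomorphic_intros)
      show "Determinant.det (s \<cdot>\<^sub>m 1\<^sub>m r - A) \<noteq> 0" if "s \<in> S" for s
        using det_shift_eigenvalue[OF A, of s] S[OF that] by simp
    qed (use kn in auto)
  qed
  then show ?thesis
  proof (rule holomorphic_transform)
    fix s assume "s \<in> S"
    have CR: "C * resolvent A s \<in> carrier_mat p r" by (rule mult_carrier_mat[OF C R])
    show "(\<Sum>k<r. (\<Sum>n<r. C $$ (j, n) * resolvent A s $$ (n, k)) * B $$ (k, l)) = transfer A B C s $$ (j, l)"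
      unfolding transfer_eq_resolvent[OF A S[OF \<open>s \<in> S\<close>]] mult_mat_index[OF CR B jl]
      by (intro sum.cong refl) (simp only: mult_mat_index[OF C R jl(1)] lessThan_iff)
  qed
qed

text \<open>Both sides are holomorphic off a finite set, whose complement is connected, so the
  identity theorem extends the equation from a half-plane. Minimality compares transfer functions at
  all such points.\<close>

lemma partial_fractions_continuation:
  assumes ABC: "realization p m r A B C" and hur: "hurwitz A" and jl: "j < p" "l < m" and I: "finite I"
    and eq: "\<And>s. Re s > 0 \<Longrightarrow> transfer A B C s $$ (j, l) = (\<Sum>i\<in>I. rho i / (s - lam i))"
    and s: "\<not> eigenvalue A s" "s \<notin> lam ` I"
  shows "transfer A B C s $$ (j, l) = (\<Sum>i\<in>I. rho i / (s - lam i))"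
proof -
  have A: "A \<in> carrier_mat r r" using ABC by (auto simp: realization_def)
  define F where "F = {s. eigenvalue A s} \<union> lam ` I"
  have F: "finite F" using finite_eigenvalues[OF A] I by (simp add: F_def)
  \<comment> \<open>The numbers \<open>lam i\<close> are not yet known to be stable; the half-plane
    \<open>Re s > M\<close> avoids all of them.\<close>
  define M where "M = (\<Sum>i\<in>I. cmod (lam i))"
  have M: "Re (lam i) \<le> M" if "i \<in> I" for i
  proof -
    have "Re (lam i) \<le> cmod (lam i)" by (rule complex_Re_le_cmod)
    also have "\<dots> \<le> M" unfolding M_def using that I by (intro member_le_sum) auto
    finally show ?thesis .
  qed
  have M0: "M \<ge> 0" unfolding M_def by (simp add: sum_nonneg)
  show ?thesis
  proof (rule analytic_continuation_open[where s="{s. Re s > M}" and s'="UNIV - F" and z=s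
        and f="\<lambda>s. transfer A B C s $$ (j, l)" and g="\<lambda>s. \<Sum>i\<in>I. rho i / (s - lam i)"])
    show "open {s. M < Re s}" by (rule open_halfspace_Re_gt)
    show "open (UNIV - F)" using F by (simp add: open_Diff finite_imp_closed)
    have "complex_of_real (M + 1) \<in> {s. M < Re s}" by simp
    then show "{s. M < Re s} \<noteq> {}" by blast
    show "connected (UNIV - F)" by (rule connected_open_delete_finite) (use F in auto)
    show "{s. M < Re s} \<subseteq> UNIV - F"
    proof
      fix s assume "s \<in> {s. M < Re s}"
      then have s: "M < Re s" by simp
      have "s \<notin> F"
      proof
        assume "s \<in> F"
        then consider "eigenvalue A s" | i where "i \<in> I" "s = lam i" by (auto simp: F_def)
        then show False
        proof cases
          case 1 then have "Re s < 0" using hur by (simp add: hurwitz_def)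
          then show False using s M0 by simp
        next
          case 2 then show False using M[of i] s by simp
        qed
      qed
      then show "s \<in> UNIV - F" by simp
    qed
    show "(\<lambda>s. transfer A B C s $$ (j, l)) holomorphic_on UNIV - F"
      by (rule transfer_holomorphic[OF ABC jl]) (auto simp: F_def)
    show "(\<lambda>s. \<Sum>i\<in>I. rho i / (s - lam i)) holomorphic_on UNIV - F"
      by (intro holomorphic_intros) (auto simp: F_def)
    show "transfer A B C s $$ (j, l) = (\<Sum>i\<in>I. rho i / (s - lam i))" if "s \<in> {s. M < Re s}" for s
      using that M0 by (intro eq) simp
    show "s \<in> UNIV - F" using s by (simp add: F_def)
  qed
qed

text \<open>A vanishing residue could be dropped, and the remaining terms would form a diagonal
  realization of order \<open>r - 1\<close> with the same transfer function.\<close>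

lemma minimal_realization_residue_nonzero:
  assumes min: "minimal_realization p m r A B C" and hur: "hurwitz A"
    and bc: "\<And>i. i < r \<Longrightarrow> b i \<in> carrier_mat m 1" "\<And>i. i < r \<Longrightarrow> c i \<in> carrier_mat p 1"
    and eq: "\<And>s j l. Re s > 0 \<Longrightarrow> j < p \<Longrightarrow> l < m \<Longrightarrow>
      transfer A B C s $$ (j, l) = (\<Sum>i<r. c i $$ (j, 0) * cnj (b i $$ (l, 0)) / (s - lam i))"
    and k: "k < r"
  shows "\<exists>j<p. \<exists>l<m. c k $$ (j, 0) * cnj (b k $$ (l, 0)) \<noteq> 0"
proof (rule ccontr)
  assume "\<not> ?thesis"
  then have zero: "c k $$ (j, 0) * cnj (b k $$ (l, 0)) = 0" if "j < p" "l < m" for j l using that by blast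
  have ABC: "realization p m r A B C" using min by (simp add: minimal_realization_def)
  then have A: "A \<in> carrier_mat r r" and B: "B \<in> carrier_mat r m" and C: "C \<in> carrier_mat p r"
    by (auto simp: realization_def)
  define I where "I = {..<r} - {k}"
  have bij: "bij_betw (\<lambda>i. if i < k then i else Suc i) {..<r - 1} I"
    unfolding bij_betw_def
  proof
    show "inj_on (\<lambda>i. if i < k then i else Suc i) {..<r - 1}" by (auto simp: inj_on_def split: if_splits)
    show "(\<lambda>i. if i < k then i else Suc i) ` {..<r - 1} = I"
    proof
      show "(\<lambda>i. if i < k then i else Suc i) ` {..<r - 1} \<subseteq> I" using k by (auto simp: I_def)
      show "I \<subseteq> (\<lambda>i. if i < k then i else Suc i) ` {..<r - 1}"
      proof
        fix x assume x: "x \<in> I"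
        show "x \<in> (\<lambda>i. if i < k then i else Suc i) ` {..<r - 1}"
        proof (cases "x < k")
          case True then show ?thesis using x k by (intro image_eqI[of _ _ x]) (auto simp: I_def)
        next
          case False then show ?thesis using x k by (intro image_eqI[of _ _ "x - 1"]) (auto simp: I_def)
        qed
      qed
    qed
  qed
  \<comment> \<open>Enumerates the indices below \<open>r\<close> other than
    \<open>k\<close>.\<close>
  define \<iota> where "\<iota> i = (if i < k then i else Suc i)" for i
  have bij: "bij_betw \<iota> {..<r - 1} I" using bij unfolding \<iota>_def .
  define A' where "A' = mat_diag (r - 1) (\<lambda>i. lam (\<iota> i))"
  define B' where "B' = Matrix.mat (r - 1) m (\<lambda>(i, l). cnj (b (\<iota> i) $$ (l, 0)))"
  define C' where "C' = Matrix.mat p (r - 1) (\<lambda>(j, i). c (\<iota> i) $$ (j, 0))"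
  have A': "A' \<in> carrier_mat (r - 1) (r - 1)" and B': "B' \<in> carrier_mat (r - 1) m" and C': "C' \<in> carrier_mat p (r - 1)"
    by (simp_all add: A'_def B'_def C'_def)
  have "transfer A B C s = transfer A' B' C' s" if s: "\<not> eigenvalue A s" "\<not> eigenvalue A' s" for s
  proof -
    have T: "transfer A B C s \<in> carrier_mat p m"
      unfolding transfer_eq_resolvent[OF A s(1)]
      by (rule mult_carrier_mat[OF mult_carrier_mat[OF C resolvent_carrier[OF A]] B])
    have T': "transfer A' B' C' s = C' * resolvent A' s * B'" by (rule transfer_eq_resolvent[OF A' s(2)])
    have T'c: "transfer A' B' C' s \<in> carrier_mat p m"
      unfolding T' by (rule mult_carrier_mat[OF mult_carrier_mat[OF C' resolvent_carrier[OF A']] B'])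
    have ne: "s \<noteq> lam (\<iota> i)" if "i < r - 1" for i
      using mat_diag_not_eigenvalue[of "r - 1" "\<lambda>i. lam (\<iota> i)" s i] s(2) that by (simp add: A'_def)
    then have nI: "s \<notin> lam ` I" using bij_betw_imp_surj_on[OF bij] by auto
    show ?thesis
    proof (rule eq_matI)
      fix j l assume "j < dim_row (transfer A' B' C' s)" "l < dim_col (transfer A' B' C' s)"
      then have jl: "j < p" "l < m" using carrier_matD[OF T'c] by simp_all
      have "transfer A B C s $$ (j, l) = (\<Sum>i\<in>I. c i $$ (j, 0) * cnj (b i $$ (l, 0)) / (s - lam i))"
      proof (rule partial_fractions_continuation[OF ABC hur jl _ _ s(1) nI])
        show "finite I" by (simp add: I_def)
        fix s :: complex assume "Re s > 0"
        then have "transfer A B C s $$ (j, l) = (\<Sum>i<r. c i $$ (j, 0) * cnj (b i $$ (l, 0)) / (s - lam i))"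
          by (rule eq[OF _ jl])
        also have "\<dots> = (\<Sum>i\<in>I. c i $$ (j, 0) * cnj (b i $$ (l, 0)) / (s - lam i))"
          by (rule sum.mono_neutral_right) (use zero[OF jl] in \<open>auto simp: I_def\<close>)
        finally show "transfer A B C s $$ (j, l) = (\<Sum>i\<in>I. c i $$ (j, 0) * cnj (b i $$ (l, 0)) / (s - lam i))" .
      qed
      also have "\<dots> = (\<Sum>i<r - 1. c (\<iota> i) $$ (j, 0) * cnj (b (\<iota> i) $$ (l, 0)) / (s - lam (\<iota> i)))"
        by (rule sum.reindex_bij_betw[OF bij, symmetric])
      also have "\<dots> = (\<Sum>i<r - 1. C' $$ (j, i) * B' $$ (i, l) / (s - lam (\<iota> i)))"
        using jl by (intro sum.cong refl) (simp add: C'_def B'_def)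
      also have "\<dots> = transfer A' B' C' s $$ (j, l)"
        unfolding T' by (simp only: A'_def diag_realization_index[OF C' B' ne jl])
      finally show "transfer A B C s $$ (j, l) = transfer A' B' C' s $$ (j, l)" .
    qed (use carrier_matD[OF T] carrier_matD[OF T'c] in simp_all)
  qed
  then have "r \<le> r - 1"
    using min A' B' C' unfolding minimal_realization_def realization_def by blast
  then show False using k by simp
qed

text \<open>Off the spectrum the transfer function is continuous, so \<open>(s - lam k)\<close>
  times it tends to 0 at \<open>lam k\<close>; by the partial fractions it tends to
  \<open>rho k\<close>. Distinctness of the poles prevents cancellation.\<close>

lemma pole_is_eigenvalue:
  assumes ABC: "realization p m r A B C" and hur: "hurwitz A" and jl: "j < p" "l < m"
    and eq: "\<And>s. Re s > 0 \<Longrightarrow> transfer A B C s $$ (j, l) = (\<Sum>i<r. rho i / (s - lam i))"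
    and lam: "inj_on lam {..<r}" and k: "k < r" and nz: "rho k \<noteq> 0"
  shows "eigenvalue A (lam k)"
proof (rule ccontr)
  assume ne: "\<not> eigenvalue A (lam k)"
  have A: "A \<in> carrier_mat r r" using ABC by (auto simp: realization_def)
  define T where "T s = transfer A B C s $$ (j, l)" for s
  define E where "E = {s. eigenvalue A s}"
  have E: "finite E" using finite_eigenvalues[OF A] by (simp add: E_def)
  have oE: "open (- E)" by (rule open_Compl[OF finite_imp_closed[OF E]])
  have "T holomorphic_on - E" unfolding T_def by (rule transfer_holomorphic[OF ABC jl]) (simp add: E_def)
  then have "continuous_on (- E) T" by (rule holomorphic_on_imp_continuous_on)
  then have "isCont T (lam k)" using oE ne by (simp add: continuous_on_eq_continuous_at E_def)
  then have T: "(T \<longlongrightarrow> T (lam k)) (at (lam k))" by (simp add: isCont_def)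
  have l1: "((\<lambda>s. (s - lam k) * T s) \<longlongrightarrow> 0) (at (lam k))"
    by (rule tendsto_eq_intros T refl | simp)+
  define I where "I = {..<r} - {k}"
  define W where "W = - (E \<union> lam ` I)"
  have oW: "open W" unfolding W_def using E by (intro open_Compl finite_imp_closed) (simp add: I_def)
  have kW: "lam k \<in> W" using ne lam k by (auto simp: W_def E_def I_def inj_on_def)
  have l2: "((\<lambda>s. rho k + (s - lam k) * (\<Sum>i\<in>I. rho i / (s - lam i))) \<longlongrightarrow> rho k) (at (lam k))"
  proof -
    have "((\<lambda>s. rho k + (s - lam k) * (\<Sum>i\<in>I. rho i / (s - lam i))) \<longlongrightarrow> rho k + (lam k - lam k) * (\<Sum>i\<in>I. rho i / (lam k - lam i))) (at (lam k))"
    proof (intro tendsto_intros)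
      fix i assume "i \<in> I"
      then show "lam k - lam i \<noteq> 0" using kW by (auto simp: W_def)
    qed
    then show ?thesis by simp
  qed
  have "((\<lambda>s. (s - lam k) * T s) \<longlongrightarrow> rho k) (at (lam k))"
  proof (rule Lim_transform_eventually[OF l2])
    show "\<forall>\<^sub>F s in at (lam k). rho k + (s - lam k) * (\<Sum>i\<in>I. rho i / (s - lam i)) = (s - lam k) * T s"
      using eventually_at_in_open[OF oW kW]
    proof eventually_elim
      case (elim s)
      then have s: "s \<noteq> lam k" "\<not> eigenvalue A s" "s \<notin> lam ` {..<r}" by (auto simp: W_def E_def I_def)
      have "T s = (\<Sum>i<r. rho i / (s - lam i))"
        unfolding T_def by (rule partial_fractions_continuation[OF ABC hur jl _ eq s(2,3)]) simp_all
      also have "\<dots> = rho k / (s - lam k) + (\<Sum>i\<in>I. rho i / (s - lam i))"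
        unfolding I_def using k by (intro sum.remove) auto
      finally show ?case using s(1) by (simp add: distrib_left)
    qed
  qed
  with l1 have "rho k = 0" by (rule tendsto_unique[OF at_neq_bot, symmetric])
  with nz show False ..
qed

text \<open>With weights \<open>x^j\<close> each sum is the value at \<open>x\<close> of a nonzero
  polynomial; some \<open>x\<close> avoids the finitely many roots of all of them.\<close>

lemma generic_combination:
  fixes w :: "nat \<Rightarrow> nat \<Rightarrow> complex"
  assumes "\<And>k. k < r \<Longrightarrow> \<exists>j<p. w k j \<noteq> 0"
  obtains u where "\<And>k. k < r \<Longrightarrow> (\<Sum>j<p. u j * w k j) \<noteq> 0"
proof -
  define P where "P k = (\<Sum>j<p. monom (w k j) j)" for k
  have P: "P k \<noteq> 0" if "k < r" for k
  proof -
    note k = that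
    obtain j where j: "j < p" "w k j \<noteq> 0" using assms[OF k] by blast
    have "poly.coeff (P k) j = (\<Sum>i<p. if i = j then w k i else 0)" by (simp add: P_def coeff_sum)
    also have "\<dots> = w k j" using j by simp
    finally show ?thesis using j by auto
  qed
  have "finite (\<Union>k\<in>{..<r}. {x. poly (P k) x = 0})" using P poly_roots_finite by auto
  then obtain x where x: "x \<notin> (\<Union>k\<in>{..<r}. {x. poly (P k) x = 0})"
    using ex_new_if_finite[OF infinite_UNIV_char_0] by blast
  show thesis
  proof
    fix k assume "k < r"
    then have "poly (P k) x \<noteq> 0" using x by auto
    then show "(\<Sum>j<p. x ^ j * w k j) \<noteq> 0" by (simp add: P_def poly_sum poly_monom mult.commute)
  qed
qed

lemma hardy2_zero: "hardy2 (\<lambda>s. 0)"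
  by (rule hardy2_decay[of _ 0]) auto

lemma hardy2_sum: "(\<And>i. i \<in> I \<Longrightarrow> hardy2 (f i)) \<Longrightarrow> hardy2 (\<lambda>s. \<Sum>i\<in>I. f i s)"
  by (induction I rule: infinite_finite_induct) (auto intro: hardy2_zero hardy2_add)

section \<open>Stable transfer functions lie in the Hardy space\<close>

text \<open>From \<open>s R = 1 + A R\<close>, the sum \<open>n\<close> of the moduli in a column of
  \<open>R\<close> satisfies \<open>|s| n <= 1 + \<alpha> n\<close>, where \<alpha> is the entry sum
  of \<open>A\<close>; and \<open>\<alpha> n\<close> is at most half of
  \<open>|s| n\<close>.\<close>

lemma resolvent_entry_bound:
  fixes A :: "complex mat"
  assumes A: "A \<in> carrier_mat r r" and s: "\<not> eigenvalue A s" and ij: "i < r" "j < r"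
    and large: "cmod s \<ge> 2 * (\<Sum>i<r. \<Sum>k<r. cmod (A $$ (i, k)))" "s \<noteq> 0"
  shows "cmod (resolvent A s $$ (i, j)) \<le> 2 / cmod s"
proof -
  define R where "R = resolvent A s"
  define \<alpha> where "\<alpha> = (\<Sum>i<r. \<Sum>k<r. cmod (A $$ (i, k)))"
  define n where "n = (\<Sum>i<r. cmod (R $$ (i, j)))"
  have R: "R \<in> carrier_mat r r" unfolding R_def by (rule resolvent_carrier[OF A])
  have S: "s \<cdot>\<^sub>m 1\<^sub>m r - A \<in> carrier_mat r r" by (rule shift_carrier[OF A])
  have eq: "s * R $$ (i, j) = (if i = j then 1 else 0) + (\<Sum>k<r. A $$ (i, k) * R $$ (k, j))" if i: "i < r" for i
  proof -
    have "(if i = j then 1 else 0) = ((s \<cdot>\<^sub>m 1\<^sub>m r - A) * R) $$ (i, j)"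
      using resolvent(2)[OF A s] i ij(2) by (simp add: R_def)
    also have "\<dots> = (\<Sum>k<r. (s \<cdot>\<^sub>m 1\<^sub>m r - A) $$ (i, k) * R $$ (k, j))"
      by (rule mult_mat_index[OF S R i ij(2)])
    also have "\<dots> = (\<Sum>k<r. (if k = i then s * R $$ (i, j) else 0) - A $$ (i, k) * R $$ (k, j))"
      using A i by (intro sum.cong refl) (auto simp: left_diff_distrib)
    also have "\<dots> = s * R $$ (i, j) - (\<Sum>k<r. A $$ (i, k) * R $$ (k, j))"
      using i by (simp add: sum_subtractf)
    finally show ?thesis by (simp add: algebra_simps)
  qed
  have le_n: "cmod (R $$ (k, j)) \<le> n" if "k < r" for k
    unfolding n_def using that by (intro member_le_sum) auto
  have "cmod s * n = (\<Sum>i<r. cmod (s * R $$ (i, j)))" by (simp add: n_def sum_distrib_left norm_mult)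
  also have "\<dots> \<le> (\<Sum>i<r. (if i = j then 1 else 0) + (\<Sum>k<r. cmod (A $$ (i, k)) * n))"
  proof (rule sum_mono)
    fix i assume i: "i \<in> {..<r}"
    have "cmod (s * R $$ (i, j)) \<le> cmod (if i = j then 1 else 0) + cmod (\<Sum>k<r. A $$ (i, k) * R $$ (k, j))"
      using eq[of i] i by (simp only: lessThan_iff norm_triangle_ineq)
    also have "\<dots> \<le> (if i = j then 1 else 0) + (\<Sum>k<r. cmod (A $$ (i, k)) * n)"
    proof (intro add_mono)
      show "cmod (\<Sum>k<r. A $$ (i, k) * R $$ (k, j)) \<le> (\<Sum>k<r. cmod (A $$ (i, k)) * n)"
        by (rule order_trans[OF norm_sum sum_mono]) (auto simp: norm_mult intro!: mult_left_mono le_n)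
    qed simp
    finally show "cmod (s * R $$ (i, j)) \<le> (if i = j then 1 else 0) + (\<Sum>k<r. cmod (A $$ (i, k)) * n)" .
  qed
  also have "\<dots> = 1 + \<alpha> * n"
    using ij by (simp add: sum.distrib \<alpha>_def sum_distrib_right)
  finally have 1: "cmod s * n \<le> 1 + \<alpha> * n" .
  have n0: "n \<ge> 0" by (simp add: n_def sum_nonneg)
  have "2 * (\<alpha> * n) \<le> cmod s * n" using mult_right_mono[OF large(1) n0] by (simp add: \<alpha>_def mult.assoc)
  with 1 have "cmod s * n \<le> 2" by linarith
  then have "n \<le> 2 / cmod s" using large(2) by (simp add: pos_le_divide_eq mult.commute)
  with le_n[OF ij(1)] show ?thesis by (simp add: R_def)
qed

lemma transfer_hardy2:
  assumes ABC: "realization p m r A B C" and hur: "hurwitz A" and jl: "j < p" "l < m"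
  shows "hardy2 (\<lambda>s. transfer A B C s $$ (j, l))"
proof -
  have A: "A \<in> carrier_mat r r" and B: "B \<in> carrier_mat r m" and C: "C \<in> carrier_mat p r"
    using ABC by (auto simp: realization_def)
  have ev: "\<not> eigenvalue A s" if "Re s \<ge> 0" for s using hur that by (auto simp: hurwitz_def)
  define T where "T s = transfer A B C s $$ (j, l)" for s
  define \<alpha> where "\<alpha> = (\<Sum>i<r. \<Sum>k<r. cmod (A $$ (i, k)))"
  \<comment> \<open>Beyond this radius both \<open>|s| >= 2 \<alpha>\<close> and
    \<open>|s| >= 1\<close> hold; the second gives \<open>1 + |s| <= 2 |s|\<close>, hence the
    constant \<open>4 * q\<close> below. Within it, compactness gives a bound.\<close>
  define \<rho> where "\<rho> = 2 * \<alpha> + 1"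
  define q where "q = (\<Sum>k<r. \<Sum>n<r. cmod (C $$ (j, n)) * cmod (B $$ (k, l)))"
  have \<alpha>: "\<alpha> \<ge> 0" and q: "q \<ge> 0" by (simp_all add: \<alpha>_def q_def sum_nonneg)
  have cont: "continuous_on {s. Re s \<ge> 0} T"
  proof -
    have "finite {s. eigenvalue A s}" by (rule finite_eigenvalues[OF A])
    moreover have "T holomorphic_on - {s. eigenvalue A s}"
      unfolding T_def by (rule transfer_holomorphic[OF ABC jl]) simp
    ultimately show ?thesis
      using ev by (intro continuous_on_subset[OF holomorphic_on_imp_continuous_on]) auto
  qed
  have "compact ({s. Re s \<ge> 0} \<inter> cball 0 \<rho>)"
    by (intro closed_Int_compact closed_halfspace_Re_ge compact_cball)
  then have "bounded (T ` ({s. Re s \<ge> 0} \<inter> cball 0 \<rho>))"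
    by (intro compact_imp_bounded compact_continuous_image continuous_on_subset[OF cont]) auto
  then obtain b where b: "\<And>s. Re s \<ge> 0 \<Longrightarrow> cmod s \<le> \<rho> \<Longrightarrow> cmod (T s) \<le> b"
    by (fastforce simp: bounded_iff)
  have "cmod (T 0) \<le> b" using b[of 0] \<alpha> by (simp add: \<rho>_def)
  then have b0: "b \<ge> 0" using norm_ge_zero[of "T 0"] by linarith
  have "cmod (T s) \<le> (b * (1 + \<rho>) + 4 * q) / (1 + cmod s)" if s: "Re s > 0" for s
  proof (cases "cmod s \<le> \<rho>")
    case True
    have "cmod (T s) * (1 + cmod s) \<le> b * (1 + \<rho>)"
      using b[of s] s True b0 by (intro mult_mono) auto
    then have "cmod (T s) * (1 + cmod s) \<le> b * (1 + \<rho>) + 4 * q" using q by simp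
    then show ?thesis by (subst pos_le_divide_eq) (auto intro: add_pos_nonneg)
  next
    case False
    then have s1: "cmod s \<ge> 1" and s\<alpha>: "cmod s \<ge> 2 * \<alpha>" using \<alpha> by (simp_all add: \<rho>_def)
    then have s0: "s \<noteq> 0" by auto
    have CR: "C * resolvent A s \<in> carrier_mat p r" by (rule mult_carrier_mat[OF C resolvent_carrier[OF A]])
    have evs: "\<not> eigenvalue A s" using ev[of s] s by simp
    have T: "T s = (\<Sum>k<r. (\<Sum>n<r. C $$ (j, n) * resolvent A s $$ (n, k)) * B $$ (k, l))"
      unfolding T_def transfer_eq_resolvent[OF A evs] mult_mat_index[OF CR B jl]
      by (intro sum.cong refl) (simp only: mult_mat_index[OF C resolvent_carrier[OF A] jl(1)] lessThan_iff)
    have "cmod (T s) \<le> (\<Sum>k<r. \<Sum>n<r. cmod (C $$ (j, n)) * cmod (B $$ (k, l)) * (2 / cmod s))"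
      unfolding T sum_distrib_right
    proof (intro order_trans[OF norm_sum sum_mono] order_trans[OF norm_sum sum_mono])
      fix k n assume kn: "k \<in> {..<r}" "n \<in> {..<r}"
      have "cmod (resolvent A s $$ (n, k)) \<le> 2 / cmod s"
        by (rule resolvent_entry_bound[OF A evs]) (use kn s\<alpha> s0 in \<open>auto simp: \<alpha>_def\<close>)
      then have "cmod (C $$ (j, n)) * cmod (B $$ (k, l)) * cmod (resolvent A s $$ (n, k)) \<le> cmod (C $$ (j, n)) * cmod (B $$ (k, l)) * (2 / cmod s)"
        by (intro mult_left_mono) auto
      then show "cmod (C $$ (j, n) * resolvent A s $$ (n, k) * B $$ (k, l)) \<le> cmod (C $$ (j, n)) * cmod (B $$ (k, l)) * (2 / cmod s)"
        by (simp only: norm_mult mult_ac)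
    qed
    also have "\<dots> = q * (2 / cmod s)" by (simp only: q_def sum_distrib_right)
    finally have "cmod (T s) * cmod s \<le> 2 * q" using s0 by (simp add: field_simps)
    moreover have "cmod (T s) * (1 + cmod s) \<le> 2 * (cmod (T s) * cmod s)"
      using mult_left_mono[OF s1, of "cmod (T s)"] by (simp add: algebra_simps)
    moreover have "b * (1 + \<rho>) \<ge> 0" using b0 \<alpha> by (simp add: \<rho>_def)
    ultimately have "cmod (T s) * (1 + cmod s) \<le> b * (1 + \<rho>) + 4 * q" by linarith
    then show ?thesis by (subst pos_le_divide_eq) (auto intro: add_pos_nonneg)
  qed
  moreover have "T holomorphic_on {s. Re s > 0}"
    unfolding T_def by (rule transfer_holomorphic[OF ABC jl]) (use ev in auto)
  moreover have "b * (1 + \<rho>) + 4 * q \<ge> 0" using b0 q \<alpha> by (simp add: \<rho>_def)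
  ultimately show ?thesis
    unfolding T_def[abs_def, symmetric] by (intro hardy2_decay) auto
qed

lemma transfer_carrier:
  assumes ABC: "realization p m r A B C" and hur: "hurwitz A" and s: "Re s > 0"
  shows "transfer A B C s \<in> carrier_mat p m"
proof -
  have A: "A \<in> carrier_mat r r" and B: "B \<in> carrier_mat r m" and C: "C \<in> carrier_mat p r"
    using ABC by (auto simp: realization_def)
  have "\<not> eigenvalue A s" using hur s by (auto simp: hurwitz_def)
  then show ?thesis
    unfolding transfer_eq_resolvent[OF A \<open>\<not> eigenvalue A s\<close>]
    by (intro mult_carrier_mat[OF mult_carrier_mat[OF C resolvent_carrier[OF A]] B])
qed

lemma manifold_M_subset_H2:
  assumes "G \<in> manifold_M p m r"
  shows "G \<in> H2 p m"
proof -
  obtain A B C where ABC: "realization p m r A B C" "hurwitz A" "\<And>s. Re s > 0 \<Longrightarrow> G s = transfer A B C s"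
    using assms unfolding manifold_M_def minimal_realization_def by auto
  have "hardy2 (\<lambda>s. G s $$ (i, j))" if "i < p" "j < m" for i j
    using transfer_hardy2[OF ABC(1,2) that] by (subst hardy2_cong[of _ "\<lambda>s. transfer A B C s $$ (i, j)"]) (simp_all add: ABC(3))
  then show ?thesis using transfer_carrier[OF ABC(1,2)] ABC(3) by (auto simp: H2_iff_hardy2)
qed

section \<open>Orthogonality\<close>

text \<open>The region extends to the left of the imaginary axis because the tangent vector is read
  on the mirrored lines.\<close>

definition decaying :: "real \<Rightarrow> (complex \<Rightarrow> complex) \<Rightarrow> bool" where
  "decaying \<delta> E \<longleftrightarrow> continuous_on {s. Re s \<ge> -\<delta>} E \<and>
     (\<exists>C\<ge>0. \<forall>s. Re s \<ge> -\<delta> \<longrightarrow> cmod (E s) \<le> C / (1 + cmod s))"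

lemma decaying_add:
  assumes "decaying \<delta> E" "decaying \<delta> F"
  shows "decaying \<delta> (\<lambda>s. E s + F s)"
proof -
  obtain C where C: "C \<ge> 0" "\<And>s. Re s \<ge> -\<delta> \<Longrightarrow> cmod (E s) \<le> C / (1 + cmod s)"
    using assms(1) by (auto simp: decaying_def)
  obtain D where D: "D \<ge> 0" "\<And>s. Re s \<ge> -\<delta> \<Longrightarrow> cmod (F s) \<le> D / (1 + cmod s)"
    using assms(2) by (auto simp: decaying_def)
  have "cmod (E s + F s) \<le> (C + D) / (1 + cmod s)" if "Re s \<ge> -\<delta>" for s
    unfolding add_divide_distrib by (intro norm_triangle_le add_mono C D that)
  moreover have "C + D \<ge> 0" using C D by simp
  ultimately have "\<exists>C\<ge>0. \<forall>s. Re s \<ge> -\<delta> \<longrightarrow> cmod (E s + F s) \<le> C / (1 + cmod s)" by blast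
  then show ?thesis using assms unfolding decaying_def by (auto intro: continuous_on_add)
qed

lemma decaying_cmult:
  assumes "decaying \<delta> E"
  shows "decaying \<delta> (\<lambda>s. c * E s)"
proof -
  obtain C where C: "C \<ge> 0" "\<And>s. Re s \<ge> -\<delta> \<Longrightarrow> cmod (E s) \<le> C / (1 + cmod s)"
    using assms(1) by (auto simp: decaying_def)
  have "cmod (c * E s) \<le> (cmod c * C) / (1 + cmod s)" if "Re s \<ge> -\<delta>" for s
    using mult_left_mono[OF C(2)[OF that], of "cmod c"] by (simp add: norm_mult)
  moreover have "cmod c * C \<ge> 0" using C by simp
  ultimately have "\<exists>C\<ge>0. \<forall>s. Re s \<ge> -\<delta> \<longrightarrow> cmod (c * E s) \<le> C / (1 + cmod s)" by blast
  then show ?thesis using assms unfolding decaying_def by (auto intro!: continuous_intros)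
qed

lemma decaying_sum: "(\<And>i. i \<in> I \<Longrightarrow> decaying \<delta> (f i)) \<Longrightarrow> decaying \<delta> (\<lambda>s. \<Sum>i\<in>I. f i s)"
proof (induction I rule: infinite_finite_induct)
  case (insert x I)
  then show ?case by (simp add: decaying_add)
qed (auto simp: decaying_def intro!: exI[of _ 0])

lemma decaying_diff: "decaying \<delta> E \<Longrightarrow> decaying \<delta> F \<Longrightarrow> decaying \<delta> (\<lambda>s. E s - F s)"
  using decaying_add[of \<delta> E "\<lambda>s. (-1) * F s"] decaying_cmult[of \<delta> F "-1"] by simp

lemma decaying_pole: "Re l < -\<delta> \<Longrightarrow> decaying \<delta> (\<lambda>s. 1 / (s - l))"
  unfolding decaying_def by (rule pole_decay[of l \<delta>]) (auto intro!: continuous_intros)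

text \<open>The linear numerator costs one of the two powers of decay and leaves one.\<close>

lemma decaying_two_poles:
  assumes "Re a < -\<delta>" "Re b < -\<delta>"
  shows "decaying \<delta> (\<lambda>s. (k0 + k1 * s) / ((s - a) * (s - b)))"
proof -
  obtain C where C: "C \<ge> 0" "\<And>s. Re s \<ge> -\<delta> \<Longrightarrow> cmod (1 / (s - a)) \<le> C / (1 + cmod s)"
    using pole_decay[OF assms(1)] by blast
  obtain D where D: "D \<ge> 0" "\<And>s. Re s \<ge> -\<delta> \<Longrightarrow> cmod (1 / (s - b)) \<le> D / (1 + cmod s)"
    using pole_decay[OF assms(2)] by blast
  have "cmod ((k0 + k1 * s) / ((s - a) * (s - b))) \<le> ((cmod k0 + cmod k1) * C * D) / (1 + cmod s)" if s: "Re s \<ge> -\<delta>" for s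
  proof -
    have pos: "1 + cmod s > 0" by (auto intro: add_pos_nonneg)
    have "cmod (k0 + k1 * s) \<le> cmod k0 + cmod k1 * cmod s"
      using norm_triangle_ineq[of k0 "k1 * s"] by (simp add: norm_mult)
    also have "\<dots> \<le> (cmod k0 + cmod k1) * (1 + cmod s)" by (simp add: algebra_simps)
    finally have 1: "cmod (k0 + k1 * s) \<le> (cmod k0 + cmod k1) * (1 + cmod s)" .
    have "cmod ((k0 + k1 * s) / ((s - a) * (s - b))) = cmod (k0 + k1 * s) * (cmod (1 / (s - a)) * cmod (1 / (s - b)))"
      by (simp add: norm_divide norm_mult)
    also have "\<dots> \<le> ((cmod k0 + cmod k1) * (1 + cmod s)) * ((C / (1 + cmod s)) * (D / (1 + cmod s)))"
      by (intro mult_mono 1 C(2) D(2) s) (use C(1) pos in auto)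
    also have "\<dots> = ((cmod k0 + cmod k1) * C * D) / (1 + cmod s)"
    proof -
      have "(K * x) * ((C / x) * (D / x)) = (K * C * D) / x" if "x > 0" for K x :: real
        using that by (simp add: field_simps)
      then show ?thesis using pos by blast
    qed
    finally show ?thesis .
  qed
  moreover have "(cmod k0 + cmod k1) * C * D \<ge> 0" using C D by simp
  ultimately have "\<exists>C\<ge>0. \<forall>s. Re s \<ge> -\<delta> \<longrightarrow> cmod ((k0 + k1 * s) / ((s - a) * (s - b))) \<le> C / (1 + cmod s)" by blast
  moreover have "continuous_on {s. Re s \<ge> -\<delta>} (\<lambda>s. (k0 + k1 * s) / ((s - a) * (s - b)))"
    using assms by (intro continuous_intros) auto
  ultimately show ?thesis unfolding decaying_def by blast
qed

lemma decaying_sqint: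
  assumes "decaying \<delta> E" "x \<ge> -\<delta>"
  shows "sqint (line E x)"
proof -
  obtain C where C: "C \<ge> 0" "\<And>s. Re s \<ge> -\<delta> \<Longrightarrow> cmod (E s) \<le> C / (1 + cmod s)"
    using assms(1) by (auto simp: decaying_def)
  have "continuous_on {s. Re s \<ge> -\<delta>} E" using assms(1) by (simp add: decaying_def)
  then have cont: "continuous_on UNIV (line E x)"
    unfolding line_def by (rule continuous_on_compose2) (use assms(2) in \<open>auto intro!: continuous_intros\<close>)
  have "nrm2 (line E x) \<le> ennreal (C\<^sup>2 * kernel_mass)"
    by (rule nrm2_decay_le, unfold line_def, rule cmod_le_decay[OF C(2) C(1)]) (use assms(2) in simp)
  then have "nrm2 (line E x) < \<infinity>" by (rule order_le_less_trans) simp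
  then show ?thesis using cont by (simp add: sqint_def borel_measurable_continuous_onI)
qed

section \<open>Orthogonality to partial fractions\<close>

text \<open>Integrability is included because a nonintegrable function also has Bochner integral 0,
  and such zeros would not add up.\<close>

definition null_integral :: "(real \<Rightarrow> complex) \<Rightarrow> bool" where
  "null_integral f \<longleftrightarrow> integrable lborel f \<and> (\<integral>\<omega>. f \<omega> \<partial>lborel) = 0"

lemma null_integral_add: "null_integral f \<Longrightarrow> null_integral g \<Longrightarrow> null_integral (\<lambda>\<omega>. f \<omega> + g \<omega>)"
  by (simp add: null_integral_def)

lemma null_integral_diff: "null_integral f \<Longrightarrow> null_integral g \<Longrightarrow> null_integral (\<lambda>\<omega>. f \<omega> - g \<omega>)"
  by (simp add: null_integral_def)

lemma null_integral_cmult: "null_integral f \<Longrightarrow> null_integral (\<lambda>\<omega>. c * f \<omega>)"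
  by (simp add: null_integral_def)

lemma null_integral_sum: "(\<And>i. i \<in> I \<Longrightarrow> null_integral (f i)) \<Longrightarrow> null_integral (\<lambda>\<omega>. \<Sum>i\<in>I. f i \<omega>)"
  by (simp add: null_integral_def Bochner_Integration.integral_sum)

lemma sum_rotate3:
  "(\<Sum>j\<in>P. \<Sum>l\<in>M. \<Sum>k\<in>R. f j l k) = (\<Sum>k\<in>R. \<Sum>l\<in>M. \<Sum>j\<in>P. f j l k)"
  for f :: "'a \<Rightarrow> 'b \<Rightarrow> 'c \<Rightarrow> complex"
proof -
  have "(\<Sum>j\<in>P. \<Sum>l\<in>M. \<Sum>k\<in>R. f j l k) = (\<Sum>l\<in>M. \<Sum>j\<in>P. \<Sum>k\<in>R. f j l k)" by (rule sum.swap)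
  also have "\<dots> = (\<Sum>l\<in>M. \<Sum>k\<in>R. \<Sum>j\<in>P. f j l k)" by (intro sum.cong refl sum.swap)
  also have "\<dots> = (\<Sum>k\<in>R. \<Sum>l\<in>M. \<Sum>j\<in>P. f j l k)" by (rule sum.swap)
  finally show ?thesis .
qed

lemma sum_swap4:
  "(\<Sum>j\<in>P. \<Sum>l\<in>M. \<Sum>k\<in>R. \<Sum>n\<in>Q. f j l k n) = (\<Sum>k\<in>R. \<Sum>n\<in>Q. \<Sum>j\<in>P. \<Sum>l\<in>M. f j l k n)"
  for f :: "'a \<Rightarrow> 'b \<Rightarrow> 'c \<Rightarrow> 'd \<Rightarrow> complex"
proof -
  have "(\<Sum>j\<in>P. \<Sum>l\<in>M. \<Sum>k\<in>R. \<Sum>n\<in>Q. f j l k n) = (\<Sum>k\<in>R. \<Sum>l\<in>M. \<Sum>j\<in>P. \<Sum>n\<in>Q. f j l k n)"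
    by (rule sum_rotate3)
  also have "\<dots> = (\<Sum>k\<in>R. \<Sum>n\<in>Q. \<Sum>j\<in>P. \<Sum>l\<in>M. f j l k n)"
    by (intro sum.cong refl sum_rotate3)
  finally show ?thesis .
qed

text \<open>The three interpolation conditions match the three kinds of terms: \<open>left\<close>
  removes the terms with free \<open>be\<close>, \<open>right\<close> those with free
  \<open>al\<close>, and the terms with two poles use \<open>left\<close> at one mirror image and
  \<open>right\<close> at the other, or \<open>der\<close> when the poles coincide.\<close>

lemma h2_inner_partial_fractions_zero:
  fixes p m r :: nat and lam :: "nat \<Rightarrow> complex" and b c al be k0 k1 :: "nat \<Rightarrow> nat \<Rightarrow> complex"
  assumes F: "F \<in> H2 p m" and V: "V \<in> H2 p m" and lam: "\<And>k. k < r \<Longrightarrow> Re (lam k) < 0"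
    and VE: "\<And>s i j. Re s > 0 \<Longrightarrow> i < p \<Longrightarrow> j < m \<Longrightarrow> V s $$ (i, j) =
       (\<Sum>k<r. c k i * be k j * (1 / (s - lam k))) + (\<Sum>k<r. al i k * cnj (b k j) * (1 / (s - lam k)))
       - (\<Sum>k<r. \<Sum>n<r. c k i * cnj (b n j) * ((k0 k n + k1 k n * s) / ((s - lam k) * (s - lam n))))"
    and right: "\<And>k i. k < r \<Longrightarrow> i < p \<Longrightarrow> (\<Sum>j<m. F (- cnj (lam k)) $$ (i, j) * b k j) = 0"
    and left: "\<And>k j. k < r \<Longrightarrow> j < m \<Longrightarrow> (\<Sum>i<p. cnj (c k i) * F (- cnj (lam k)) $$ (i, j)) = 0"
    and der: "\<And>k. k < r \<Longrightarrow> (\<Sum>i<p. \<Sum>j<m. cnj (c k i) * deriv (\<lambda>s. F s $$ (i, j)) (- cnj (lam k)) * b k j) = 0"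
    and lami: "inj_on lam {..<r}"
  shows "h2_inner p m F V = 0"
proof -
  define E where "E i j s = (\<Sum>k<r. c k i * be k j * (1 / (s - lam k))) + (\<Sum>k<r. al i k * cnj (b k j) * (1 / (s - lam k)))
       - (\<Sum>k<r. \<Sum>n<r. c k i * cnj (b n j) * ((k0 k n + k1 k n * s) / ((s - lam k) * (s - lam n))))" for i j s
  \<comment> \<open>At most half the distance from the axis to the nearest pole; the inserted 1
    keeps the set nonempty for \<open>r = 0\<close>.\<close>
  define \<delta> where "\<delta> = Min (insert 1 ((\<lambda>k. - Re (lam k) / 2) ` {..<r}))"
  have \<delta>: "\<delta> > 0" unfolding \<delta>_def using lam by (subst Min_gr_iff) auto
  have \<delta>l: "Re (lam k) < -\<delta>" if "k < r" for k
  proof -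
    have "\<delta> \<le> - Re (lam k) / 2" unfolding \<delta>_def using that by (intro Min_le) auto
    then show ?thesis using lam[OF that] by simp
  qed
  have Edec: "decaying \<delta> (E i j)" for i j
    unfolding E_def
    by (intro decaying_diff decaying_add decaying_sum decaying_cmult decaying_pole decaying_two_poles \<delta>l) auto
  \<comment> \<open>Distances from the axis that tend to 0 and never exceed \<delta>, so that both
    mirrored lines stay clear of the poles. The integral is exactly 0 for each of them.\<close>
  define X where "X n = \<delta> * inverse (real (Suc n))" for n
  have X: "0 < X n" "X n \<le> \<delta>" for n
    using \<delta> by (auto simp: X_def field_simps)
  have "X \<longlonglongrightarrow> \<delta> * 0" unfolding X_def by (intro tendsto_mult tendsto_const LIMSEQ_inverse_real_of_nat)
  then have X0: "X \<longlonglongrightarrow> 0" by simp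
  define f where "f i j s = F s $$ (i, j)" for i j s
  have f: "hardy2 (f i j)" if "i < p" "j < m" for i j unfolding f_def by (rule H2_hardy2[OF F that])
  define I where "I n = (\<Sum>i<p. \<Sum>j<m. \<integral>\<omega>. cnj (line (f i j) (X n) \<omega>) * line (E i j) (- X n) \<omega> \<partial>lborel)" for n
  have lim: "I \<longlonglongrightarrow> (\<Sum>i<p. \<Sum>j<m. \<integral>\<omega>. cnj (boundary_function p m F \<omega> $$ (i, j)) * boundary_function p m V \<omega> $$ (i, j) \<partial>lborel)"
    unfolding I_def
  proof (intro tendsto_sum)
    fix i j assume "i \<in> {..<p}" "j \<in> {..<m}"
    then have ij: "i < p" "j < m" by auto
    obtain C where C: "C \<ge> 0" "\<And>s. Re s \<ge> -\<delta> \<Longrightarrow> cmod (E i j s) \<le> C / (1 + cmod s)"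
      using Edec[of i j] by (auto simp: decaying_def)
    have cont: "continuous_on {s. Re s \<ge> -\<delta>} (E i j)" using Edec[of i j] by (simp add: decaying_def)
    show "(\<lambda>n. \<integral>\<omega>. cnj (line (f i j) (X n) \<omega>) * line (E i j) (- X n) \<omega> \<partial>lborel) \<longlonglongrightarrow>
      (\<integral>\<omega>. cnj (boundary_function p m F \<omega> $$ (i, j)) * boundary_function p m V \<omega> $$ (i, j) \<partial>lborel)"
    proof (rule hardy2_inner_reflected_tendsto[OF f[OF ij] _ H2_hardy2[OF V ij] boundary_function_l2_boundary(2)[OF V ij] _ cont C X X0])
      show "l2_boundary (f i j) (\<lambda>\<omega>. boundary_function p m F \<omega> $$ (i, j))"
        unfolding f_def by (rule boundary_function_l2_boundary(2)[OF F ij])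
      show "V s $$ (i, j) = E i j s" if "0 < Re s" for s unfolding E_def by (rule VE[OF that ij])
    qed
  qed
  have "I n = 0" for n
  proof -
    define x where "x = X n"
    have x: "0 < x" "x \<le> \<delta>" using X by (simp_all add: x_def)
    have xl: "x < - Re (lam k)" if "k < r" for k using \<delta>l[OF that] x by simp
    have sqE: "sqint (line (E i j) (- x))" for i j by (rule decaying_sqint[OF Edec]) (use x in simp)
    define rk where "rk k \<omega> = 1 / (Complex (- x) \<omega> - lam k)" for k \<omega>
    define rkn where "rkn k n \<omega> = (k0 k n + k1 k n * Complex (- x) \<omega>) / ((Complex (- x) \<omega> - lam k) * (Complex (- x) \<omega> - lam n))" for k n \<omega>
    have sqk: "sqint (rk k)" if "k < r" for k
      using decaying_sqint[OF decaying_pole[OF \<delta>l[OF that]], of "-x"] x by (simp add: line_def[abs_def] rk_def[abs_def])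
    have sqkn: "sqint (rkn k n)" if "k < r" "n < r" for k n
      using decaying_sqint[OF decaying_two_poles[OF \<delta>l[OF that(1)] \<delta>l[OF that(2)], of "k0 k n" "k1 k n"], of "-x"] x
      by (simp add: line_def[abs_def] rkn_def[abs_def])
    \<comment> \<open>The vanishing lemmas conjugate the rational factor, the inner product
      conjugates the error; the two integrals are conjugate.\<close>
    have null: "null_integral (\<lambda>\<omega>. cnj (line \<phi> x \<omega>) * g \<omega>)"
      if \<phi>: "hardy2 \<phi>" and g: "sqint g" and z: "(\<integral>\<omega>. line \<phi> x \<omega> * cnj (g \<omega>) \<partial>lborel) = 0" for \<phi> g
    proof -
      have "integrable lborel (\<lambda>\<omega>. cnj (line \<phi> x \<omega>) * g \<omega>)"
        by (intro sqint_mult_integrable sqint_cnj hardy2_sqint \<phi> g x)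
      moreover have "(\<integral>\<omega>. cnj (line \<phi> x \<omega>) * g \<omega> \<partial>lborel) = cnj (\<integral>\<omega>. line \<phi> x \<omega> * cnj (g \<omega>) \<partial>lborel)"
        by (simp add: Bochner_Integration.integral_cnj[symmetric] del: Bochner_Integration.integral_cnj)
      ultimately show ?thesis using z by (simp add: null_integral_def)
    qed
    \<comment> \<open>The error contracted with \<open>c\<close> from the left, with
      \<open>b\<close> from the right, and with both. The coefficients are conjugated so that, after
      the conjugation in the inner product, the residue entries of the tangent vector
      result.\<close>
    define \<phi> where "\<phi> k j s = (\<Sum>i<p. cnj (c k i) * f i j s)" for k j s
    define \<psi> where "\<psi> k i s = (\<Sum>j<m. b k j * f i j s)" for k i s
    define \<theta> where "\<theta> k n s = (\<Sum>i<p. \<Sum>j<m. (cnj (c k i) * b n j) * f i j s)" for k n s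
    have \<phi>: "hardy2 (\<phi> k j)" if "j < m" for k j
      unfolding \<phi>_def by (intro hardy2_sum hardy2_cmult f that) simp
    have \<psi>: "hardy2 (\<psi> k i)" if "i < p" for k i
      unfolding \<psi>_def by (intro hardy2_sum hardy2_cmult f that) simp
    have \<theta>: "hardy2 (\<theta> k n)" for k n
      unfolding \<theta>_def by (intro hardy2_sum hardy2_cmult f) simp_all
    have n1: "null_integral (\<lambda>\<omega>. cnj (line (\<phi> k j) x \<omega>) * rk k \<omega>)" if "k < r" "j < m" for k j
    proof (rule null[OF \<phi>[OF that(2)] sqk[OF that(1)]])
      have "\<phi> k j (- cnj (lam k)) = 0" using left[OF that] by (simp add: \<phi>_def f_def)
      from hardy2_reflected_pole_zero[OF \<phi>[OF that(2)] this x(1) xl[OF that(1)]]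
      show "(\<integral>\<omega>. line (\<phi> k j) x \<omega> * cnj (rk k \<omega>) \<partial>lborel) = 0" by (simp only: rk_def)
    qed
    have n2: "null_integral (\<lambda>\<omega>. cnj (line (\<psi> k i) x \<omega>) * rk k \<omega>)" if "k < r" "i < p" for k i
    proof (rule null[OF \<psi>[OF that(2)] sqk[OF that(1)]])
      have "\<psi> k i (- cnj (lam k)) = 0" using right[OF that] by (simp add: \<psi>_def f_def mult.commute)
      from hardy2_reflected_pole_zero[OF \<psi>[OF that(2)] this x(1) xl[OF that(1)]]
      show "(\<integral>\<omega>. line (\<psi> k i) x \<omega> * cnj (rk k \<omega>) \<partial>lborel) = 0" by (simp only: rk_def)
    qed
    have n3: "null_integral (\<lambda>\<omega>. cnj (line (\<theta> k n) x \<omega>) * rkn k n \<omega>)" if kn: "k < r" "n < r" for k n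
    proof (rule null[OF \<theta> sqkn[OF that]])
      have "\<theta> k n s = (\<Sum>j<m. b n j * \<phi> k j s)" for s
        unfolding \<theta>_def \<phi>_def sum_distrib_left by (subst sum.swap) (simp add: mult_ac)
      then have a0: "\<theta> k n (- cnj (lam k)) = 0" using left[OF kn(1)] by (simp add: \<phi>_def f_def)
      have \<theta>2: "\<theta> k n s = (\<Sum>i<p. cnj (c k i) * \<psi> n i s)" for s
        unfolding \<theta>_def \<psi>_def sum_distrib_left by (simp add: mult_ac)
      \<comment> \<open>Equal poles mean equal indices, which is where the derivative condition
        enters; otherwise the second zero comes from the right condition at the other mirror
        image.\<close>
      have ab: "if lam k = lam n then deriv (\<theta> k n) (- cnj (lam k)) = 0 else \<theta> k n (- cnj (lam n)) = 0"
      proof (cases "lam k = lam n")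
        case True
        then have "k = n" using lami kn by (auto simp: inj_on_def)
        have pos: "Re (- cnj (lam k)) > 0" using lam[OF kn(1)] by simp
        have fd: "(f i j has_field_derivative deriv (f i j) (- cnj (lam k))) (at (- cnj (lam k)))" if "i < p" "j < m" for i j
          using holomorphic_derivI[OF hardy2_holomorphic[OF f[OF that]] open_rhp] pos by simp
        have "(\<theta> k n has_field_derivative (\<Sum>i<p. \<Sum>j<m. (cnj (c k i) * b n j) * deriv (f i j) (- cnj (lam k)))) (at (- cnj (lam k)))"
          unfolding \<theta>_def by (intro DERIV_sum DERIV_cmult fd) auto
        then have "deriv (\<theta> k n) (- cnj (lam k)) = (\<Sum>i<p. \<Sum>j<m. (cnj (c k i) * b n j) * deriv (f i j) (- cnj (lam k)))"
          by (rule DERIV_imp_deriv)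
        also have "\<dots> = 0" using der[OF kn(1)] \<open>k = n\<close> by (simp add: f_def[abs_def] mult_ac)
        finally show ?thesis using True by simp
      next
        case False
        then show ?thesis unfolding \<theta>2 using right[OF kn(2)] by (simp add: \<psi>_def f_def mult.commute)
      qed
      from hardy2_reflected_two_poles_zero[OF \<theta> a0 ab x(1) xl[OF kn(1)] xl[OF kn(2)]]
      show "(\<integral>\<omega>. line (\<theta> k n) x \<omega> * cnj (rkn k n \<omega>) \<partial>lborel) = 0" by (simp only: rkn_def)
    qed
    have int: "integrable lborel (\<lambda>\<omega>. cnj (line (f i j) x \<omega>) * line (E i j) (- x) \<omega>)" if "i < p" "j < m" for i j
      by (intro sqint_mult_integrable sqint_cnj hardy2_sqint f that x sqE)
    have "I n = (\<integral>\<omega>. (\<Sum>i<p. \<Sum>j<m. cnj (line (f i j) x \<omega>) * line (E i j) (- x) \<omega>) \<partial>lborel)"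
      unfolding I_def x_def[symmetric] using int
      by (subst Bochner_Integration.integral_sum) (auto intro!: sum.cong Bochner_Integration.integral_sum[symmetric] Bochner_Integration.integrable_sum)
    \<comment> \<open>Moving the sums over the entries inside collects the error into the
      contractions, so each remaining summand is one of the vanishing integrals.\<close>
    also have "(\<lambda>\<omega>. \<Sum>i<p. \<Sum>j<m. cnj (line (f i j) x \<omega>) * line (E i j) (- x) \<omega>) =
      (\<lambda>\<omega>. (\<Sum>k<r. \<Sum>j<m. be k j * (cnj (line (\<phi> k j) x \<omega>) * rk k \<omega>))
         + (\<Sum>k<r. \<Sum>i<p. al i k * (cnj (line (\<psi> k i) x \<omega>) * rk k \<omega>))
         - (\<Sum>k<r. \<Sum>n<r. cnj (line (\<theta> k n) x \<omega>) * rkn k n \<omega>))"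
    proof
      fix \<omega>
      define a where "a i j = cnj (line (f i j) x \<omega>)" for i j
      have e\<phi>: "cnj (line (\<phi> k j) x \<omega>) = (\<Sum>i<p. c k i * a i j)" for k j
        by (simp add: \<phi>_def line_def a_def)
      have e\<psi>: "cnj (line (\<psi> k i) x \<omega>) = (\<Sum>j<m. cnj (b k j) * a i j)" for k i
        by (simp add: \<psi>_def line_def a_def)
      have e\<theta>: "cnj (line (\<theta> k n) x \<omega>) = (\<Sum>i<p. \<Sum>j<m. c k i * cnj (b n j) * a i j)" for k n
        by (simp add: \<theta>_def line_def a_def)
      have eE: "line (E i j) (- x) \<omega> = (\<Sum>k<r. c k i * be k j * rk k \<omega>) + (\<Sum>k<r. al i k * cnj (b k j) * rk k \<omega>)
        - (\<Sum>k<r. \<Sum>n<r. c k i * cnj (b n j) * rkn k n \<omega>)" for i j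
        by (simp only: line_def E_def rk_def rkn_def)
      have s1: "(\<Sum>i<p. \<Sum>j<m. a i j * (\<Sum>k<r. c k i * be k j * rk k \<omega>)) = (\<Sum>k<r. \<Sum>j<m. be k j * (cnj (line (\<phi> k j) x \<omega>) * rk k \<omega>))"
      proof -
        have "(\<Sum>i<p. \<Sum>j<m. a i j * (\<Sum>k<r. c k i * be k j * rk k \<omega>)) = (\<Sum>i<p. \<Sum>j<m. \<Sum>k<r. a i j * (c k i * be k j * rk k \<omega>))"
          by (simp only: sum_distrib_left)
        also have "\<dots> = (\<Sum>k<r. \<Sum>j<m. \<Sum>i<p. a i j * (c k i * be k j * rk k \<omega>))" by (rule sum_rotate3)
        also have "\<dots> = (\<Sum>k<r. \<Sum>j<m. be k j * (cnj (line (\<phi> k j) x \<omega>) * rk k \<omega>))"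
          unfolding e\<phi> sum_distrib_left sum_distrib_right by (intro sum.cong refl) (simp add: mult_ac)
        finally show ?thesis .
      qed
      have s2: "(\<Sum>i<p. \<Sum>j<m. a i j * (\<Sum>k<r. al i k * cnj (b k j) * rk k \<omega>)) = (\<Sum>k<r. \<Sum>i<p. al i k * (cnj (line (\<psi> k i) x \<omega>) * rk k \<omega>))"
      proof -
        have "(\<Sum>i<p. \<Sum>j<m. a i j * (\<Sum>k<r. al i k * cnj (b k j) * rk k \<omega>)) = (\<Sum>j<m. \<Sum>i<p. \<Sum>k<r. a i j * (al i k * cnj (b k j) * rk k \<omega>))"
          by (simp only: sum_distrib_left) (rule sum.swap)
        also have "\<dots> = (\<Sum>k<r. \<Sum>i<p. \<Sum>j<m. a i j * (al i k * cnj (b k j) * rk k \<omega>))" by (rule sum_rotate3)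
        also have "\<dots> = (\<Sum>k<r. \<Sum>i<p. al i k * (cnj (line (\<psi> k i) x \<omega>) * rk k \<omega>))"
          unfolding e\<psi> sum_distrib_left sum_distrib_right by (intro sum.cong refl) (simp add: mult_ac)
        finally show ?thesis .
      qed
      have s3: "(\<Sum>i<p. \<Sum>j<m. a i j * (\<Sum>k<r. \<Sum>n<r. c k i * cnj (b n j) * rkn k n \<omega>)) = (\<Sum>k<r. \<Sum>n<r. cnj (line (\<theta> k n) x \<omega>) * rkn k n \<omega>)"
      proof -
        have "(\<Sum>i<p. \<Sum>j<m. a i j * (\<Sum>k<r. \<Sum>n<r. c k i * cnj (b n j) * rkn k n \<omega>)) = (\<Sum>i<p. \<Sum>j<m. \<Sum>k<r. \<Sum>n<r. a i j * (c k i * cnj (b n j) * rkn k n \<omega>))"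
          by (simp only: sum_distrib_left)
        also have "\<dots> = (\<Sum>k<r. \<Sum>n<r. \<Sum>i<p. \<Sum>j<m. a i j * (c k i * cnj (b n j) * rkn k n \<omega>))" by (rule sum_swap4)
        also have "\<dots> = (\<Sum>k<r. \<Sum>n<r. cnj (line (\<theta> k n) x \<omega>) * rkn k n \<omega>)"
          unfolding e\<theta> sum_distrib_right by (intro sum.cong refl) (simp add: mult_ac)
        finally show ?thesis .
      qed
      show "(\<Sum>i<p. \<Sum>j<m. cnj (line (f i j) x \<omega>) * line (E i j) (- x) \<omega>) =
         (\<Sum>k<r. \<Sum>j<m. be k j * (cnj (line (\<phi> k j) x \<omega>) * rk k \<omega>))
         + (\<Sum>k<r. \<Sum>i<p. al i k * (cnj (line (\<psi> k i) x \<omega>) * rk k \<omega>))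
         - (\<Sum>k<r. \<Sum>n<r. cnj (line (\<theta> k n) x \<omega>) * rkn k n \<omega>)"
        unfolding s1[symmetric] s2[symmetric] s3[symmetric] eE a_def[symmetric]
        by (simp only: distrib_left right_diff_distrib sum.distrib sum_subtractf)
    qed
    also have "null_integral \<dots>"
      by (intro null_integral_diff null_integral_add null_integral_sum null_integral_cmult n1 n2 n3) auto
    then have "(\<integral>\<omega>. (\<Sum>k<r. \<Sum>j<m. be k j * (cnj (line (\<phi> k j) x \<omega>) * rk k \<omega>))
         + (\<Sum>k<r. \<Sum>i<p. al i k * (cnj (line (\<psi> k i) x \<omega>) * rk k \<omega>))
         - (\<Sum>k<r. \<Sum>n<r. cnj (line (\<theta> k n) x \<omega>) * rkn k n \<omega>) \<partial>lborel) = 0"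
      by (simp only: null_integral_def)
    finally show ?thesis .
  qed
  then have I0: "I = (\<lambda>n. 0)" by blast
  have "0 = (\<Sum>i<p. \<Sum>j<m. \<integral>\<omega>. cnj (boundary_function p m F \<omega> $$ (i, j)) * boundary_function p m V \<omega> $$ (i, j) \<partial>lborel)"
    using lim unfolding I0 by (rule LIMSEQ_unique[OF tendsto_const])
  also have "\<dots> = (\<Sum>j<m. \<Sum>i<p. \<integral>\<omega>. cnj (boundary_function p m F \<omega> $$ (i, j)) * boundary_function p m V \<omega> $$ (i, j) \<partial>lborel)"
    by (rule sum.swap)
  finally show ?thesis
    unfolding h2_inner_eq[OF F V] by (simp only: mult_zero_right)
qed

text \<open>Differentiability in the Hardy norm becomes differentiability at each point, which is
  all that the reconstruction formula consumes. The nonzero residues supply admissible tangential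
  data.\<close>

lemma tangent_space_explicit:
  assumes V: "V \<in> tangent_space p m r G"
    and G: "pole_residue_form p m r G lam b c" and lami: "inj_on lam {..<r}"
    and lam: "\<And>k. k < r \<Longrightarrow> Re (lam k) < 0"
    and nz: "\<And>k. k < r \<Longrightarrow> \<exists>i<p. \<exists>j<m. c k $$ (i, 0) * cnj (b k $$ (j, 0)) \<noteq> 0"
  obtains al be k0 k1 :: "nat \<Rightarrow> nat \<Rightarrow> complex" where
    "\<And>s i j. Re s > 0 \<Longrightarrow> i < p \<Longrightarrow> j < m \<Longrightarrow> V s $$ (i, j) =
       (\<Sum>k<r. c k $$ (i, 0) * be k j * (1 / (s - lam k))) + (\<Sum>k<r. al i k * cnj (b k $$ (j, 0)) * (1 / (s - lam k)))
       - (\<Sum>k<r. \<Sum>n<r. c k $$ (i, 0) * cnj (b n $$ (j, 0)) * ((k0 k n + k1 k n * s) / ((s - lam k) * (s - lam n))))"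
    and "V \<in> H2 p m"
proof -
  obtain \<epsilon> \<gamma> where \<epsilon>: "\<epsilon> > 0" and sm: "h2_smooth_curve p m \<epsilon> \<gamma>"
    and M: "\<And>t. t \<in> {-\<epsilon><..<\<epsilon>} \<Longrightarrow> \<gamma> t \<in> manifold_M p m r" and g0: "\<gamma> 0 = G"
    and der: "h2_has_derivative_at p m \<gamma> V 0"
    using V unfolding tangent_space_def by blast
  have V2: "V \<in> H2 p m" using der by (simp add: h2_has_derivative_at_def)
  have bc: "b k \<in> carrier_mat m 1" "c k \<in> carrier_mat p 1" if "k < r" for k
    using G that by (auto simp: pole_residue_form_def)
  have nzc: "\<exists>i<p. c k $$ (i, 0) \<noteq> 0" and nzb: "\<exists>j<m. cnj (b k $$ (j, 0)) \<noteq> 0" if k: "k < r" for k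
  proof -
    obtain i j where "i < p" "j < m" "c k $$ (i, 0) * cnj (b k $$ (j, 0)) \<noteq> 0" using nz[OF k] by blast
    then show "\<exists>i<p. c k $$ (i, 0) \<noteq> 0" "\<exists>j<m. cnj (b k $$ (j, 0)) \<noteq> 0" by auto
  qed
  \<comment> \<open>A nonzero residue means that both of its vectors are nonzero, so generic
    \<open>u\<close> and \<open>v\<close> annihilate none of them.\<close>
  obtain u where u: "\<And>k. k < r \<Longrightarrow> (\<Sum>i<p. u i * c k $$ (i, 0)) \<noteq> 0"
  proof (rule generic_combination[of r p "\<lambda>k i. c k $$ (i, 0)"])
    show "\<exists>i<p. c k $$ (i, 0) \<noteq> 0" if "k < r" for k using that by (rule nzc)
  qed (rule that)
  obtain v where v: "\<And>k. k < r \<Longrightarrow> (\<Sum>j<m. v j * cnj (b k $$ (j, 0))) \<noteq> 0"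
  proof (rule generic_combination[of r m "\<lambda>k j. cnj (b k $$ (j, 0))"])
    show "\<exists>j<m. cnj (b k $$ (j, 0)) \<noteq> 0" if "k < r" for k using that by (rule nzb)
  qed (rule that)
  \<comment> \<open>The numbers 1 to \<open>2 r\<close>, split into two halves, as distinct
    interpolation points in the right half-plane.\<close>
  define mu where "mu i = complex_of_nat (Suc i)" for i
  define nu where "nu i = complex_of_nat (Suc (i + r))" for i
  interpret L: loewner p m r u v mu nu .
  define C0 where "C0 = Matrix.mat p r (\<lambda>(i, k). c k $$ (i, 0))"
  define B0 where "B0 = Matrix.mat r m (\<lambda>(k, j). cnj (b k $$ (j, 0)))"
  have C0: "C0 \<in> carrier_mat p r" and B0: "B0 \<in> carrier_mat r m" by (simp_all add: C0_def B0_def)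
  have C0i: "C0 $$ (i, k) = c k $$ (i, 0)" if "i < p" "k < r" for i k using that by (simp add: C0_def)
  have B0i: "B0 $$ (k, j) = cnj (b k $$ (j, 0))" if "k < r" "j < m" for k j using that by (simp add: B0_def)
  have uC: "(L.U * C0) $$ (0, k) \<noteq> 0" if "k < r" for k
    unfolding L.UG_index[OF C0 that] using u[OF that] that by (simp add: C0i)
  have Bv: "(B0 * L.V) $$ (k, 0) \<noteq> 0" if "k < r" for k
    unfolding L.GV_index[OF B0 that] using v[OF that] that by (simp add: B0i mult.commute)
  have G0: "\<gamma> 0 s = C0 * resolvent (mat_diag r lam) s * B0" if s: "Re s > 0" for s
  proof -
    have ne: "s \<noteq> lam k" if "k < r" for k using lam[OF that] s by auto
    have R: "resolvent (mat_diag r lam) s \<in> carrier_mat r r" by (rule resolvent_carrier[OF mat_diag_dim])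
    have CRB: "C0 * resolvent (mat_diag r lam) s * B0 \<in> carrier_mat p m"
      by (rule mult_carrier_mat[OF mult_carrier_mat[OF C0 R] B0])
    have Gs: "G s = Matrix.mat p m (\<lambda>(j, l). \<Sum>i<r. (c i * mat_adjoint (b i)) $$ (j, l) / (s - lam i))"
      using G s by (simp add: pole_residue_form_def)
    show ?thesis
    proof (rule eq_matI)
      fix i j assume "i < dim_row (C0 * resolvent (mat_diag r lam) s * B0)" "j < dim_col (C0 * resolvent (mat_diag r lam) s * B0)"
      then have ij: "i < p" "j < m" using carrier_matD[OF CRB] by simp_all
      have "\<gamma> 0 s $$ (i, j) = (\<Sum>k<r. (c k * mat_adjoint (b k)) $$ (i, j) / (s - lam k))"
        unfolding g0 Gs using ij by simp
      also have "\<dots> = (\<Sum>k<r. C0 $$ (i, k) * B0 $$ (k, j) / (s - lam k))"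
      proof (intro sum.cong refl)
        fix k assume "k \<in> {..<r}"
        then have k: "k < r" by simp
        show "(c k * mat_adjoint (b k)) $$ (i, j) / (s - lam k) = C0 $$ (i, k) * B0 $$ (k, j) / (s - lam k)"
          using mult_mat_index[OF bc(2)[OF k] mat_adjoint_carrier[OF bc(1)[OF k]] ij]
            mat_adjoint_index[OF bc(1)[OF k], of 0 j] ij k by (simp add: C0i B0i)
      qed
      also have "\<dots> = (C0 * resolvent (mat_diag r lam) s * B0) $$ (i, j)"
        by (rule diag_realization_index[OF C0 B0 ne ij, symmetric])
      finally show "\<gamma> 0 s $$ (i, j) = (C0 * resolvent (mat_diag r lam) s * B0) $$ (i, j)" .
    qed (use carrier_matD[OF CRB] in \<open>simp_all add: g0 Gs\<close>)
  qed
  have Gh: "\<exists>A B C. realization p m r A B C \<and> hurwitz A \<and> (\<forall>s. Re s > 0 \<longrightarrow> \<gamma> h s = transfer A B C s)" if "\<bar>h\<bar> < \<epsilon>" for h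
    using M[of h] that unfolding manifold_M_def minimal_realization_def by (auto simp: abs_less_iff)
  have H2g: "\<gamma> h \<in> H2 p m" if "\<bar>h\<bar> < \<epsilon>" for h
    using M[of h] that by (intro manifold_M_subset_H2) (auto simp: abs_less_iff)
  \<comment> \<open>The evaluation bound is applied to the difference between the difference
    quotient and \<open>V\<close>, whose Hardy norm tends to 0.\<close>
  have lim: "((\<lambda>h. (complex_of_real (1 / h) \<cdot>\<^sub>m (\<gamma> h s - \<gamma> 0 s)) $$ (i, j)) \<longlongrightarrow> V s $$ (i, j)) (at 0)"
    if s: "Re s > 0" and ij: "i < p" "j < m" for s i j
  proof -
    define Q where "Q h s = complex_of_real (1 / h) \<cdot>\<^sub>m (\<gamma> h s - \<gamma> 0 s)" for h s
    have QV: "((\<lambda>h. h2_norm p m (\<lambda>s. Q h s - V s)) \<longlongrightarrow> 0) (at 0)"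
      using der unfolding h2_has_derivative_at_def Q_def by simp
    have near: "\<forall>\<^sub>F h in at 0. \<bar>h\<bar> < \<epsilon>" using \<epsilon> by (auto simp: eventually_at intro!: exI[of _ \<epsilon>])
    obtain K where K: "K \<ge> 0" "\<And>F. F \<in> H2 p m \<Longrightarrow> cmod (F s $$ (i, j)) \<le> K * h2_norm p m F"
      using h2_norm_eval_bound[OF ij s] by blast
    have "((\<lambda>h. Q h s $$ (i, j) - V s $$ (i, j)) \<longlongrightarrow> 0) (at 0)"
    proof (rule Lim_null_comparison)
      show "((\<lambda>h. K * h2_norm p m (\<lambda>s. Q h s - V s)) \<longlongrightarrow> 0) (at 0)"
        using tendsto_mult[OF tendsto_const QV, of K] by simp
      show "\<forall>\<^sub>F h in at 0. norm (Q h s $$ (i, j) - V s $$ (i, j)) \<le> K * h2_norm p m (\<lambda>s. Q h s - V s)"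
        using near
      proof eventually_elim
        case (elim h)
        have "(\<lambda>s. Q h s - V s) \<in> H2 p m"
          unfolding Q_def using \<epsilon> by (intro H2_diff H2_smult H2g V2 elim) simp
        from K(2)[OF this] show ?case
          using carrier_matD[OF H2_carrier[OF V2 s]] ij by simp
      qed
    qed
    from tendsto_add[OF this tendsto_const[of "V s $$ (i, j)"]] show ?thesis by (simp add: Q_def)
  qed
  have m1: "inj_on mu {..<r}" "inj_on nu {..<r}" by (auto simp: mu_def nu_def inj_on_def simp del: of_nat_Suc)
  have m2: "Re (mu k) > 0" "Re (nu k) > 0" for k by (simp_all add: mu_def nu_def)
  have m3: "mu i \<noteq> nu j" if "i < r" "j < r" for i j
    using that by (simp add: mu_def nu_def del: of_nat_Suc)
  show thesis
  proof (rule L.tangent_explicit[where D=V and G=\<gamma>, OF B0 C0 lami lam m1(1) m2(1) m1(2) m2(2) m3 uC Bv G0 \<epsilon> Gh lim])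
    fix al be k0 k1 :: "nat \<Rightarrow> nat \<Rightarrow> complex"
    assume ex: "\<And>s j l. Re s > 0 \<Longrightarrow> j < p \<Longrightarrow> l < m \<Longrightarrow> V s $$ (j, l) =
       (\<Sum>k<r. C0 $$ (j, k) * be k l * (1 / (s - lam k))) + (\<Sum>k<r. al j k * B0 $$ (k, l) * (1 / (s - lam k)))
       - (\<Sum>k<r. \<Sum>n<r. C0 $$ (j, k) * B0 $$ (n, l) * ((k0 k n + k1 k n * s) / ((s - lam k) * (s - lam n))))"
    show thesis
    proof (rule that[OF _ V2])
      fix s i j assume s: "0 < Re s" and ij: "i < p" "j < m"
      show "V s $$ (i, j) = (\<Sum>k<r. c k $$ (i, 0) * be k j * (1 / (s - lam k))) + (\<Sum>k<r. al i k * cnj (b k $$ (j, 0)) * (1 / (s - lam k)))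
         - (\<Sum>k<r. \<Sum>n<r. c k $$ (i, 0) * cnj (b n $$ (j, 0)) * ((k0 k n + k1 k n * s) / ((s - lam k) * (s - lam n))))"
        unfolding ex[OF s ij] using ij
        by (intro arg_cong2[where f="(-)"] arg_cong2[where f="(+)"] sum.cong refl) (simp_all add: C0i B0i)
    qed
  qed
qed

theorem corollary6p4:
  fixes p m r :: nat
    and H Hk Hk1 :: "complex \<Rightarrow> complex mat"
    and lam :: "nat \<Rightarrow> complex"
    and b c :: "nat \<Rightarrow> complex mat"
  assumes "H \<in> H2 p m"
    and "Hk \<in> manifold_M p m r"
    and "Hk1 \<in> manifold_M p m r"
    and "pole_residue_form p m r Hk lam b c"
    and "inj_on lam {..<r}"
    and "irka_next p m r H lam b c Hk1"
  shows "h2_perp p m (\<lambda>s. H s - Hk1 s) (tangent_space p m r Hk) \<and>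
    is_projection_along (manifold_M p m r) (mfd_normal_space p m r Hk) H Hk1"
proof -
  have H1: "Hk1 \<in> H2 p m" by (rule manifold_M_subset_H2[OF assms(3)])
  define F where "F s = H s - Hk1 s" for s
  have F: "F \<in> H2 p m" unfolding F_def[abs_def] by (rule H2_diff[OF assms(1) H1])
  have bc: "b k \<in> carrier_mat m 1" "c k \<in> carrier_mat p 1" if "k < r" for k
    using assms(4) that by (auto simp: pole_residue_form_def)
  obtain A B C where ABC: "minimal_realization p m r A B C" "hurwitz A" "\<And>s. Re s > 0 \<Longrightarrow> Hk s = transfer A B C s"
    using assms(2) unfolding manifold_M_def by auto
  have res: "transfer A B C s $$ (j, l) = (\<Sum>i<r. c i $$ (j, 0) * cnj (b i $$ (l, 0)) / (s - lam i))"
    if s: "Re s > 0" and jl: "j < p" "l < m" for s j l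
  proof -
    have "Hk s = Matrix.mat p m (\<lambda>(j, l). \<Sum>i<r. (c i * mat_adjoint (b i)) $$ (j, l) / (s - lam i))"
      using assms(4) s by (simp add: pole_residue_form_def)
    then have "transfer A B C s $$ (j, l) = (\<Sum>i<r. (c i * mat_adjoint (b i)) $$ (j, l) / (s - lam i))"
      using ABC(3)[OF s] jl by simp
    also have "\<dots> = (\<Sum>i<r. c i $$ (j, 0) * cnj (b i $$ (l, 0)) / (s - lam i))"
    proof (intro sum.cong refl)
      fix i assume "i \<in> {..<r}"
      then have i: "i < r" by simp
      show "(c i * mat_adjoint (b i)) $$ (j, l) / (s - lam i) = c i $$ (j, 0) * cnj (b i $$ (l, 0)) / (s - lam i)"
        using mult_mat_index[OF bc(2)[OF i] mat_adjoint_carrier[OF bc(1)[OF i]] jl]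
          mat_adjoint_index[OF bc(1)[OF i], of 0 l] jl by simp
    qed
    finally show ?thesis .
  qed
  have nz: "\<exists>i<p. \<exists>j<m. c k $$ (i, 0) * cnj (b k $$ (j, 0)) \<noteq> 0" if "k < r" for k
    by (rule minimal_realization_residue_nonzero[OF ABC(1,2) bc res that])
  have real: "realization p m r A B C" using ABC(1) by (simp add: minimal_realization_def)
  \<comment> \<open>This places the interpolation points \<open>- cnj (lam k)\<close> in the
    half-plane on which \<open>H\<close> is holomorphic.\<close>
  have lam: "Re (lam k) < 0" if k: "k < r" for k
  proof -
    obtain j l where jl: "j < p" "l < m" "c k $$ (j, 0) * cnj (b k $$ (l, 0)) \<noteq> 0" using nz[OF k] by blast
    have "eigenvalue A (lam k)"
      by (rule pole_is_eigenvalue[where rho="\<lambda>i. c i $$ (j, 0) * cnj (b i $$ (l, 0))",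
          OF real ABC(2) jl(1,2) res[OF _ jl(1,2)] assms(5) k jl(3)])
    then show ?thesis using ABC(2) by (simp add: hurwitz_def)
  qed
  have \<sigma>: "Re (- cnj (lam k)) > 0" if "k < r" for k using lam[OF that] by simp
  have Hc: "H s \<in> carrier_mat p m" "Hk1 s \<in> carrier_mat p m" if "Re s > 0" for s
    using H2_carrier[OF assms(1) that] H2_carrier[OF H1 that] by auto
  have Fi: "F s $$ (i, j) = H s $$ (i, j) - Hk1 s $$ (i, j)" if "Re s > 0" "i < p" "j < m" for s i j
    using carrier_matD[OF Hc(2)[OF that(1)]] that by (simp add: F_def)
  have irka: "H (- cnj (lam k)) * b k = Hk1 (- cnj (lam k)) * b k"
    "mat_adjoint (c k) * H (- cnj (lam k)) = mat_adjoint (c k) * Hk1 (- cnj (lam k))"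
    "mat_adjoint (c k) * deriv_mat p m H (- cnj (lam k)) * b k = mat_adjoint (c k) * deriv_mat p m Hk1 (- cnj (lam k)) * b k"
    if "k < r" for k
    using assms(6) that by (simp_all add: irka_next_def Let_def)
  have right: "(\<Sum>j<m. F (- cnj (lam k)) $$ (i, j) * b k $$ (j, 0)) = 0" if k: "k < r" and i: "i < p" for k i
  proof -
    have idx: "(X * b k) $$ (i, 0) = (\<Sum>j<m. X $$ (i, j) * b k $$ (j, 0))" if "X \<in> carrier_mat p m" for X
      by (rule mult_mat_index[OF that bc(1)[OF k] i]) simp
    have "(\<Sum>j<m. H (- cnj (lam k)) $$ (i, j) * b k $$ (j, 0)) = (\<Sum>j<m. Hk1 (- cnj (lam k)) $$ (i, j) * b k $$ (j, 0))"
      using irka(1)[OF k] idx[OF Hc(1)[OF \<sigma>[OF k]]] idx[OF Hc(2)[OF \<sigma>[OF k]]] by simp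
    then show ?thesis using i by (simp add: Fi[OF \<sigma>[OF k]] left_diff_distrib sum_subtractf)
  qed
  have left: "(\<Sum>i<p. cnj (c k $$ (i, 0)) * F (- cnj (lam k)) $$ (i, j)) = 0" if k: "k < r" and j: "j < m" for k j
  proof -
    have idx: "(mat_adjoint (c k) * X) $$ (0, j) = (\<Sum>i<p. cnj (c k $$ (i, 0)) * X $$ (i, j))" if "X \<in> carrier_mat p m" for X
      using mult_mat_index[OF mat_adjoint_carrier[OF bc(2)[OF k]] that _ j, of 0]
      by (simp add: mat_adjoint_index[OF bc(2)[OF k]])
    have "(\<Sum>i<p. cnj (c k $$ (i, 0)) * H (- cnj (lam k)) $$ (i, j)) = (\<Sum>i<p. cnj (c k $$ (i, 0)) * Hk1 (- cnj (lam k)) $$ (i, j))"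
      using irka(2)[OF k] idx[OF Hc(1)[OF \<sigma>[OF k]]] idx[OF Hc(2)[OF \<sigma>[OF k]]] by simp
    then show ?thesis using j by (simp add: Fi[OF \<sigma>[OF k]] right_diff_distrib sum_subtractf)
  qed
  have der: "(\<Sum>i<p. \<Sum>j<m. cnj (c k $$ (i, 0)) * deriv (\<lambda>s. F s $$ (i, j)) (- cnj (lam k)) * b k $$ (j, 0)) = 0" if k: "k < r" for k
  proof -
    let ?\<sigma> = "- cnj (lam k)"
    \<comment> \<open>The entries of \<open>F\<close> split as differences only where the matrix
      sizes are known, namely in the right half-plane; a neighbourhood of the point suffices for the
      derivative.\<close>
    have dF: "deriv (\<lambda>s. F s $$ (i, j)) ?\<sigma> = deriv (\<lambda>s. H s $$ (i, j)) ?\<sigma> - deriv (\<lambda>s. Hk1 s $$ (i, j)) ?\<sigma>"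
      if ij: "i < p" "j < m" for i j
    proof -
      have d: "(\<lambda>s. H s $$ (i, j)) field_differentiable at ?\<sigma>" "(\<lambda>s. Hk1 s $$ (i, j)) field_differentiable at ?\<sigma>"
        using holomorphic_on_imp_differentiable_at[OF hardy2_holomorphic[OF H2_hardy2[OF assms(1) ij]] open_rhp]
          holomorphic_on_imp_differentiable_at[OF hardy2_holomorphic[OF H2_hardy2[OF H1 ij]] open_rhp] \<sigma>[OF k] by auto
      have "\<forall>\<^sub>F s in nhds ?\<sigma>. s \<in> {s. Re s > 0}"
        by (rule eventually_nhds_in_open[OF open_rhp]) (use \<sigma>[OF k] in simp)
      then have "\<forall>\<^sub>F s in nhds ?\<sigma>. F s $$ (i, j) = H s $$ (i, j) - Hk1 s $$ (i, j)"
        by eventually_elim (simp add: Fi ij)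
      then have "deriv (\<lambda>s. F s $$ (i, j)) ?\<sigma> = deriv (\<lambda>s. H s $$ (i, j) - Hk1 s $$ (i, j)) ?\<sigma>"
        by (rule deriv_cong_ev) simp
      then show ?thesis using deriv_diff[OF d] by simp
    qed
    have idx: "(mat_adjoint (c k) * deriv_mat p m X ?\<sigma> * b k) $$ (0, 0)
        = (\<Sum>i<p. \<Sum>j<m. cnj (c k $$ (i, 0)) * deriv (\<lambda>s. X s $$ (i, j)) ?\<sigma> * b k $$ (j, 0))" for X
    proof -
      have D: "deriv_mat p m X ?\<sigma> \<in> carrier_mat p m" by (simp add: deriv_mat_def)
      note cD = mult_carrier_mat[OF mat_adjoint_carrier[OF bc(2)[OF k]] D]
      have "(mat_adjoint (c k) * deriv_mat p m X ?\<sigma> * b k) $$ (0, 0)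
        = (\<Sum>j<m. (\<Sum>i<p. cnj (c k $$ (i, 0)) * deriv_mat p m X ?\<sigma> $$ (i, j)) * b k $$ (j, 0))"
        unfolding mult_mat_index[OF cD bc(1)[OF k] zero_lt_one_nat zero_lt_one_nat]
      proof (intro sum.cong refl arg_cong2[where f="(*)"])
        fix j assume "j \<in> {..<m}"
        then show "(mat_adjoint (c k) * deriv_mat p m X ?\<sigma>) $$ (0, j) = (\<Sum>i<p. cnj (c k $$ (i, 0)) * deriv_mat p m X ?\<sigma> $$ (i, j))"
          using mult_mat_index[OF mat_adjoint_carrier[OF bc(2)[OF k]] D zero_lt_one_nat, of j]
          by (simp add: mat_adjoint_index[OF bc(2)[OF k]])
      qed
      also have "\<dots> = (\<Sum>j<m. \<Sum>i<p. cnj (c k $$ (i, 0)) * deriv (\<lambda>s. X s $$ (i, j)) ?\<sigma> * b k $$ (j, 0))"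
        by (intro sum.cong refl) (simp add: deriv_mat_def sum_distrib_right)
      also have "\<dots> = (\<Sum>i<p. \<Sum>j<m. cnj (c k $$ (i, 0)) * deriv (\<lambda>s. X s $$ (i, j)) ?\<sigma> * b k $$ (j, 0))"
        by (rule sum.swap)
      finally show ?thesis .
    qed
    have "(\<Sum>i<p. \<Sum>j<m. cnj (c k $$ (i, 0)) * deriv (\<lambda>s. F s $$ (i, j)) ?\<sigma> * b k $$ (j, 0))
      = (\<Sum>i<p. \<Sum>j<m. cnj (c k $$ (i, 0)) * deriv (\<lambda>s. H s $$ (i, j)) ?\<sigma> * b k $$ (j, 0)
           - cnj (c k $$ (i, 0)) * deriv (\<lambda>s. Hk1 s $$ (i, j)) ?\<sigma> * b k $$ (j, 0))"
      by (intro sum.cong refl) (simp add: dF left_diff_distrib right_diff_distrib)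
    also have "\<dots> = 0"
      using irka(3)[OF k] idx[of H] idx[of Hk1] by (simp only: sum_subtractf diff_self)
    finally show ?thesis .
  qed
  have perp: "h2_perp p m F (tangent_space p m r Hk)"
    unfolding h2_perp_def
  proof
    fix V assume V: "V \<in> tangent_space p m r Hk"
    show "h2_inner p m F V = 0"
    proof (rule tangent_space_explicit[OF V assms(4,5)])
      show "Re (lam k) < 0" if "k < r" for k using that by (rule lam)
      show "\<exists>i<p. \<exists>j<m. c k $$ (i, 0) * cnj (b k $$ (j, 0)) \<noteq> 0" if "k < r" for k using that by (rule nz)
      fix al be k0 k1 :: "nat \<Rightarrow> nat \<Rightarrow> complex"
      assume ex: "\<And>s i j. Re s > 0 \<Longrightarrow> i < p \<Longrightarrow> j < m \<Longrightarrow> V s $$ (i, j) =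
         (\<Sum>k<r. c k $$ (i, 0) * be k j * (1 / (s - lam k))) + (\<Sum>k<r. al i k * cnj (b k $$ (j, 0)) * (1 / (s - lam k)))
         - (\<Sum>k<r. \<Sum>n<r. c k $$ (i, 0) * cnj (b n $$ (j, 0)) * ((k0 k n + k1 k n * s) / ((s - lam k) * (s - lam n))))"
        and V2: "V \<in> H2 p m"
      show "h2_inner p m F V = 0"
        by (rule h2_inner_partial_fractions_zero[where c="\<lambda>k i. c k $$ (i, 0)" and b="\<lambda>k j. b k $$ (j, 0)"
            and al=al and be=be and ?k0.0=k0 and ?k1.0=k1, OF F V2 lam ex right left der assms(5)])
    qed
  qed
  \<comment> \<open>The projection statement is the orthogonality together with membership of the
    error in the Hardy space.\<close>
  have "F \<in> mfd_normal_space p m r Hk"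
    using F perp by (simp add: mfd_normal_space_def h2_orth_compl_def)
  then show ?thesis
    using perp assms(3) unfolding is_projection_along_def F_def[abs_def] by blast
qed

end
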